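(* Let $\mathcal{H}$ be a complex Hilbert space and let $T\in\mathcal{B}(\mathcal{H})$ be a concave operator. Then: (i) $T$ has a $2$-isometric lifting $S$ on a Hilbert space $\mathcal{K}=\mathcal{H}^{\perp}\oplus\mathcal{H}$ with covariance ${\rm cov}(S)=\sqrt{2}\,\max\{1,\|\Delta_T\|^{1/2}\}$ and having a block matrix of the form $$S=\begin{pmatrix} W & X\\ 0 & T\end{pmatrix}\ \text{on}\ \begin{bmatrix}\mathcal{H}^{\perp}\\ \mathcal{H}\end{bmatrix},\qquad W=\begin{pmatrix} S_+^1 & \sqrt{2}E_0\\ 0 & S_+^0\end{pmatrix}\ \text{on}\ \begin{bmatrix}\mathcal{H}_1\\ \mathcal{H}_0\end{bmatrix},\qquad W^*X=0,$$ where $W$ is a $2$-isometry on a nontrivial decomposition $\mathcal{H}^{\perp}=\mathcal{H}_1\oplus\mathcal{H}_0$, $S_+^1$ and $S_+^0$ are unilateral shifts (on $\mathcal{H}_1$ and $\mathcal{H}_0$ respectively), $E_0:\mathcal{H}_0\to\mathcal{H}_1$ is an isometry, and $X:\mathcal{H}\to\mathcal{H}^\perp$ is a bounded operator. (ii) $T$ has a minimal $2$-isometric lifting $S$ on some $\mathcal{K}=\mathcal{H}^\perp\oplus\mathcal{H}$, of the form $S=\begin{pmatrix} W & X\\ 0 & T\end{pmatrix}$ on $\mathcal{H}^\perp\oplus\mathcal{H}$, where $W=S|_{\mathcal{H}^{\perp}}$ is an isometry, $W^*X=0$, and ${\rm cov}(S)=\|\Delta_T\|^{1/2}$.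
   Context: For $T\in\mathcal{B}(\mathcal{H})$ put $\Delta_T=T^*T-I$. $T$ is concave if $T^{*2}T^2-2T^*T+I\le 0$, and a $2$-isometry if $T^{*2}T^2-2T^*T+I=0$. For a $2$-isometry $S$, the covariance is ${\rm cov}(S)=\|\Delta_S\|^{1/2}$. If $\mathcal{H}$ is a closed subspace of $\mathcal{K}$, an operator $S\in\mathcal{B}(\mathcal{K})$ is a lifting of $T$ if $P_{\mathcal{H}}S=TP_{\mathcal{H}}$ (equivalently $\mathcal{H}$ is invariant for $S^*$ and $S^*|_{\mathcal{H}}=T^*$). A lifting $S$ is minimal if $\mathcal{K}=\bigvee_{n\ge0}S^n\mathcal{H}$ (closed linear span). *)

theory Defs
  imports Complex_Main
begin

text \<open>Abstract complex inner product spaces, given by a carrier set together with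
  the vector space operations and a complex inner product (linear in the first
  argument). Operators are functions; only their values on carriers matter.\<close>

record 'v cips =
  hcar   :: "'v set"
  hadd   :: "'v \<Rightarrow> 'v \<Rightarrow> 'v"
  hscale :: "complex \<Rightarrow> 'v \<Rightarrow> 'v"
  hzero  :: "'v"
  hinner :: "'v \<Rightarrow> 'v \<Rightarrow> complex"

definition hsub :: "'v cips \<Rightarrow> 'v \<Rightarrow> 'v \<Rightarrow> 'v" where
  "hsub V x y = hadd V x (hscale V (-1) y)"

definition hnorm :: "'v cips \<Rightarrow> 'v \<Rightarrow> real" where
  "hnorm V x = sqrt (Re (hinner V x x))"

definition hilbert_space :: "'v cips \<Rightarrow> bool" where
  "hilbert_space V \<longleftrightarrow>
     (let C = hcar V in
      hzero V \<in> C \<and>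
      (\<forall>x\<in>C. \<forall>y\<in>C. hadd V x y \<in> C) \<and>
      (\<forall>a. \<forall>x\<in>C. hscale V a x \<in> C) \<and>
      (\<forall>x\<in>C. \<forall>y\<in>C. \<forall>z\<in>C. hadd V (hadd V x y) z = hadd V x (hadd V y z)) \<and>
      (\<forall>x\<in>C. \<forall>y\<in>C. hadd V x y = hadd V y x) \<and>
      (\<forall>x\<in>C. hadd V x (hzero V) = x) \<and>
      (\<forall>x\<in>C. hadd V x (hscale V (-1) x) = hzero V) \<and>
      (\<forall>a b. \<forall>x\<in>C. hscale V a (hscale V b x) = hscale V (a * b) x) \<and>
      (\<forall>x\<in>C. hscale V 1 x = x) \<and>
      (\<forall>a. \<forall>x\<in>C. \<forall>y\<in>C. hscale V a (hadd V x y) = hadd V (hscale V a x) (hscale V a y)) \<and>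
      (\<forall>a b. \<forall>x\<in>C. hscale V (a + b) x = hadd V (hscale V a x) (hscale V b x)) \<and>
      (\<forall>x\<in>C. \<forall>y\<in>C. hinner V y x = cnj (hinner V x y)) \<and>
      (\<forall>x\<in>C. \<forall>y\<in>C. \<forall>z\<in>C. hinner V (hadd V x y) z = hinner V x z + hinner V y z) \<and>
      (\<forall>a. \<forall>x\<in>C. \<forall>y\<in>C. hinner V (hscale V a x) y = a * hinner V x y) \<and>
      (\<forall>x\<in>C. 0 \<le> Re (hinner V x x)) \<and>
      (\<forall>x\<in>C. hinner V x x = 0 \<longrightarrow> x = hzero V) \<and>
      (\<forall>f. (\<forall>n. f n \<in> C) \<and>
           (\<forall>e>0. \<exists>N. \<forall>m\<ge>N. \<forall>n\<ge>N. hnorm V (hsub V (f m) (f n)) < e)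
           \<longrightarrow> (\<exists>l\<in>C. (\<lambda>n. hnorm V (hsub V (f n) l)) \<longlonglongrightarrow> 0)))"

definition bop :: "'v cips \<Rightarrow> 'w cips \<Rightarrow> ('v \<Rightarrow> 'w) \<Rightarrow> bool" where
  "bop V W A \<longleftrightarrow>
     (\<forall>x\<in>hcar V. A x \<in> hcar W) \<and>
     (\<forall>x\<in>hcar V. \<forall>y\<in>hcar V. A (hadd V x y) = hadd W (A x) (A y)) \<and>
     (\<forall>a. \<forall>x\<in>hcar V. A (hscale V a x) = hscale W a (A x)) \<and>
     (\<exists>c. \<forall>x\<in>hcar V. hnorm W (A x) \<le> c * hnorm V x)"

definition opnorm :: "'v cips \<Rightarrow> 'w cips \<Rightarrow> ('v \<Rightarrow> 'w) \<Rightarrow> real" where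
  "opnorm V W A = Sup ((\<lambda>x. hnorm W (A x)) ` {x \<in> hcar V. hnorm V x \<le> 1})"

text \<open>Hilbert space adjoint (unique on the carrier for bounded operators between
  Hilbert spaces).\<close>
definition hadj :: "'v cips \<Rightarrow> 'w cips \<Rightarrow> ('v \<Rightarrow> 'w) \<Rightarrow> ('w \<Rightarrow> 'v)" where
  "hadj V W A = (SOME B. bop W V B \<and>
      (\<forall>x\<in>hcar V. \<forall>y\<in>hcar W. hinner W (A x) y = hinner V x (B y)))"

definition isometry :: "'v cips \<Rightarrow> 'w cips \<Rightarrow> ('v \<Rightarrow> 'w) \<Rightarrow> bool" where
  "isometry V W A \<longleftrightarrow> bop V W A \<and> (\<forall>x\<in>hcar V. hnorm W (A x) = hnorm V x)"

definition twoiso_op :: "'v cips \<Rightarrow> ('v \<Rightarrow> 'v) \<Rightarrow> 'v \<Rightarrow> 'v" where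
  "twoiso_op V T x =
     hadd V (hsub V (hadj V V T (hadj V V T (T (T x))))
                    (hscale V 2 (hadj V V T (T x)))) x"

definition op_nonpos :: "'v cips \<Rightarrow> ('v \<Rightarrow> 'v) \<Rightarrow> bool" where
  "op_nonpos V A \<longleftrightarrow> (\<forall>x\<in>hcar V. Im (hinner V (A x) x) = 0 \<and> Re (hinner V (A x) x) \<le> 0)"

definition concave_op :: "'v cips \<Rightarrow> ('v \<Rightarrow> 'v) \<Rightarrow> bool" where
  "concave_op V T \<longleftrightarrow> bop V V T \<and> op_nonpos V (twoiso_op V T)"

definition two_isometry :: "'v cips \<Rightarrow> ('v \<Rightarrow> 'v) \<Rightarrow> bool" where
  "two_isometry V S \<longleftrightarrow> bop V V S \<and> (\<forall>x\<in>hcar V. twoiso_op V S x = hzero V)"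

definition Delta :: "'v cips \<Rightarrow> ('v \<Rightarrow> 'v) \<Rightarrow> 'v \<Rightarrow> 'v" where
  "Delta V T x = hsub V (hadj V V T (T x)) x"

definition cov :: "'v cips \<Rightarrow> ('v \<Rightarrow> 'v) \<Rightarrow> real" where
  "cov V S = sqrt (opnorm V V (Delta V S))"

definition closed_subspace :: "'v cips \<Rightarrow> 'v set \<Rightarrow> bool" where
  "closed_subspace V L \<longleftrightarrow> L \<subseteq> hcar V \<and> hzero V \<in> L \<and>
     (\<forall>x\<in>L. \<forall>y\<in>L. hadd V x y \<in> L) \<and> (\<forall>a. \<forall>x\<in>L. hscale V a x \<in> L) \<and>
     (\<forall>f l. (\<forall>n. f n \<in> L) \<and> l \<in> hcar V \<and> (\<lambda>n. hnorm V (hsub V (f n) l)) \<longlonglongrightarrow> 0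
            \<longrightarrow> l \<in> L)"

definition closed_span :: "'v cips \<Rightarrow> 'v set \<Rightarrow> 'v set" where
  "closed_span V M = \<Inter> {L. closed_subspace V L \<and> M \<subseteq> L}"

text \<open>Unilateral shift (Halmos): an isometry S for which there is a wandering
  subspace L, i.e. the spaces \<open>S^n L\<close> are mutually orthogonal and V is their
  orthogonal sum \<open>\<Oplus>_{n\<ge>0} S^n L\<close>.\<close>
definition unilateral_shift :: "'v cips \<Rightarrow> ('v \<Rightarrow> 'v) \<Rightarrow> bool" where
  "unilateral_shift V S \<longleftrightarrow> isometry V V S \<and>
     (\<exists>L. closed_subspace V L \<and>
          (\<forall>m n. m \<noteq> n \<longrightarrow> (\<forall>x\<in>L. \<forall>y\<in>L. hinner V ((S^^m) x) ((S^^n) y) = 0)) \<and>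
          closed_span V (\<Union>n. (S^^n) ` L) = hcar V)"

definition dsum :: "'a cips \<Rightarrow> 'b cips \<Rightarrow> ('a \<times> 'b) cips" where
  "dsum A B = \<lparr> hcar = hcar A \<times> hcar B,
      hadd = (\<lambda>(a, b) (c, d). (hadd A a c, hadd B b d)),
      hscale = (\<lambda>s (a, b). (hscale A s a, hscale B s b)),
      hzero = (hzero A, hzero B),
      hinner = (\<lambda>(a, b) (c, d). hinner A a c + hinner B b d) \<rparr>"

definition upper_blk :: "'a cips \<Rightarrow> ('a \<Rightarrow> 'a) \<Rightarrow> ('b \<Rightarrow> 'a) \<Rightarrow> ('b \<Rightarrow> 'b) \<Rightarrow> 'a \<times> 'b \<Rightarrow> 'a \<times> 'b" where
  "upper_blk A P Q R = (\<lambda>(x, y). (hadd A (P x) (Q y), R y))"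

text \<open>S on \<open>K = G \<oplus> H\<close> (H identified with \<open>{0} \<times> H\<close>, G = \<open>H\<^sup>\<perp>\<close>) is a lifting of T:
  \<open>P_H S = T P_H\<close>.\<close>
definition is_lifting :: "'g cips \<Rightarrow> 'h cips \<Rightarrow> ('g \<times> 'h \<Rightarrow> 'g \<times> 'h) \<Rightarrow> ('h \<Rightarrow> 'h) \<Rightarrow> bool" where
  "is_lifting G H S T \<longleftrightarrow>
     (\<forall>g\<in>hcar G. \<forall>h\<in>hcar H. (hzero G, snd (S (g, h))) = (hzero G, T h))"

definition minimal_lifting :: "'g cips \<Rightarrow> 'h cips \<Rightarrow> ('g \<times> 'h \<Rightarrow> 'g \<times> 'h) \<Rightarrow> ('h \<Rightarrow> 'h) \<Rightarrow> bool" where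
  "minimal_lifting G H S T \<longleftrightarrow> is_lifting G H S T \<and>
     closed_span (dsum G H) (\<Union>n. (S^^n) ` ({hzero G} \<times> hcar H)) = hcar (dsum G H)"

text \<open>Fixed carrier type for the auxiliary spaces (large enough for all
  countable constructions over H, e.g. \<open>\<ell>\<^sup>2_+(D)\<close> with D built from H).\<close>
type_synonym 'a bigT = "nat \<Rightarrow> 'a \<times> complex"

end

theory Submission
  imports Defs
begin

text \<open>Write \<open>\<Delta>(x) = \<parallel>T x\<parallel>\<^sup>2 - \<parallel>x\<parallel>\<^sup>2\<close>. Concavity makes \<open>n \<mapsto> \<parallel>T\<^sup>n x\<parallel>\<^sup>2\<close> a concave nonnegative
  sequence, hence increasing, so \<open>\<Delta> \<ge> 0\<close>, and \<open>\<Delta> \<circ> T \<le> \<Delta>\<close>. If \<open>W\<^sup>*X = 0\<close>, the block operator \<open>S\<close> has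
  defect \<open>\<Delta>\<^sub>S = \<Delta>\<^sub>W \<oplus> (\<Delta> + X\<^sup>*X)\<close>, and it is a 2-isometry as soon as \<open>\<Delta>\<^sub>S \<circ> S = \<Delta>\<^sub>S\<close>. The auxiliary
  spaces live in \<open>E = \<ell>\<^sup>2(H \<oplus> \<complex>)\<close>, where the summand \<open>\<complex>\<close> keeps \<open>E\<close> nonzero: every bounded positive
  form on \<open>H\<close> is \<open>\<parallel>X h\<parallel>\<^sup>2\<close> for some \<open>X : H \<rightarrow> E\<close>, and moving coordinates to the residue classes
  modulo 3 makes the ranges of the operators involved orthogonal.

  For (i), \<open>\<Delta>\<^sub>W = 0 \<oplus> 2 I\<close>; taking \<open>X = (X\<^sub>1, X\<^sub>0)\<close> with \<open>\<parallel>X\<^sub>1 h\<parallel>\<^sup>2 = \<Delta>(T h)\<close> and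
  \<open>\<parallel>X\<^sub>0 h\<parallel>\<^sup>2 = \<Delta>(h) - \<Delta>(T h)\<close> makes \<open>\<Delta>\<^sub>S = 0 \<oplus> 2 I \<oplus> 2 \<Delta>\<close> invariant.

  For (ii), \<open>\<Delta>\<^sub>W = 0\<close> and \<open>\<Delta>\<^sub>S = 0 \<oplus> q\<close> with \<open>q = \<Delta> + X\<^sup>*X\<close>, so one needs a form \<open>\<Delta> \<le> q \<le> c = \<parallel>\<Delta>\<parallel>\<close>
  with \<open>q \<circ> T = q\<close>. It is the increasing limit of forms with \<open>q\<^sub>0 = \<Delta>\<close> and \<open>q\<^sub>n\<^sub>+\<^sub>1 \<circ> T = q\<^sub>n\<close>: since
  \<open>c \<parallel>T x\<parallel>\<^sup>2 - q\<^sub>n(x) \<le> (c - q\<^sub>n)(T x)\<close>, Douglas' factorization lemma yields a form \<open>0 \<le> p \<le> c - q\<^sub>n\<close>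
  with \<open>p(T x) = c \<parallel>T x\<parallel>\<^sup>2 - q\<^sub>n(x)\<close>, and \<open>q\<^sub>n\<^sub>+\<^sub>1 = c - p\<close>.\<close>

section \<open>Inner product spaces\<close>

definition hsq :: "'v cips \<Rightarrow> 'v \<Rightarrow> real" where
  "hsq V x = Re (hinner V x x)"

definition tends_to :: "'v cips \<Rightarrow> (nat \<Rightarrow> 'v) \<Rightarrow> 'v \<Rightarrow> bool" where
  "tends_to V f l \<longleftrightarrow> (\<lambda>n. hnorm V (hsub V (f n) l)) \<longlonglongrightarrow> 0"

definition cauchy_seq :: "'v cips \<Rightarrow> (nat \<Rightarrow> 'v) \<Rightarrow> bool" where
  "cauchy_seq V f \<longleftrightarrow> (\<forall>e>0. \<exists>N. \<forall>m\<ge>N. \<forall>n\<ge>N. hnorm V (hsub V (f m) (f n)) < e)"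

definition linear_subspace :: "'v cips \<Rightarrow> 'v set \<Rightarrow> bool" where
  "linear_subspace V L \<longleftrightarrow> L \<subseteq> hcar V \<and> hzero V \<in> L \<and>
     (\<forall>x\<in>L. \<forall>y\<in>L. hadd V x y \<in> L) \<and> (\<forall>a. \<forall>x\<in>L. hscale V a x \<in> L)"

locale inner_space =
  fixes V :: "'v cips"
  assumes zero_closed [simp, intro]: "hzero V \<in> hcar V"
    and add_closed [simp, intro]: "x \<in> hcar V \<Longrightarrow> y \<in> hcar V \<Longrightarrow> hadd V x y \<in> hcar V"
    and scale_closed [simp, intro]: "x \<in> hcar V \<Longrightarrow> hscale V a x \<in> hcar V"
    and add_assoc: "x \<in> hcar V \<Longrightarrow> y \<in> hcar V \<Longrightarrow> z \<in> hcar V \<Longrightarrow>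
        hadd V (hadd V x y) z = hadd V x (hadd V y z)"
    and add_comm: "x \<in> hcar V \<Longrightarrow> y \<in> hcar V \<Longrightarrow> hadd V x y = hadd V y x"
    and add_zero [simp]: "x \<in> hcar V \<Longrightarrow> hadd V x (hzero V) = x"
    and add_neg: "x \<in> hcar V \<Longrightarrow> hadd V x (hscale V (-1) x) = hzero V"
    and scale_scale: "x \<in> hcar V \<Longrightarrow> hscale V a (hscale V b x) = hscale V (a * b) x"
    and scale_one: "x \<in> hcar V \<Longrightarrow> hscale V 1 x = x"
    and scale_add_right: "x \<in> hcar V \<Longrightarrow> y \<in> hcar V \<Longrightarrow>
        hscale V a (hadd V x y) = hadd V (hscale V a x) (hscale V a y)"
    and scale_add_left: "x \<in> hcar V \<Longrightarrow> hscale V (a + b) x = hadd V (hscale V a x) (hscale V b x)"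
    and inner_cnj: "x \<in> hcar V \<Longrightarrow> y \<in> hcar V \<Longrightarrow> hinner V y x = cnj (hinner V x y)"
    and inner_add_left [simp]: "x \<in> hcar V \<Longrightarrow> y \<in> hcar V \<Longrightarrow> z \<in> hcar V \<Longrightarrow>
        hinner V (hadd V x y) z = hinner V x z + hinner V y z"
    and inner_scale_left [simp]: "x \<in> hcar V \<Longrightarrow> y \<in> hcar V \<Longrightarrow>
        hinner V (hscale V a x) y = a * hinner V x y"
    and inner_nonneg: "x \<in> hcar V \<Longrightarrow> 0 \<le> Re (hinner V x x)"
    and inner_definite: "x \<in> hcar V \<Longrightarrow> hinner V x x = 0 \<Longrightarrow> x = hzero V"

locale complete_space = inner_space +
  assumes complete: "(\<And>n. f n \<in> hcar V) \<Longrightarrow> cauchy_seq V f \<Longrightarrow> \<exists>l\<in>hcar V. tends_to V f l"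

lemma hilbert_space_iff: "hilbert_space V \<longleftrightarrow> complete_space V"
  unfolding hilbert_space_def complete_space_def complete_space_axioms_def inner_space_def
    cauchy_seq_def tends_to_def Let_def Ball_def
  by (simp only: atomize_all atomize_imp conj_assoc HOL.all_simps)
    (intro arg_cong2[of _ _ _ _ "(\<and>)"]; blast)

lemma le_of_square_le_mult:
  fixes r k :: real
  assumes "r * r \<le> k * r" "0 \<le> r" "0 \<le> k"
  shows "r \<le> k"
  using assms by (cases "r = 0") auto

lemma tendsto_zero_comparison:
  fixes f :: "nat \<Rightarrow> 'a::real_normed_vector"
  assumes "\<And>n. norm (f n) \<le> g n" "g \<longlonglongrightarrow> 0"
  shows "f \<longlonglongrightarrow> 0"
  by (rule tendsto_norm_zero_cancel, rule tendsto_sandwich[OF _ _ tendsto_const assms(2)])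
    (use assms(1) in auto)

text \<open>The polynomial is the form \<open>\<parallel>x - s \<langle>x, y\<rangle> y\<parallel>\<^sup>2\<close> for \<open>w = \<bar>\<langle>x, y\<rangle>\<bar>\<^sup>2\<close>.\<close>

lemma coefficient_le_of_nonneg_polynomial:
  fixes w B d :: real
  assumes "0 \<le> w" "0 \<le> B" and nonneg: "\<And>s. 0 \<le> d - 2 * s * w + s\<^sup>2 * w * B"
  shows "w \<le> d * B"
proof (cases "w = 0 \<or> B = 0")
  case True
  then show ?thesis
    using nonneg[of 0] nonneg[of "(d + 1) / (2 * w)"] assms(2) by (cases "w = 0") auto
next
  case False
  then have "d - 2 * (1/B) * w + (1/B)\<^sup>2 * w * B = d - w / B"
    by (simp add: field_simps power2_eq_square)
  then have "w / B \<le> d" using nonneg[of "1/B"] by linarith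
  then show ?thesis using False \<open>0 \<le> B\<close> by (simp add: pos_divide_le_eq)
qed

context inner_space
begin

lemma inner_add_right [simp]:
  "x \<in> hcar V \<Longrightarrow> y \<in> hcar V \<Longrightarrow> z \<in> hcar V \<Longrightarrow>
     hinner V z (hadd V x y) = hinner V z x + hinner V z y"
  using inner_cnj[of "hadd V x y" z] inner_cnj[of x z] inner_cnj[of y z] by simp

lemma inner_scale_right [simp]:
  "x \<in> hcar V \<Longrightarrow> y \<in> hcar V \<Longrightarrow> hinner V y (hscale V a x) = cnj a * hinner V y x"
  using inner_cnj[of "hscale V a x" y] inner_cnj[of x y] by simp

lemma sub_closed [simp, intro]: "x \<in> hcar V \<Longrightarrow> y \<in> hcar V \<Longrightarrow> hsub V x y \<in> hcar V"
  by (simp add: hsub_def)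

lemma inner_sub_left [simp]:
  "x \<in> hcar V \<Longrightarrow> y \<in> hcar V \<Longrightarrow> z \<in> hcar V \<Longrightarrow>
     hinner V (hsub V x y) z = hinner V x z - hinner V y z"
  by (simp add: hsub_def)

lemma inner_sub_right [simp]:
  "x \<in> hcar V \<Longrightarrow> y \<in> hcar V \<Longrightarrow> z \<in> hcar V \<Longrightarrow>
     hinner V z (hsub V x y) = hinner V z x - hinner V z y"
  by (simp add: hsub_def)

lemma inner_zero_left [simp]: "x \<in> hcar V \<Longrightarrow> hinner V (hzero V) x = 0"
  using inner_add_left[of "hzero V" "hzero V" x] by simp

lemma inner_zero_right [simp]: "x \<in> hcar V \<Longrightarrow> hinner V x (hzero V) = 0"
  using inner_cnj[of "hzero V" x] by simp

lemma inner_self: "x \<in> hcar V \<Longrightarrow> hinner V x x = complex_of_real (hsq V x)"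
  using arg_cong[OF inner_cnj[of x x], of Im] by (simp add: hsq_def complex_eq_iff)

lemma vector_eqI:
  assumes x: "x \<in> hcar V" and y: "y \<in> hcar V"
    and eq: "\<And>z. z \<in> hcar V \<Longrightarrow> hinner V x z = hinner V y z"
  shows "x = y"
proof -
  have "hinner V (hsub V x y) (hsub V x y) = 0"
    using x y eq[of "hsub V x y"] by (simp del: inner_sub_right)
  then have zero: "hadd V x (hscale V (-1) y) = hzero V"
    using x y inner_definite[of "hsub V x y"] by (simp add: hsub_def)
  have "x = hadd V x (hadd V (hscale V (-1) y) y)"
    using x y add_neg[of y] add_comm[of y "hscale V (-1) y"] by simp
  also have "\<dots> = hadd V (hzero V) y"
    using x y zero add_assoc[of x "hscale V (-1) y" y] by simp
  also have "\<dots> = y" using y add_comm[of y "hzero V"] by simp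
  finally show ?thesis .
qed

lemma add_left_comm:
  "x \<in> hcar V \<Longrightarrow> y \<in> hcar V \<Longrightarrow> z \<in> hcar V \<Longrightarrow> hadd V x (hadd V y z) = hadd V y (hadd V x z)"
  by (rule vector_eqI) auto

lemmas add_ac = add_assoc add_comm add_left_comm

lemma zero_add [simp]: "x \<in> hcar V \<Longrightarrow> hadd V (hzero V) x = x"
  using add_comm[of "hzero V" x] by simp

lemma scale_zero [simp]: "hscale V a (hzero V) = hzero V"
  by (rule vector_eqI) auto

lemma sub_self [simp]: "x \<in> hcar V \<Longrightarrow> hsub V x x = hzero V"
  by (rule vector_eqI) auto

lemma sub_zero [simp]: "x \<in> hcar V \<Longrightarrow> hsub V x (hzero V) = x"
  by (rule vector_eqI) auto

lemma sub_sub_cancel [simp]: "x \<in> hcar V \<Longrightarrow> y \<in> hcar V \<Longrightarrow> hsub V x (hsub V x y) = y"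
  by (rule vector_eqI) auto

lemma sub_add_cancel [simp]: "x \<in> hcar V \<Longrightarrow> y \<in> hcar V \<Longrightarrow> hadd V (hsub V x y) y = x"
  by (rule vector_eqI) auto

lemma hsq_nonneg [simp]: "x \<in> hcar V \<Longrightarrow> 0 \<le> hsq V x"
  by (simp add: hsq_def inner_nonneg)

lemma hnorm_nonneg [simp]: "x \<in> hcar V \<Longrightarrow> 0 \<le> hnorm V x"
  by (simp add: hnorm_def inner_nonneg)

lemma hnorm_sq: "x \<in> hcar V \<Longrightarrow> (hnorm V x)\<^sup>2 = hsq V x"
  by (simp add: hnorm_def hsq_def inner_nonneg)

lemma cmod_inner_self: "x \<in> hcar V \<Longrightarrow> cmod (hinner V x x) = hnorm V x * hnorm V x"
  using hnorm_sq[of x] by (simp add: inner_self power2_eq_square)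

lemma hsq_eq_0_iff: "x \<in> hcar V \<Longrightarrow> hsq V x = 0 \<longleftrightarrow> x = hzero V"
  using inner_definite[of x] inner_self[of x] by (metis inner_zero_left of_real_0 of_real_eq_0_iff)

lemma hsq_zero [simp]: "hsq V (hzero V) = 0"
  by (simp add: hsq_def)

lemma hnorm_zero [simp]: "hnorm V (hzero V) = 0"
  by (simp add: hnorm_def)

lemma hnorm_scale:
  assumes "x \<in> hcar V"
  shows "hnorm V (hscale V a x) = cmod a * hnorm V x"
proof -
  have "hinner V (hscale V a x) (hscale V a x) = of_real ((cmod a)\<^sup>2) * of_real (hsq V x)"
    using assms inner_self[of x] complex_norm_square[of a] by simp
  then have "hinner V (hscale V a x) (hscale V a x) = of_real ((cmod a)\<^sup>2 * hsq V x)"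
    by (simp only: of_real_mult)
  then show ?thesis by (simp add: hnorm_def hsq_def real_sqrt_mult)
qed

lemma hsq_scale: "x \<in> hcar V \<Longrightarrow> hsq V (hscale V a x) = (cmod a)\<^sup>2 * hsq V x"
  by (simp add: hnorm_scale power_mult_distrib flip: hnorm_sq)

lemma hnorm_sub_commute: "x \<in> hcar V \<Longrightarrow> y \<in> hcar V \<Longrightarrow> hnorm V (hsub V x y) = hnorm V (hsub V y x)"
  by (simp add: hnorm_def)

lemma hsq_add:
  "x \<in> hcar V \<Longrightarrow> y \<in> hcar V \<Longrightarrow> hsq V (hadd V x y) = hsq V x + 2 * Re (hinner V x y) + hsq V y"
  using inner_cnj[of x y] by (simp add: hsq_def)

end

section \<open>Positive forms\<close>

definition sesquilinear_form :: "'v cips \<Rightarrow> 'w cips \<Rightarrow> ('v \<Rightarrow> 'w \<Rightarrow> complex) \<Rightarrow> bool" where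
  "sesquilinear_form V W a \<longleftrightarrow>
     (\<forall>x\<in>hcar V. \<forall>y\<in>hcar V. \<forall>z\<in>hcar W. a (hadd V x y) z = a x z + a y z) \<and>
     (\<forall>s. \<forall>x\<in>hcar V. \<forall>z\<in>hcar W. a (hscale V s x) z = s * a x z) \<and>
     (\<forall>x\<in>hcar V. \<forall>y\<in>hcar W. \<forall>z\<in>hcar W. a x (hadd W y z) = a x y + a x z) \<and>
     (\<forall>s. \<forall>x\<in>hcar V. \<forall>z\<in>hcar W. a x (hscale W s z) = cnj s * a x z)"

definition hermitian_form :: "'v cips \<Rightarrow> ('v \<Rightarrow> 'v \<Rightarrow> complex) \<Rightarrow> bool" where
  "hermitian_form V a \<longleftrightarrow> sesquilinear_form V V a \<and> (\<forall>x\<in>hcar V. \<forall>y\<in>hcar V. a y x = cnj (a x y))"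

abbreviation quad :: "('v \<Rightarrow> 'v \<Rightarrow> complex) \<Rightarrow> 'v \<Rightarrow> real" where
  "quad a x \<equiv> Re (a x x)"

definition positive_form :: "'v cips \<Rightarrow> ('v \<Rightarrow> 'v \<Rightarrow> complex) \<Rightarrow> bool" where
  "positive_form V a \<longleftrightarrow> hermitian_form V a \<and> (\<forall>x\<in>hcar V. 0 \<le> quad a x)"

lemma hermitian_formI:
  assumes add: "\<And>x y z. x \<in> hcar V \<Longrightarrow> y \<in> hcar V \<Longrightarrow> z \<in> hcar V \<Longrightarrow> a (hadd V x y) z = a x z + a y z"
    and scale: "\<And>s x y. x \<in> hcar V \<Longrightarrow> y \<in> hcar V \<Longrightarrow> a (hscale V s x) y = s * a x y"
    and cnj: "\<And>x y. x \<in> hcar V \<Longrightarrow> y \<in> hcar V \<Longrightarrow> a y x = cnj (a x y)"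
    and V: "inner_space V"
  shows "hermitian_form V a"
proof -
  interpret inner_space V by fact
  have add_right: "a z (hadd V x y) = a z x + a z y"
    if "x \<in> hcar V" "y \<in> hcar V" "z \<in> hcar V" for x y z
    using cnj[of "hadd V x y" z] cnj[of x z] cnj[of y z] that by (simp add: add)
  have scale_right: "a y (hscale V s x) = cnj s * a y x" if "x \<in> hcar V" "y \<in> hcar V" for x y s
    using cnj[of "hscale V s x" y] cnj[of x y] that by (simp add: scale)
  show ?thesis
    unfolding hermitian_form_def sesquilinear_form_def
    by (intro conjI ballI allI) (rule add scale add_right scale_right cnj; assumption)+
qed

lemma sesquilinear_form_expand:
  assumes "sesquilinear_form V W a"
  shows "x \<in> hcar V \<Longrightarrow> y \<in> hcar V \<Longrightarrow> z \<in> hcar W \<Longrightarrow> a (hadd V x y) z = a x z + a y z"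
    and "x \<in> hcar V \<Longrightarrow> z \<in> hcar W \<Longrightarrow> a (hscale V s x) z = s * a x z"
    and "x \<in> hcar V \<Longrightarrow> w \<in> hcar W \<Longrightarrow> z \<in> hcar W \<Longrightarrow> a x (hadd W w z) = a x w + a x z"
    and "x \<in> hcar V \<Longrightarrow> z \<in> hcar W \<Longrightarrow> a x (hscale W s z) = cnj s * a x z"
  using assms unfolding sesquilinear_form_def by blast+

lemma hermitian_form_sesquilinear: "hermitian_form V a \<Longrightarrow> sesquilinear_form V V a"
  by (simp add: hermitian_form_def)

lemma hermitian_form_cnj: "hermitian_form V a \<Longrightarrow> x \<in> hcar V \<Longrightarrow> y \<in> hcar V \<Longrightarrow> a y x = cnj (a x y)"
  unfolding hermitian_form_def by blast

lemma positive_form_hermitian: "positive_form V a \<Longrightarrow> hermitian_form V a"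
  by (simp add: positive_form_def)

lemma positive_form_nonneg: "positive_form V a \<Longrightarrow> x \<in> hcar V \<Longrightarrow> 0 \<le> quad a x"
  by (simp add: positive_form_def)

lemmas hermitian_form_expand = sesquilinear_form_expand[OF hermitian_form_sesquilinear]

context inner_space
begin

lemma hermitian_form_sub:
  assumes "hermitian_form V a" "x \<in> hcar V" "y \<in> hcar V" "z \<in> hcar V"
  shows "a (hsub V x y) z = a x z - a y z" and "a z (hsub V x y) = a z x - a z y"
  using assms by (simp_all add: hsub_def hermitian_form_expand)

lemma hermitian_form_diff:
  assumes a: "hermitian_form V a" and b: "hermitian_form V b"
  shows "hermitian_form V (\<lambda>x y. a x y - b x y)"
proof (rule hermitian_formI)
  fix x y assume "x \<in> hcar V" "y \<in> hcar V"
  then show "a y x - b y x = cnj (a x y - b x y)"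
    using hermitian_form_cnj[OF a, of x y] hermitian_form_cnj[OF b, of x y] by simp
qed (simp_all add: hermitian_form_expand[OF a] hermitian_form_expand[OF b] algebra_simps
  inner_space_axioms)

lemma positive_form_diff:
  assumes "hermitian_form V a" "hermitian_form V b" "\<And>x. x \<in> hcar V \<Longrightarrow> quad b x \<le> quad a x"
  shows "positive_form V (\<lambda>x y. a x y - b x y)"
  using assms by (simp add: positive_form_def hermitian_form_diff)

lemma positive_form_scale:
  assumes a: "positive_form V a" and c: "0 \<le> c"
  shows "positive_form V (\<lambda>x y. of_real c * a x y)"
proof -
  note h = positive_form_hermitian[OF a]
  have "hermitian_form V (\<lambda>x y. of_real c * a x y)"
  proof (rule hermitian_formI)
    fix x y assume "x \<in> hcar V" "y \<in> hcar V"
    then show "of_real c * a y x = cnj (of_real c * a x y)"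
      using hermitian_form_cnj[OF h, of x y] by simp
  qed (simp_all add: hermitian_form_expand[OF h] algebra_simps inner_space_axioms)
  then show ?thesis using positive_form_nonneg[OF a] c by (simp add: positive_form_def)
qed

lemma positive_form_inner: "positive_form V (hinner V)"
proof -
  have "hermitian_form V (hinner V)"
    by (rule hermitian_formI[OF _ _ inner_cnj inner_space_axioms]) simp_all
  then show ?thesis by (simp add: positive_form_def inner_nonneg)
qed

lemma form_polarization:
  assumes a: "hermitian_form V a" and x: "x \<in> hcar V" and y: "y \<in> hcar V"
  shows "a x y = Complex
    ((quad a (hadd V x y) - quad a (hsub V x y)) / 4)
    ((quad a (hadd V x (hscale V \<i> y)) - quad a (hsub V x (hscale V \<i> y))) / 4)"
  using x y hermitian_form_cnj[OF a x y]
  by (simp add: hermitian_form_expand[OF a] hermitian_form_sub[OF a] complex_eq_iff algebra_simps)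

lemma hermitian_form_eqI:
  assumes "hermitian_form V a" "hermitian_form V b" "\<And>z. z \<in> hcar V \<Longrightarrow> quad a z = quad b z"
    and "x \<in> hcar V" "y \<in> hcar V"
  shows "a x y = b x y"
  unfolding form_polarization[OF assms(1,4,5)] form_polarization[OF assms(2,4,5)]
  using assms(3-5) by simp

lemma form_cauchy_schwarz:
  assumes a: "positive_form V a" and x: "x \<in> hcar V" and y: "y \<in> hcar V"
  shows "(cmod (a x y))\<^sup>2 \<le> quad a x * quad a y"
proof (rule coefficient_le_of_nonneg_polynomial)
  note h = positive_form_hermitian[OF a]
  show "0 \<le> quad a y" using a y by (rule positive_form_nonneg)
  fix s :: real
  let ?w = "a x y"
  let ?z = "hsub V x (hscale V (of_real s * ?w) y)"
  have "a ?z ?z = a x x - 2 * of_real s * (?w * cnj ?w) + (of_real s)\<^sup>2 * (?w * cnj ?w) * a y y"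
    using x y hermitian_form_cnj[OF h x y]
    by (simp add: hermitian_form_expand[OF h] hermitian_form_sub[OF h] algebra_simps
      power2_eq_square)
  also have "\<dots> = a x x - of_real (2 * s * (cmod ?w)\<^sup>2) + of_real (s\<^sup>2 * (cmod ?w)\<^sup>2) * a y y"
    by (simp only: of_real_mult complex_norm_square) simp
  finally have "quad a ?z = quad a x - 2 * s * (cmod ?w)\<^sup>2 + s\<^sup>2 * (cmod ?w)\<^sup>2 * quad a y"
    by simp
  moreover have "0 \<le> quad a ?z" using a x y by (intro positive_form_nonneg) auto
  ultimately show "0 \<le> quad a x - 2 * s * (cmod ?w)\<^sup>2 + s\<^sup>2 * (cmod ?w)\<^sup>2 * quad a y" by simp
qed simp

lemma cauchy_schwarz:
  "x \<in> hcar V \<Longrightarrow> y \<in> hcar V \<Longrightarrow> cmod (hinner V x y) \<le> hnorm V x * hnorm V y"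
  by (rule power2_le_imp_le)
    (use form_cauchy_schwarz[OF positive_form_inner, of x y] in
      \<open>simp_all add: power_mult_distrib hnorm_sq hsq_def\<close>)

lemma hnorm_triangle:
  assumes "x \<in> hcar V" "y \<in> hcar V"
  shows "hnorm V (hadd V x y) \<le> hnorm V x + hnorm V y"
proof (rule power2_le_imp_le)
  have "Re (hinner V x y) \<le> hnorm V x * hnorm V y"
    using cauchy_schwarz[OF assms] complex_Re_le_cmod order_trans by blast
  then show "(hnorm V (hadd V x y))\<^sup>2 \<le> (hnorm V x + hnorm V y)\<^sup>2"
    using assms by (simp add: hnorm_sq hsq_add power2_sum)
qed (use assms in simp)

lemma hnorm_triangle_reverse:
  assumes "x \<in> hcar V" "y \<in> hcar V"
  shows "\<bar>hnorm V x - hnorm V y\<bar> \<le> hnorm V (hsub V x y)"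
  using assms hnorm_triangle[of "hsub V x y" y] hnorm_triangle[of "hsub V y x" x]
  by (simp add: hnorm_sub_commute[of x y] abs_le_iff)

lemma tends_to_iff_hsq:
  assumes "\<And>n. f n \<in> hcar V" "l \<in> hcar V"
  shows "tends_to V f l \<longleftrightarrow> (\<lambda>n. hsq V (hsub V (f n) l)) \<longlonglongrightarrow> 0"
proof
  assume "tends_to V f l"
  from tendsto_power[OF this[unfolded tends_to_def], of 2] show "(\<lambda>n. hsq V (hsub V (f n) l)) \<longlonglongrightarrow> 0"
    using assms by (simp add: hnorm_sq)
next
  assume "(\<lambda>n. hsq V (hsub V (f n) l)) \<longlonglongrightarrow> 0"
  from tendsto_real_sqrt[OF this] show "tends_to V f l"
    by (simp add: tends_to_def hnorm_def hsq_def)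
qed

lemma tendsto_hnorm:
  assumes "\<And>n. f n \<in> hcar V" "l \<in> hcar V" "tends_to V f l"
  shows "(\<lambda>n. hnorm V (f n)) \<longlonglongrightarrow> hnorm V l"
proof -
  have "(\<lambda>n. hnorm V (f n) - hnorm V l) \<longlonglongrightarrow> 0"
    by (rule tendsto_zero_comparison[OF _ assms(3)[unfolded tends_to_def]])
      (use assms hnorm_triangle_reverse in auto)
  then show ?thesis by (rule LIM_zero_cancel)
qed

lemma tendsto_inner:
  assumes "\<And>n. f n \<in> hcar V" "l \<in> hcar V" "x \<in> hcar V" and lim: "tends_to V f l"
  shows "(\<lambda>n. hinner V x (f n)) \<longlonglongrightarrow> hinner V x l"
proof -
  have "(\<lambda>n. hinner V x (f n) - hinner V x l) \<longlonglongrightarrow> 0"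
  proof (rule tendsto_zero_comparison)
    show "norm (hinner V x (f n) - hinner V x l) \<le> hnorm V x * hnorm V (hsub V (f n) l)" for n
      using cauchy_schwarz[of x "hsub V (f n) l"] assms by simp
    show "(\<lambda>n. hnorm V x * hnorm V (hsub V (f n) l)) \<longlonglongrightarrow> 0"
      using tendsto_mult_right_zero[OF lim[unfolded tends_to_def]] .
  qed
  then show ?thesis by (rule LIM_zero_cancel)
qed

lemma tends_to_sub_left:
  assumes "\<And>n. f n \<in> hcar V" "l \<in> hcar V" "x \<in> hcar V" "tends_to V f l"
  shows "tends_to V (\<lambda>n. hsub V x (f n)) (hsub V x l)"
proof -
  have "hsub V (hsub V x (f n)) (hsub V x l) = hsub V l (f n)" for n
    using assms by (intro vector_eqI) auto
  then show ?thesis using assms by (simp add: tends_to_def hnorm_sub_commute)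
qed

end

section \<open>Bounded operators\<close>

lemma bop_closed: "bop V W A \<Longrightarrow> x \<in> hcar V \<Longrightarrow> A x \<in> hcar W"
  by (simp add: bop_def)

lemma bop_hadd:
  "bop V W A \<Longrightarrow> x \<in> hcar V \<Longrightarrow> y \<in> hcar V \<Longrightarrow> A (hadd V x y) = hadd W (A x) (A y)"
  by (simp add: bop_def)

lemma bop_hscale: "bop V W A \<Longrightarrow> x \<in> hcar V \<Longrightarrow> A (hscale V s x) = hscale W s (A x)"
  by (simp add: bop_def)

lemmas bopD = bop_closed bop_hadd bop_hscale

lemma bop_sub:
  assumes "bop V W A" "inner_space V" "x \<in> hcar V" "y \<in> hcar V"
  shows "A (hsub V x y) = hsub W (A x) (A y)"
  using assms by (simp add: hsub_def bopD inner_space.scale_closed)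

lemma bop_zero:
  assumes "bop V W A" "inner_space V" "inner_space W"
  shows "A (hzero V) = hzero W"
proof -
  interpret V: inner_space V by fact
  interpret W: inner_space W by fact
  show ?thesis
    using bop_sub[OF assms(1,2) V.zero_closed V.zero_closed] bop_closed[OF assms(1) V.zero_closed]
    by simp
qed

lemma bopI:
  assumes "\<And>x. x \<in> hcar V \<Longrightarrow> A x \<in> hcar W"
    and "\<And>x y. x \<in> hcar V \<Longrightarrow> y \<in> hcar V \<Longrightarrow> A (hadd V x y) = hadd W (A x) (A y)"
    and "\<And>s x. x \<in> hcar V \<Longrightarrow> A (hscale V s x) = hscale W s (A x)"
    and "\<And>x. x \<in> hcar V \<Longrightarrow> hnorm W (A x) \<le> c * hnorm V x"
  shows "bop V W A"
  unfolding bop_def using assms by blast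

lemma bopI_hsq:
  assumes "\<And>x. x \<in> hcar V \<Longrightarrow> A x \<in> hcar W"
    and "\<And>x y. x \<in> hcar V \<Longrightarrow> y \<in> hcar V \<Longrightarrow> A (hadd V x y) = hadd W (A x) (A y)"
    and "\<And>s x. x \<in> hcar V \<Longrightarrow> A (hscale V s x) = hscale W s (A x)"
    and "\<And>x. x \<in> hcar V \<Longrightarrow> hsq W (A x) \<le> c * hsq V x"
  shows "bop V W A"
  using assms(1-3) real_sqrt_le_mono[OF assms(4)]
  by (intro bopI[where c = "sqrt c"]) (simp_all add: hnorm_def hsq_def real_sqrt_mult)

lemma bop_bound:
  assumes "bop V W A" "inner_space V"
  obtains c where "0 \<le> c" "\<And>x. x \<in> hcar V \<Longrightarrow> hnorm W (A x) \<le> c * hnorm V x"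
proof -
  obtain c where c: "\<And>x. x \<in> hcar V \<Longrightarrow> hnorm W (A x) \<le> c * hnorm V x"
    using assms(1) unfolding bop_def by blast
  have "hnorm W (A x) \<le> max c 0 * hnorm V x" if "x \<in> hcar V" for x
    using c[OF that] inner_space.hnorm_nonneg[OF assms(2) that]
    by (meson max.cobounded1 mult_right_mono order_trans)
  then show ?thesis using that[of "max c 0"] by simp
qed

lemma bop_compose:
  assumes A: "bop U V A" and B: "bop V W B" and V: "inner_space V"
  shows "bop U W (\<lambda>x. B (A x))"
proof -
  obtain c where c: "\<And>x. x \<in> hcar U \<Longrightarrow> hnorm V (A x) \<le> c * hnorm U x"
    using A unfolding bop_def by blast
  obtain d where d: "0 \<le> d" "\<And>x. x \<in> hcar V \<Longrightarrow> hnorm W (B x) \<le> d * hnorm V x"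
    using bop_bound[OF B V] by blast
  show ?thesis
  proof (rule bopI)
    fix x assume x: "x \<in> hcar U"
    show "hnorm W (B (A x)) \<le> (d * c) * hnorm U x"
      using order_trans[OF d(2)[OF bop_closed[OF A x]] mult_left_mono[OF c[OF x] d(1)]]
      by (simp add: mult.assoc)
  qed (simp_all add: bopD[OF A] bopD[OF B])
qed

lemma bop_id: "bop V V (\<lambda>x. x)"
  by (rule bopI[where c = 1]) auto

lemma bop_add:
  assumes A: "bop V W A" and B: "bop V W B" and W: "inner_space W"
  shows "bop V W (\<lambda>x. hadd W (A x) (B x))"
proof -
  interpret W: inner_space W by fact
  obtain c where c: "\<And>x. x \<in> hcar V \<Longrightarrow> hnorm W (A x) \<le> c * hnorm V x"
    using A unfolding bop_def by blast
  obtain d where d: "\<And>x. x \<in> hcar V \<Longrightarrow> hnorm W (B x) \<le> d * hnorm V x"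
    using B unfolding bop_def by blast
  show ?thesis
  proof (rule bopI)
    fix x assume x: "x \<in> hcar V"
    show "hnorm W (hadd W (A x) (B x)) \<le> (c + d) * hnorm V x"
      using W.hnorm_triangle[OF bop_closed[OF A x] bop_closed[OF B x]] c[OF x] d[OF x]
      by (simp add: distrib_right)
  next
    fix x y assume "x \<in> hcar V" "y \<in> hcar V"
    then show "hadd W (A (hadd V x y)) (B (hadd V x y))
        = hadd W (hadd W (A x) (B x)) (hadd W (A y) (B y))"
      using bopD[OF A] bopD[OF B] by (intro W.vector_eqI) auto
  qed (use bopD[OF A] bopD[OF B] in \<open>auto simp: W.scale_add_right\<close>)
qed

lemma bop_scale:
  assumes A: "bop V W A" and W: "inner_space W"
  shows "bop V W (\<lambda>x. hscale W s (A x))"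
proof -
  interpret W: inner_space W by fact
  obtain c where c: "\<And>x. x \<in> hcar V \<Longrightarrow> hnorm W (A x) \<le> c * hnorm V x"
    using A unfolding bop_def by blast
  show ?thesis
  proof (rule bopI)
    fix x assume x: "x \<in> hcar V"
    show "hnorm W (hscale W s (A x)) \<le> (cmod s * c) * hnorm V x"
      using mult_left_mono[OF c[OF x], of "cmod s"] bop_closed[OF A x]
      by (simp add: W.hnorm_scale mult.assoc)
  qed (use bopD[OF A] in \<open>auto simp: W.scale_add_right W.scale_scale mult.commute\<close>)
qed

lemma bop_diff:
  assumes "bop V W A" "bop V W B" "inner_space W"
  shows "bop V W (\<lambda>x. hsub W (A x) (B x))"
  unfolding hsub_def using assms by (intro bop_add bop_scale)

lemma tends_to_bop:
  assumes A: "bop V W A" and V: "inner_space V" and W: "inner_space W"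
    and f: "\<And>n. f n \<in> hcar V" and l: "l \<in> hcar V" and lim: "tends_to V f l"
  shows "tends_to W (\<lambda>n. A (f n)) (A l)"
proof -
  interpret V: inner_space V by fact
  interpret W: inner_space W by fact
  obtain c where c: "\<And>x. x \<in> hcar V \<Longrightarrow> hnorm W (A x) \<le> c * hnorm V x"
    using A unfolding bop_def by blast
  show ?thesis
    unfolding tends_to_def
  proof (rule tendsto_zero_comparison)
    show "(\<lambda>n. c * hnorm V (hsub V (f n) l)) \<longlonglongrightarrow> 0"
      using tendsto_mult_right_zero[OF lim[unfolded tends_to_def]] .
    show "norm (hnorm W (hsub W (A (f n)) (A l))) \<le> c * hnorm V (hsub V (f n) l)" for n
      using c[OF V.sub_closed[OF f l]] bop_sub[OF A V f l] bop_closed[OF A f] bop_closed[OF A l]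
      by simp
  qed
qed

lemma positive_form_compose:
  assumes a: "positive_form W a" and T: "bop V W T" and V: "inner_space V"
  shows "positive_form V (\<lambda>x y. a (T x) (T y))"
proof -
  note h = positive_form_hermitian[OF a]
  have "hermitian_form V (\<lambda>x y. a (T x) (T y))"
    by (rule hermitian_formI[OF _ _ hermitian_form_cnj[OF h] V])
      (simp_all add: hermitian_form_expand[OF h] bopD[OF T])
  then show ?thesis using positive_form_nonneg[OF a] bop_closed[OF T]
    by (simp add: positive_form_def)
qed

lemma isometryI:
  assumes "\<And>x. x \<in> hcar V \<Longrightarrow> A x \<in> hcar W"
    and "\<And>x y. x \<in> hcar V \<Longrightarrow> y \<in> hcar V \<Longrightarrow> A (hadd V x y) = hadd W (A x) (A y)"
    and "\<And>s x. x \<in> hcar V \<Longrightarrow> A (hscale V s x) = hscale W s (A x)"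
    and "\<And>x. x \<in> hcar V \<Longrightarrow> hsq W (A x) = hsq V x"
  shows "isometry V W A"
  unfolding isometry_def
  using bopI_hsq[of V A W 1] assms by (simp add: hnorm_def hsq_def)

lemma isometry_bop: "isometry V W A \<Longrightarrow> bop V W A"
  by (simp add: isometry_def)

lemma isometry_closed: "isometry V W A \<Longrightarrow> x \<in> hcar V \<Longrightarrow> A x \<in> hcar W"
  by (simp add: isometry_def bop_def)

lemma isometry_inner:
  assumes A: "isometry V W A" and V: "inner_space V" and W: "inner_space W"
    and "x \<in> hcar V" "y \<in> hcar V"
  shows "hinner W (A x) (A y) = hinner V x y"
proof -
  interpret V: inner_space V by fact
  interpret W: inner_space W by fact
  have "quad (hinner W) (A x) = quad (hinner V) x" if "x \<in> hcar V" for x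
    using A that V.hnorm_sq[of x] W.hnorm_sq[of "A x"] isometry_closed[OF A]
    by (simp add: isometry_def hsq_def)
  then show ?thesis
    using assms positive_form_compose[OF W.positive_form_inner isometry_bop[OF A] V]
      V.positive_form_inner
    by (intro V.hermitian_form_eqI[of "\<lambda>x y. hinner W (A x) (A y)"])
      (auto intro: positive_form_hermitian)
qed

lemma isometry_hsq:
  assumes "isometry V W A" "inner_space V" "inner_space W" "x \<in> hcar V"
  shows "hsq W (A x) = hsq V x"
  using isometry_inner[OF assms assms(4)] by (simp add: hsq_def)

definition orthogonal_ranges ::
    "'u cips \<Rightarrow> 'v cips \<Rightarrow> 'w cips \<Rightarrow> ('u \<Rightarrow> 'w) \<Rightarrow> ('v \<Rightarrow> 'w) \<Rightarrow> bool" where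
  "orthogonal_ranges U V W A B \<longleftrightarrow> (\<forall>x\<in>hcar U. \<forall>y\<in>hcar V. hinner W (A x) (B y) = 0)"

lemma orthogonal_rangesD:
  "orthogonal_ranges U V W A B \<Longrightarrow> x \<in> hcar U \<Longrightarrow> y \<in> hcar V \<Longrightarrow> hinner W (A x) (B y) = 0"
  by (simp add: orthogonal_ranges_def)

section \<open>Closed subspaces\<close>

lemma closed_subspace_iff:
  "closed_subspace V L \<longleftrightarrow> linear_subspace V L \<and>
    (\<forall>f l. (\<forall>n. f n \<in> L) \<longrightarrow> l \<in> hcar V \<longrightarrow> tends_to V f l \<longrightarrow> l \<in> L)"
  by (auto simp: closed_subspace_def linear_subspace_def tends_to_def)

lemma linear_subspaceD:
  assumes "linear_subspace V L"
  shows "x \<in> L \<Longrightarrow> x \<in> hcar V" and "hzero V \<in> L"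
    and "x \<in> L \<Longrightarrow> y \<in> L \<Longrightarrow> hadd V x y \<in> L" and "x \<in> L \<Longrightarrow> hscale V a x \<in> L"
    and "x \<in> L \<Longrightarrow> y \<in> L \<Longrightarrow> hsub V x y \<in> L"
  using assms by (auto simp: linear_subspace_def hsub_def)

lemma closed_subspace_linear: "closed_subspace V L \<Longrightarrow> linear_subspace V L"
  by (simp add: closed_subspace_iff)

lemmas closed_subspaceD = linear_subspaceD[OF closed_subspace_linear]

lemma closed_subspace_limit:
  "closed_subspace V L \<Longrightarrow> (\<And>n. f n \<in> L) \<Longrightarrow> l \<in> hcar V \<Longrightarrow> tends_to V f l \<Longrightarrow> l \<in> L"
  unfolding closed_subspace_iff by blast

lemma closed_subspace_vimage:
  assumes V: "inner_space V" and W: "inner_space W" and A: "bop V W A" and L: "closed_subspace W L"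
  shows "closed_subspace V {x \<in> hcar V. A x \<in> L}"
  unfolding closed_subspace_iff
proof (intro conjI allI impI)
  interpret V: inner_space V by fact
  show "linear_subspace V {x \<in> hcar V. A x \<in> L}"
    unfolding linear_subspace_def
    using closed_subspaceD[OF L] bop_zero[OF A V W] bopD[OF A] by auto
  fix f l assume f: "\<forall>n. f n \<in> {x \<in> hcar V. A x \<in> L}" and l: "l \<in> hcar V" and lim: "tends_to V f l"
  then have "tends_to W (\<lambda>n. A (f n)) (A l)" by (intro tends_to_bop[OF A V W]) auto
  then show "l \<in> {x \<in> hcar V. A x \<in> L}"
    using f l bop_closed[OF A l] by (auto intro: closed_subspace_limit[OF L])
qed

lemma closed_span_superset: "M \<subseteq> closed_span V M"
  unfolding closed_span_def by blast

lemma closed_span_minimal: "closed_subspace V L \<Longrightarrow> M \<subseteq> L \<Longrightarrow> closed_span V M \<subseteq> L"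
  unfolding closed_span_def by blast

lemma linear_subspace_Inter:
  assumes "\<And>L. L \<in> \<L> \<Longrightarrow> linear_subspace V L" "\<L> \<noteq> {}"
  shows "linear_subspace V (\<Inter>\<L>)"
  unfolding linear_subspace_def
proof (intro conjI ballI allI InterI)
  show "\<Inter>\<L> \<subseteq> hcar V" using linear_subspaceD(1)[OF assms(1)] assms(2) by blast
qed (use linear_subspaceD[OF assms(1)] in blast)+

context inner_space
begin

lemma closed_subspace_orthogonal:
  assumes M: "M \<subseteq> hcar V"
  shows "closed_subspace V {x \<in> hcar V. \<forall>y\<in>M. hinner V y x = 0}"
  unfolding closed_subspace_iff
proof (intro conjI allI impI)
  show "linear_subspace V {x \<in> hcar V. \<forall>y\<in>M. hinner V y x = 0}"
    using M by (auto simp: linear_subspace_def subset_iff)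
  fix f l assume f: "\<forall>n. f n \<in> {x \<in> hcar V. \<forall>y\<in>M. hinner V y x = 0}"
    and l: "l \<in> hcar V" and lim: "tends_to V f l"
  have "hinner V y l = 0" if y: "y \<in> M" for y
  proof -
    have "(\<lambda>n. hinner V y (f n)) \<longlonglongrightarrow> hinner V y l"
      using f l lim y M by (intro tendsto_inner) auto
    then show ?thesis using f y by (simp add: LIMSEQ_const_iff)
  qed
  then show "l \<in> {x \<in> hcar V. \<forall>y\<in>M. hinner V y x = 0}" using l by simp
qed

lemma closed_subspace_carrier: "closed_subspace V (hcar V)"
  using closed_subspace_orthogonal[of "{}"] by simp

lemma closed_subspace_closed_span:
  assumes "M \<subseteq> hcar V"
  shows "closed_subspace V (closed_span V M)"
  unfolding closed_subspace_iff[of V "closed_span V M"]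
proof (intro conjI allI impI)
  show "linear_subspace V (closed_span V M)"
    unfolding closed_span_def using assms closed_subspace_carrier
    by (intro linear_subspace_Inter) (auto intro: closed_subspace_linear)
  fix f l assume "\<forall>n. f n \<in> closed_span V M" "l \<in> hcar V" "tends_to V f l"
  then show "l \<in> closed_span V M"
    unfolding closed_span_def using closed_subspace_limit[of V _ f l] by blast
qed

lemma closed_span_eqI:
  assumes M: "M \<subseteq> hcar V" and uv: "u \<in> closed_span V M" "v \<in> closed_span V M"
    and eq: "\<And>m. m \<in> M \<Longrightarrow> hinner V m u = hinner V m v"
  shows "u = v"
proof -
  note span = closed_subspaceD[OF closed_subspace_closed_span[OF M]]
  let ?d = "hsub V u v"
  have d: "?d \<in> closed_span V M" "u \<in> hcar V" "v \<in> hcar V" using uv span by auto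
  have "M \<subseteq> {x \<in> hcar V. \<forall>y\<in>{?d}. hinner V y x = 0}"
  proof
    fix m assume "m \<in> M"
    then have "m \<in> hcar V" "hinner V m ?d = 0" using M d eq by auto
    then show "m \<in> {x \<in> hcar V. \<forall>y\<in>{?d}. hinner V y x = 0}"
      using d inner_cnj[of m ?d] by (simp del: inner_sub_left inner_sub_right)
  qed
  then have "?d \<in> {x \<in> hcar V. \<forall>y\<in>{?d}. hinner V y x = 0}"
    using closed_span_minimal[OF closed_subspace_orthogonal[of "{?d}"]] d by blast
  then have "?d = hzero V" using d by (intro inner_definite) auto
  then show "u = v" using d sub_add_cancel[of u v] by simp
qed

end

section \<open>Riesz representation and adjoints\<close>

locale dominated_functional = U: inner_space U + V: inner_space V
  for U :: "'u cips" and V :: "'v cips" +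
  fixes A :: "'u \<Rightarrow> 'v" and \<phi> :: "'u \<Rightarrow> complex" and K :: real
  assumes bop_A: "bop U V A"
    and additive: "x \<in> hcar U \<Longrightarrow> y \<in> hcar U \<Longrightarrow> \<phi> (hadd U x y) = \<phi> x + \<phi> y"
    and homogeneous: "x \<in> hcar U \<Longrightarrow> \<phi> (hscale U s x) = s * \<phi> x"
    and bound: "x \<in> hcar U \<Longrightarrow> cmod (\<phi> x) \<le> K * hnorm V (A x)" and bound_nonneg: "0 \<le> K"
begin

lemmas A_closed [simp] = bop_closed[OF bop_A]

definition riesz_functional :: "'u \<Rightarrow> real" where
  "riesz_functional x = hsq V (A x) - 2 * Re (\<phi> x)"

definition approximant :: "real \<Rightarrow> 'u \<Rightarrow> bool" where
  "approximant \<epsilon> l \<longleftrightarrow> l \<in> hcar U \<and>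
     (\<forall>x\<in>hcar U. cmod (\<phi> x - hinner V (A x) (A l)) \<le> \<epsilon> * hnorm V (A x))"

lemma approximantD:
  assumes "approximant \<epsilon> l"
  shows "l \<in> hcar U" and "x \<in> hcar U \<Longrightarrow> cmod (\<phi> x - hinner V (A x) (A l)) \<le> \<epsilon> * hnorm V (A x)"
  using assms by (simp_all add: approximant_def)

lemma riesz_functional_ge:
  assumes x: "x \<in> hcar U"
  shows "- K\<^sup>2 \<le> riesz_functional x"
proof -
  have "2 * Re (\<phi> x) \<le> 2 * K * hnorm V (A x)"
    using complex_Re_le_cmod[of "\<phi> x"] bound[OF x] by linarith
  also have "\<dots> \<le> K\<^sup>2 + (hnorm V (A x))\<^sup>2" by (rule sum_squares_bound)
  finally show ?thesis using x by (simp add: riesz_functional_def V.hnorm_sq)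
qed

lemma riesz_functional_add_scale:
  assumes l: "l \<in> hcar U" and x: "x \<in> hcar U"
  shows "riesz_functional (hadd U l (hscale U t x)) =
    riesz_functional l - 2 * Re (t * (\<phi> x - hinner V (A x) (A l))) + (cmod t)\<^sup>2 * hsq V (A x)"
proof -
  have "Re (hinner V (A l) (hscale V t (A x))) = Re (t * hinner V (A x) (A l))"
    using l x V.inner_cnj[of "A x" "A l"] by simp
  then show ?thesis
    using l x bopD(2,3)[OF bop_A]
    by (simp add: riesz_functional_def additive homogeneous V.hsq_add V.hsq_scale
        del: V.inner_scale_right) (simp add: algebra_simps)
qed

lemma approximant_of_near_minimizer:
  assumes l: "l \<in> hcar U" and \<epsilon>: "0 \<le> \<epsilon>"
    and near: "\<And>x. x \<in> hcar U \<Longrightarrow> riesz_functional l - \<epsilon>\<^sup>2 \<le> riesz_functional x"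
  shows "approximant \<epsilon> l"
  unfolding approximant_def
proof (intro conjI ballI l)
  fix x assume x: "x \<in> hcar U"
  define w where "w = \<phi> x - hinner V (A x) (A l)"
  have "(cmod w)\<^sup>2 \<le> \<epsilon>\<^sup>2 * hsq V (A x)"
  proof (rule coefficient_le_of_nonneg_polynomial)
    fix s :: real
    define t where "t = of_real s * cnj w"
    have tw: "t * w = of_real (s * (cmod w)\<^sup>2)"
      unfolding t_def by (simp only: of_real_mult complex_norm_square) simp
    have t: "(cmod t)\<^sup>2 = s\<^sup>2 * (cmod w)\<^sup>2"
      unfolding t_def by (simp add: norm_mult power_mult_distrib)
    show "0 \<le> \<epsilon>\<^sup>2 - 2 * s * (cmod w)\<^sup>2 + s\<^sup>2 * (cmod w)\<^sup>2 * hsq V (A x)"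
      using near[of "hadd U l (hscale U t x)"] l x
      unfolding riesz_functional_add_scale[OF l x] w_def[symmetric] tw t by simp
  qed (use x in simp_all)
  then have "(cmod w)\<^sup>2 \<le> (\<epsilon> * hnorm V (A x))\<^sup>2"
    using x by (simp add: power_mult_distrib V.hnorm_sq)
  then show "cmod (\<phi> x - hinner V (A x) (A l)) \<le> \<epsilon> * hnorm V (A x)"
    unfolding w_def by (rule power2_le_imp_le) (use x \<epsilon> in simp)
qed

lemma approximant_exists:
  assumes "0 < \<epsilon>"
  shows "\<exists>l. approximant \<epsilon> l"
proof -
  let ?J = "riesz_functional ` hcar U"
  have "bdd_below ?J" using riesz_functional_ge by (rule bdd_belowI2)
  then have Inf_le: "Inf ?J \<le> riesz_functional x" if "x \<in> hcar U" for x
    using that by (simp add: cINF_lower)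
  obtain l where l: "l \<in> hcar U" "riesz_functional l < Inf ?J + \<epsilon>\<^sup>2"
    using cInf_lessD[of ?J "Inf ?J + \<epsilon>\<^sup>2"] U.zero_closed assms by auto
  have "riesz_functional l - \<epsilon>\<^sup>2 \<le> riesz_functional x" if "x \<in> hcar U" for x
    using Inf_le[OF that] l(2) by linarith
  then have "approximant \<epsilon> l" using l(1) assms by (intro approximant_of_near_minimizer) auto
  then show ?thesis by blast
qed

lemma approximant_dist:
  assumes l: "approximant \<epsilon> l" and m: "approximant \<delta> m" and "0 \<le> \<epsilon>" "0 \<le> \<delta>"
  shows "hnorm V (hsub V (A l) (A m)) \<le> \<epsilon> + \<delta>"
proof (rule le_of_square_le_mult)
  let ?d = "hsub U l m"
  have d: "?d \<in> hcar U" "l \<in> hcar U" "m \<in> hcar U" using approximantD(1)[OF l] approximantD(1)[OF m]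
    by auto
  have Ad: "hsub V (A l) (A m) = A ?d" using d
    by (intro bop_sub[OF bop_A U.inner_space_axioms, symmetric])
  have "hnorm V (A ?d) * hnorm V (A ?d) = cmod (hinner V (A ?d) (hsub V (A l) (A m)))"
    using d by (simp only: Ad V.cmod_inner_self A_closed)
  also have "\<dots> = cmod ((\<phi> ?d - hinner V (A ?d) (A m)) - (\<phi> ?d - hinner V (A ?d) (A l)))"
    using d by simp
  also have "\<dots> \<le> \<delta> * hnorm V (A ?d) + \<epsilon> * hnorm V (A ?d)"
    using approximantD(2)[OF m d(1)] approximantD(2)[OF l d(1)]
    by (intro order_trans[OF norm_triangle_ineq4 add_mono])
  finally show "hnorm V (hsub V (A l) (A m)) * hnorm V (hsub V (A l) (A m))
      \<le> (\<epsilon> + \<delta>) * hnorm V (hsub V (A l) (A m))"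
    unfolding Ad by (simp add: algebra_simps)
qed (use assms approximantD(1) in auto)

lemma approximant_hnorm_le:
  assumes l: "approximant \<epsilon> l" and \<epsilon>: "0 \<le> \<epsilon>"
  shows "hnorm V (A l) \<le> K + \<epsilon>"
proof (rule le_of_square_le_mult)
  note lU = approximantD(1)[OF l]
  have "hnorm V (A l) * hnorm V (A l) = cmod (hinner V (A l) (A l))"
    using lU by (simp add: V.cmod_inner_self)
  also have "\<dots> \<le> cmod (\<phi> l) + cmod (\<phi> l - hinner V (A l) (A l))"
    using norm_triangle_ineq4[of "\<phi> l" "\<phi> l - hinner V (A l) (A l)"] by simp
  also have "\<dots> \<le> K * hnorm V (A l) + \<epsilon> * hnorm V (A l)"
    using bound[OF lU] approximantD(2)[OF l lU] by (rule add_mono)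
  finally show "hnorm V (A l) * hnorm V (A l) \<le> (K + \<epsilon>) * hnorm V (A l)"
    by (simp add: algebra_simps)
qed (use approximantD(1)[OF l] \<epsilon> bound_nonneg in auto)

theorem riesz:
  assumes "complete_space V"
  obtains u where "u \<in> closed_span V (A ` hcar U)" "hnorm V u \<le> K"
    and "\<And>x. x \<in> hcar U \<Longrightarrow> \<phi> x = hinner V (A x) u"
proof -
  interpret V: complete_space V by fact
  define \<epsilon> where "\<epsilon> n = inverse (real (Suc n))" for n
  have \<epsilon>: "\<epsilon> \<longlonglongrightarrow> 0" unfolding \<epsilon>_def by (rule LIMSEQ_inverse_real_of_nat)
  have \<epsilon>_pos: "0 < \<epsilon> n" for n by (simp add: \<epsilon>_def)
  obtain l where l: "\<And>n. approximant (\<epsilon> n) (l n)" using approximant_exists[OF \<epsilon>_pos] by metis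
  have Al: "A (l n) \<in> hcar V" for n using approximantD(1)[OF l] by simp
  have "cauchy_seq V (\<lambda>n. A (l n))"
    unfolding cauchy_seq_def
  proof (intro allI impI)
    fix e :: real assume "0 < e"
    then obtain N where N: "\<And>n. N \<le> n \<Longrightarrow> \<epsilon> n < e / 2"
      using order_tendstoD(2)[OF \<epsilon>, of "e / 2"] by (auto simp: eventually_sequentially)
    have "hnorm V (hsub V (A (l m)) (A (l n))) < e" if "N \<le> m" "N \<le> n" for m n
      using approximant_dist[OF l l less_imp_le[OF \<epsilon>_pos] less_imp_le[OF \<epsilon>_pos], of m n]
        N[OF that(1)] N[OF that(2)] by linarith
    then show "\<exists>N. \<forall>m\<ge>N. \<forall>n\<ge>N. hnorm V (hsub V (A (l m)) (A (l n))) < e" by blast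
  qed
  then obtain u where u: "u \<in> hcar V" and lim: "tends_to V (\<lambda>n. A (l n)) u"
    using V.complete[of "\<lambda>n. A (l n)"] Al by blast
  have "closed_subspace V (closed_span V (A ` hcar U))"
    by (intro V.closed_subspace_closed_span image_subsetI A_closed)
  moreover have "A (l n) \<in> closed_span V (A ` hcar U)" for n
    by (rule subsetD[OF closed_span_superset imageI[OF approximantD(1)[OF l]]])
  ultimately have "u \<in> closed_span V (A ` hcar U)" using u lim by (rule closed_subspace_limit)
  moreover have "hnorm V u \<le> K"
    using LIMSEQ_le[OF V.tendsto_hnorm[OF Al u lim] tendsto_add[OF tendsto_const \<epsilon>], of K]
      approximant_hnorm_le[OF l less_imp_le[OF \<epsilon>_pos]] by auto
  moreover have "\<phi> x = hinner V (A x) u" if x: "x \<in> hcar U" for x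
  proof -
    have "(\<lambda>n. \<phi> x - hinner V (A x) (A (l n))) \<longlonglongrightarrow> 0"
      using approximantD(2)[OF l x] tendsto_mult_left_zero[OF \<epsilon>] by (rule tendsto_zero_comparison)
    from tendsto_diff[OF tendsto_const[of "\<phi> x"] this]
    have "(\<lambda>n. hinner V (A x) (A (l n))) \<longlonglongrightarrow> \<phi> x" by simp
    then show ?thesis using V.tendsto_inner[OF Al u A_closed[OF x] lim] LIMSEQ_unique by blast
  qed
  ultimately show thesis by (rule that)
qed

end

context complete_space
begin

lemma sesquilinear_form_representation:
  assumes U: "inner_space U" and A: "bop U V A" and W: "inner_space W"
    and b: "sesquilinear_form U W b" and c: "0 \<le> c"
    and bound: "\<And>x y. x \<in> hcar U \<Longrightarrow> y \<in> hcar W \<Longrightarrow> cmod (b x y) \<le> c * hnorm W y * hnorm V (A x)"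
  shows "\<exists>B. bop W V B \<and> (\<forall>y\<in>hcar W. hnorm V (B y) \<le> c * hnorm W y) \<and>
    (\<forall>x\<in>hcar U. \<forall>y\<in>hcar W. b x y = hinner V (A x) (B y))"
proof -
  interpret U: inner_space U by fact
  interpret W: inner_space W by fact
  let ?M = "closed_span V (A ` hcar U)"
  have AU: "A ` hcar U \<subseteq> hcar V" using bop_closed[OF A] by blast
  note M = closed_subspaceD[OF closed_subspace_closed_span[OF AU]]
  have "\<exists>u\<in>?M. hnorm V u \<le> c * hnorm W y \<and> (\<forall>x\<in>hcar U. b x y = hinner V (A x) u)"
    if y: "y \<in> hcar W" for y
  proof -
    interpret dominated_functional U V A "\<lambda>x. b x y" "c * hnorm W y"
      by unfold_locales (simp_all add: A y c bound sesquilinear_form_expand(1,2)[OF b])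
    show ?thesis by (rule riesz[OF complete_space_axioms]) blast
  qed
  then obtain B where B: "\<And>y. y \<in> hcar W \<Longrightarrow> B y \<in> ?M"
    "\<And>y. y \<in> hcar W \<Longrightarrow> hnorm V (B y) \<le> c * hnorm W y"
    "\<And>x y. x \<in> hcar U \<Longrightarrow> y \<in> hcar W \<Longrightarrow> b x y = hinner V (A x) (B y)" by metis
  have "bop W V B"
  proof (rule bopI[OF _ _ _ B(2)])
    show "B (hadd W y z) = hadd V (B y) (B z)" if "y \<in> hcar W" "z \<in> hcar W" for y z
      using that B M bop_closed[OF A] sesquilinear_form_expand(3)[OF b]
      by (intro closed_span_eqI[OF AU]) (auto simp flip: B(3))
    show "B (hscale W s z) = hscale V s (B z)" if "z \<in> hcar W" for s z
      using that B M bop_closed[OF A] sesquilinear_form_expand(4)[OF b]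
      by (intro closed_span_eqI[OF AU]) (auto simp flip: B(3))
  qed (use B M in auto)
  then show ?thesis using B(2,3) by blast
qed

end

lemma sesquilinear_form_inner_bop:
  assumes A: "bop U V A" and V: "inner_space V" and G: "bop W V G"
  shows "sesquilinear_form U W (\<lambda>x y. hinner V (A x) (G y))"
proof -
  interpret inner_space V by fact
  show ?thesis
    unfolding sesquilinear_form_def using bopD[OF A] bopD[OF G] by simp
qed

lemma
  assumes V: "complete_space V" and W: "inner_space W" and A: "bop V W A"
  shows bop_hadj: "bop W V (hadj V W A)"
    and inner_hadj: "x \<in> hcar V \<Longrightarrow> y \<in> hcar W \<Longrightarrow> hinner V x (hadj V W A y) = hinner W (A x) y"
proof -
  interpret V: complete_space V by fact
  interpret W: inner_space W by fact
  obtain c where c: "0 \<le> c" "\<And>x. x \<in> hcar V \<Longrightarrow> hnorm W (A x) \<le> c * hnorm V x"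
    using bop_bound[OF A V.inner_space_axioms] by blast
  have "cmod (hinner W (A x) y) \<le> c * hnorm W y * hnorm V x" if "x \<in> hcar V" "y \<in> hcar W" for x y
    using W.cauchy_schwarz[of "A x" y] mult_right_mono[OF c(2)[of x], of "hnorm W y"] that
      bop_closed[OF A]
    by (simp add: mult_ac)
  from V.sesquilinear_form_representation[OF V.inner_space_axioms bop_id W
      sesquilinear_form_inner_bop[OF A W bop_id] c(1) this]
  have "\<exists>B. bop W V B \<and> (\<forall>x\<in>hcar V. \<forall>y\<in>hcar W. hinner W (A x) y = hinner V x (B y))" by blast
  from someI_ex[OF this]
  show "bop W V (hadj V W A)"
    and "x \<in> hcar V \<Longrightarrow> y \<in> hcar W \<Longrightarrow> hinner V x (hadj V W A y) = hinner W (A x) y"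
    unfolding hadj_def[symmetric] by simp_all
qed

lemma inner_hadj_left:
  assumes V: "complete_space V" and W: "inner_space W" and A: "bop V W A"
    and x: "x \<in> hcar V" and y: "y \<in> hcar W"
  shows "hinner V (hadj V W A y) x = hinner W y (A x)"
proof -
  interpret V: complete_space V by fact
  interpret W: inner_space W by fact
  show ?thesis
    using inner_hadj[OF V W A x y] V.inner_cnj[OF x bop_closed[OF bop_hadj[OF V W A] y]]
      W.inner_cnj[OF bop_closed[OF A x] y] by simp
qed

lemma hadj_orthogonal_eq_zero:
  assumes V: "complete_space V" and W: "inner_space W" and A: "bop V W A" and B: "bop U W B"
    and orth: "orthogonal_ranges V U W A B" and u: "u \<in> hcar U"
  shows "hadj V W A (B u) = hzero V"
proof -
  interpret V: complete_space V by fact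
  have "B u \<in> hcar W" "hadj V W A (B u) \<in> hcar V"
    using bop_closed[OF B u] bop_closed[OF bop_hadj[OF V W A]] by auto
  then show ?thesis
    using inner_hadj[OF V W A] orthogonal_rangesD[OF orth _ u] by (intro V.inner_definite) simp_all
qed

text \<open>Through the Riesz representation relative to \<open>A\<close>, \<open>\<langle>G x, w\<rangle> = \<langle>A x, B w\<rangle>\<close> defines a
  contraction \<open>B\<close>; take \<open>C = B\<^sup>*\<close>.\<close>

lemma douglas_factorization:
  assumes V: "complete_space V" and W: "complete_space W" and U: "inner_space U"
    and A: "bop U V A" and G: "bop U W G"
    and le: "\<And>x. x \<in> hcar U \<Longrightarrow> hnorm W (G x) \<le> hnorm V (A x)"
  obtains C where "bop V W C" "\<And>y. y \<in> hcar V \<Longrightarrow> hnorm W (C y) \<le> hnorm V y"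
    and "\<And>x. x \<in> hcar U \<Longrightarrow> C (A x) = G x"
proof -
  interpret V: complete_space V by fact
  interpret W: complete_space W by fact
  have "cmod (hinner W (G x) w) \<le> 1 * hnorm W w * hnorm V (A x)"
    if "x \<in> hcar U" "w \<in> hcar W" for x w
    using W.cauchy_schwarz[of "G x" w] mult_right_mono[OF le[of x], of "hnorm W w"] that
      bop_closed[OF G]
    by (simp add: mult_ac)
  from V.sesquilinear_form_representation[OF U A W.inner_space_axioms
      sesquilinear_form_inner_bop[OF G W.inner_space_axioms bop_id] zero_le_one this]
  obtain B where B: "bop W V B" "\<And>w. w \<in> hcar W \<Longrightarrow> hnorm V (B w) \<le> 1 * hnorm W w"
    and GB: "\<And>x w. x \<in> hcar U \<Longrightarrow> w \<in> hcar W \<Longrightarrow> hinner W (G x) w = hinner V (A x) (B w)"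
    by blast
  note adj = W V.inner_space_axioms B(1)
  let ?C = "hadj W V B"
  show thesis
  proof (rule that[OF bop_hadj[OF adj]])
    fix y assume y: "y \<in> hcar V"
    have Cy: "?C y \<in> hcar W" "B (?C y) \<in> hcar V"
      using bop_closed[OF bop_hadj[OF adj] y] bop_closed[OF B(1)] by auto
    show "hnorm W (?C y) \<le> hnorm V y"
    proof (rule le_of_square_le_mult)
      have "hnorm W (?C y) * hnorm W (?C y) = cmod (hinner V (B (?C y)) y)"
        using inner_hadj[OF adj Cy(1) y] W.cmod_inner_self[OF Cy(1)] by simp
      also have "\<dots> \<le> hnorm V (B (?C y)) * hnorm V y" using Cy(2) y by (rule V.cauchy_schwarz)
      also have "\<dots> \<le> hnorm V y * hnorm W (?C y)"
        using mult_right_mono[OF B(2)[OF Cy(1)] V.hnorm_nonneg[OF y]] by (simp add: mult.commute)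
      finally show "hnorm W (?C y) * hnorm W (?C y) \<le> hnorm V y * hnorm W (?C y)" .
    qed (use Cy y in auto)
  next
    fix x assume x: "x \<in> hcar U"
    show "?C (A x) = G x"
      using bop_closed[OF bop_hadj[OF adj] bop_closed[OF A x]] bop_closed[OF G x]
      by (rule W.vector_eqI) (simp add: inner_hadj_left[OF adj] bop_closed[OF A x] GB[OF x])
  qed
qed

section \<open>Direct sums, subspaces and square-summable sequences\<close>

definition complex_line :: "complex cips" where
  "complex_line = \<lparr> hcar = UNIV, hadd = (+), hscale = (*), hzero = 0, hinner = (\<lambda>x y. x * cnj y) \<rparr>"

lemma complex_line_simps [simp]:
  "hcar complex_line = UNIV" "hadd complex_line = (+)" "hscale complex_line = (*)"
  "hzero complex_line = 0" "hinner complex_line x y = x * cnj y"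
  by (simp_all add: complex_line_def)

lemma complete_space_complex_line: "complete_space complex_line"
proof
  have norm: "hnorm complex_line x = cmod x" for x
    by (simp add: hnorm_def cmod_def power2_eq_square)
  fix f :: "nat \<Rightarrow> complex"
  assume "cauchy_seq complex_line f"
  then have "Cauchy f"
    by (intro metric_CauchyI) (simp add: cauchy_seq_def norm hsub_def dist_norm)
  then obtain l where "f \<longlonglongrightarrow> l" using Cauchy_convergent convergent_def by blast
  then have "tends_to complex_line f l"
    by (simp add: tends_to_def norm hsub_def LIM_zero tendsto_norm_zero)
  then show "\<exists>l\<in>hcar complex_line. tends_to complex_line f l" by auto
qed (auto simp: algebra_simps)

lemma dsum_simps [simp]:
  "hcar (dsum A B) = hcar A \<times> hcar B"
  "hadd (dsum A B) (a, b) (c, d) = (hadd A a c, hadd B b d)"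
  "hscale (dsum A B) s (a, b) = (hscale A s a, hscale B s b)"
  "hzero (dsum A B) = (hzero A, hzero B)"
  "hinner (dsum A B) (a, b) (c, d) = hinner A a c + hinner B b d"
  by (simp_all add: dsum_def)

lemma hsub_dsum [simp]: "hsub (dsum A B) (a, b) (c, d) = (hsub A a c, hsub B b d)"
  by (simp add: hsub_def)

lemma hsq_dsum [simp]: "hsq (dsum A B) (a, b) = hsq A a + hsq B b"
  by (simp add: hsq_def)

lemma inner_space_dsum:
  assumes "inner_space A" "inner_space B"
  shows "inner_space (dsum A B)"
proof -
  interpret A: inner_space A by fact
  interpret B: inner_space B by fact
  show ?thesis
  proof
    fix x y assume "x \<in> hcar (dsum A B)" "y \<in> hcar (dsum A B)"
    then show "hinner (dsum A B) y x = cnj (hinner (dsum A B) x y)"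
      using A.inner_cnj[of "fst x" "fst y"] B.inner_cnj[of "snd x" "snd y"]
      by (cases x; cases y) simp
  next
    fix x assume x: "x \<in> hcar (dsum A B)" and zero: "hinner (dsum A B) x x = 0"
    obtain a b where ab: "x = (a, b)" "a \<in> hcar A" "b \<in> hcar B" using x by auto
    have "hsq A a + hsq B b = 0" using zero unfolding ab hsq_dsum[symmetric] by (simp add: hsq_def)
    then show "x = hzero (dsum A B)"
      using ab by (simp add: A.hsq_eq_0_iff B.hsq_eq_0_iff add_nonneg_eq_0_iff)
  qed (auto simp: A.add_ac B.add_ac A.add_neg B.add_neg A.scale_scale
      B.scale_scale A.scale_one B.scale_one A.scale_add_right B.scale_add_right A.scale_add_left
      B.scale_add_left A.inner_nonneg B.inner_nonneg algebra_simps)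
qed

lemma hnorm_le_hnorm_dsum:
  assumes "inner_space A" "inner_space B" "a \<in> hcar A" "b \<in> hcar B"
  shows "hnorm A a \<le> hnorm (dsum A B) (a, b)" "hnorm B b \<le> hnorm (dsum A B) (a, b)"
  using assms inner_space.inner_nonneg[of A a] inner_space.inner_nonneg[of B b]
  by (auto simp: hnorm_def)

lemma cauchy_seq_mono:
  assumes "cauchy_seq V f"
    and "\<And>m n. hnorm W (hsub W (g m) (g n)) \<le> hnorm V (hsub V (f m) (f n))"
  shows "cauchy_seq W g"
  using assms unfolding cauchy_seq_def by (meson order_le_less_trans)

lemma complete_space_dsum:
  assumes "complete_space A" "complete_space B"
  shows "complete_space (dsum A B)"
proof -
  interpret A: complete_space A by fact
  interpret B: complete_space B by fact
  interpret D: inner_space "dsum A B"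
    by (rule inner_space_dsum) (rule A.inner_space_axioms B.inner_space_axioms)+
  show ?thesis
  proof
    fix f :: "nat \<Rightarrow> 'a \<times> 'b"
    assume f: "\<And>n. f n \<in> hcar (dsum A B)" and cauchy: "cauchy_seq (dsum A B) f"
    define g h where "g n = fst (f n)" and "h n = snd (f n)" for n
    have gh: "g n \<in> hcar A" "h n \<in> hcar B" "f n = (g n, h n)" for n
      using f[of n] by (auto simp: g_def h_def mem_Times_iff)
    have dist: "hnorm A (hsub A (g m) (g n)) \<le> hnorm (dsum A B) (hsub (dsum A B) (f m) (f n))"
      "hnorm B (hsub B (h m) (h n)) \<le> hnorm (dsum A B) (hsub (dsum A B) (f m) (f n))" for m n
      using hnorm_le_hnorm_dsum[OF A.inner_space_axioms B.inner_space_axioms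
          A.sub_closed[OF gh(1) gh(1)] B.sub_closed[OF gh(2) gh(2)], of m n m n]
      by (simp_all add: gh(3))
    obtain l where l: "l \<in> hcar A" "tends_to A g l"
      using A.complete[OF gh(1) cauchy_seq_mono[OF cauchy dist(1)]] by blast
    obtain k where k: "k \<in> hcar B" "tends_to B h k"
      using B.complete[OF gh(2) cauchy_seq_mono[OF cauchy dist(2)]] by blast
    have "(\<lambda>n. hsq (dsum A B) (hsub (dsum A B) (f n) (l, k))) \<longlonglongrightarrow> 0"
      using l k gh tendsto_add[of "\<lambda>n. hsq A (hsub A (g n) l)" 0 _ "\<lambda>n. hsq B (hsub B (h n) k)" 0]
      by (simp add: A.tends_to_iff_hsq B.tends_to_iff_hsq)
    then have "tends_to (dsum A B) f (l, k)" using D.tends_to_iff_hsq[OF f, of "(l, k)"] l k by simp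
    then show "\<exists>l\<in>hcar (dsum A B). tends_to (dsum A B) f l" using l k by auto
  qed
qed

definition restrict_space :: "'v cips \<Rightarrow> 'v set \<Rightarrow> 'v cips" where
  "restrict_space V L = V\<lparr>hcar := L\<rparr>"

lemma restrict_space_simps [simp]:
  "hcar (restrict_space V L) = L" "hadd (restrict_space V L) = hadd V"
  "hscale (restrict_space V L) = hscale V" "hzero (restrict_space V L) = hzero V"
  "hinner (restrict_space V L) = hinner V" "hsub (restrict_space V L) = hsub V"
  "hnorm (restrict_space V L) = hnorm V" "hsq (restrict_space V L) = hsq V"
  "tends_to (restrict_space V L) = tends_to V" "cauchy_seq (restrict_space V L) = cauchy_seq V"
  by (simp_all add: restrict_space_def hsub_def hnorm_def hsq_def tends_to_def cauchy_seq_def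
    fun_eq_iff)

lemma restrict_space_carrier [simp]: "restrict_space V (hcar V) = V"
  by (cases V) (simp add: restrict_space_def)

lemma inner_space_restrict:
  assumes "inner_space V" "linear_subspace V L"
  shows "inner_space (restrict_space V L)"
proof -
  interpret inner_space V by fact
  note L = linear_subspaceD[OF assms(2)]
  show ?thesis
  proof
    fix x y assume "x \<in> hcar (restrict_space V L)" "y \<in> hcar (restrict_space V L)"
    then show "hinner (restrict_space V L) y x = cnj (hinner (restrict_space V L) x y)"
      using L(1) by (simp add: inner_cnj[symmetric])
  qed (simp_all add: L add_ac add_neg scale_scale scale_one scale_add_right
      scale_add_left inner_nonneg inner_definite)
qed

lemma complete_space_restrict:
  assumes "complete_space V" "closed_subspace V L"
  shows "complete_space (restrict_space V L)"
proof -
  interpret complete_space V by fact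
  interpret L: inner_space "restrict_space V L"
    using inner_space_axioms closed_subspace_linear[OF assms(2)] by (rule inner_space_restrict)
  show ?thesis
  proof
    fix f :: "nat \<Rightarrow> 'a"
    assume f: "\<And>n. f n \<in> hcar (restrict_space V L)" and cauchy: "cauchy_seq (restrict_space V L) f"
    have fL: "f n \<in> L" for n using f by simp
    obtain l where l: "l \<in> hcar V" "tends_to V f l"
      using complete[of f] closed_subspaceD(1)[OF assms(2) fL] cauchy by auto
    have "l \<in> L" using assms(2) fL l by (rule closed_subspace_limit)
    then show "\<exists>l\<in>hcar (restrict_space V L). tends_to (restrict_space V L) f l" using l by auto
  qed
qed

lemma bop_restrict:
  assumes "bop V W A" "K \<subseteq> hcar V" "\<And>x. x \<in> K \<Longrightarrow> A x \<in> L"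
  shows "bop (restrict_space V K) (restrict_space W L) A"
proof -
  obtain c where "\<And>x. x \<in> hcar V \<Longrightarrow> hnorm W (A x) \<le> c * hnorm V x"
    using assms(1) unfolding bop_def by blast
  then show ?thesis using assms(2,3) bopD[OF assms(1)]
    by (intro bopI[where c = c]) (auto simp: subset_iff)
qed

lemma closed_subspace_of_restrict:
  assumes L: "closed_subspace V L" and K: "closed_subspace (restrict_space V L) K"
  shows "closed_subspace V K"
  unfolding closed_subspace_iff
proof (intro conjI allI impI)
  have KL: "K \<subseteq> L" using closed_subspaceD(1)[OF K] by auto
  then show "linear_subspace V K"
    using closed_subspaceD[OF K] closed_subspaceD(1)[OF L] by (auto simp: linear_subspace_def)
  fix f l assume f: "\<forall>n. f n \<in> K" and l: "l \<in> hcar V" and lim: "tends_to V f l"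
  have "l \<in> L" by (rule closed_subspace_limit[OF L _ l lim]) (use f KL in blast)
  then show "l \<in> K" by (rule closed_subspace_limit[OF K, of f, simplified, OF spec[OF f] _ lim])
qed

definition ell2 :: "'v cips \<Rightarrow> (nat \<Rightarrow> 'v) cips" where
  "ell2 V = \<lparr> hcar = {f. (\<forall>n. f n \<in> hcar V) \<and> summable (\<lambda>n. hsq V (f n))},
     hadd = (\<lambda>f g n. hadd V (f n) (g n)), hscale = (\<lambda>s f n. hscale V s (f n)),
     hzero = (\<lambda>n. hzero V), hinner = (\<lambda>f g. \<Sum>n. hinner V (f n) (g n)) \<rparr>"

lemma ell2_simps [simp]:
  "hadd (ell2 V) f g = (\<lambda>n. hadd V (f n) (g n))"
  "hscale (ell2 V) s f = (\<lambda>n. hscale V s (f n))"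
  "hzero (ell2 V) = (\<lambda>n. hzero V)"
  "hsub (ell2 V) f g = (\<lambda>n. hsub V (f n) (g n))"
  by (simp_all add: ell2_def hsub_def)

lemma hinner_ell2: "hinner (ell2 V) f g = (\<Sum>n. hinner V (f n) (g n))"
  by (simp add: ell2_def)

lemma mem_ell2: "f \<in> hcar (ell2 V) \<longleftrightarrow> (\<forall>n. f n \<in> hcar V) \<and> summable (\<lambda>n. hsq V (f n))"
  by (simp add: ell2_def)

lemma ell2_component [simp]: "f \<in> hcar (ell2 V) \<Longrightarrow> f n \<in> hcar V"
  by (simp add: mem_ell2)

lemma ell2_summable: "f \<in> hcar (ell2 V) \<Longrightarrow> summable (\<lambda>n. hsq V (f n))"
  by (simp add: mem_ell2)

context inner_space
begin

lemma hsq_add_le: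
  assumes "x \<in> hcar V" "y \<in> hcar V"
  shows "hsq V (hadd V x y) \<le> 2 * hsq V x + 2 * hsq V y"
proof -
  have "0 \<le> hsq V (hsub V x y)" using assms by simp
  also have "\<dots> = 2 * hsq V x + 2 * hsq V y - hsq V (hadd V x y)"
    using assms by (simp add: hsq_def)
  finally show ?thesis by simp
qed

lemma cmod_inner_le:
  assumes "x \<in> hcar V" "y \<in> hcar V"
  shows "cmod (hinner V x y) \<le> hsq V x + hsq V y"
proof -
  have "2 * cmod (hinner V x y) \<le> 2 * hnorm V x * hnorm V y" using cauchy_schwarz[OF assms] by simp
  also have "\<dots> \<le> hsq V x + hsq V y"
    using sum_squares_bound[of "hnorm V x" "hnorm V y"] assms by (simp add: hnorm_sq)
  finally show ?thesis using norm_ge_zero[of "hinner V x y"] by linarith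
qed

lemma summable_inner:
  assumes "f \<in> hcar (ell2 V)" "g \<in> hcar (ell2 V)"
  shows "summable (\<lambda>n. hinner V (f n) (g n))"
  by (rule summable_comparison_test'[of "\<lambda>n. hsq V (f n) + hsq V (g n)"])
    (use assms in \<open>auto intro: summable_add ell2_summable cmod_inner_le\<close>)

lemma hsq_ell2: "f \<in> hcar (ell2 V) \<Longrightarrow> hsq (ell2 V) f = (\<Sum>n. hsq V (f n))"
  by (simp add: hsq_def hinner_ell2 summable_inner Re_suminf)

lemma inner_space_ell2: "inner_space (ell2 V)"
proof
  fix f g assume f: "f \<in> hcar (ell2 V)" and g: "g \<in> hcar (ell2 V)"
  have "summable (\<lambda>n. hsq V (hadd V (f n) (g n)))"
    by (rule summable_comparison_test'[of "\<lambda>n. 2 * hsq V (f n) + 2 * hsq V (g n)"])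
      (use f g in \<open>auto intro!: summable_add summable_mult ell2_summable hsq_add_le\<close>)
  then show "hadd (ell2 V) f g \<in> hcar (ell2 V)" using f g by (simp add: mem_ell2)
  have "cnj (\<Sum>n. hinner V (f n) (g n)) = (\<Sum>n. cnj (hinner V (f n) (g n)))"
    by (rule bounded_linear.suminf[OF bounded_linear_cnj summable_inner[OF f g]])
  then show "hinner (ell2 V) g f = cnj (hinner (ell2 V) f g)"
    using f g by (simp add: hinner_ell2 inner_cnj[symmetric])
next
  fix f assume f: "f \<in> hcar (ell2 V)"
  have sum: "Re (hinner (ell2 V) f f) = (\<Sum>n. hsq V (f n))" using hsq_ell2[OF f]
    by (simp add: hsq_def)
  then show "0 \<le> Re (hinner (ell2 V) f f)" using f by (simp add: suminf_nonneg ell2_summable)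
  assume "hinner (ell2 V) f f = 0"
  then have "\<forall>n. hsq V (f n) = 0"
    using sum f suminf_eq_zero_iff[OF ell2_summable[OF f]] by simp
  then show "f = hzero (ell2 V)" using f by (auto simp: fun_eq_iff hsq_eq_0_iff)
qed (auto simp: mem_ell2 hsq_scale add_ac add_neg scale_scale scale_one scale_add_right
    scale_add_left hinner_ell2 suminf_add suminf_mult summable_inner intro: summable_mult)

end

lemma partial_sums_bounded_imp_summable:
  fixes f :: "nat \<Rightarrow> real"
  assumes "\<And>n. 0 \<le> f n" "\<And>N. (\<Sum>n<N. f n) \<le> B"
  shows "summable f"
  using assms
  by (intro bounded_imp_summable[of f B])
    (simp_all add: lessThan_Suc_atMost[symmetric] del: sum.lessThan_Suc)

context inner_space
begin

lemma hsq_component_le_ell2: "f \<in> hcar (ell2 V) \<Longrightarrow> hsq V (f n) \<le> hsq (ell2 V) f"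
  using sum_le_suminf[OF ell2_summable, of f V "{n}"] by (simp add: hsq_ell2)

lemma ell2_lower_semicontinuous:
  assumes f: "\<And>n. f n \<in> hcar (ell2 V)" and g: "\<And>k. g k \<in> hcar V"
    and lim: "\<And>k. tends_to V (\<lambda>n. f n k) (g k)"
    and bound: "\<And>n. N \<le> n \<Longrightarrow> hsq (ell2 V) (f n) \<le> B"
  shows "g \<in> hcar (ell2 V)" and "hsq (ell2 V) g \<le> B"
proof -
  have partial: "(\<Sum>k<K. hsq V (g k)) \<le> B" for K
  proof (rule LIMSEQ_le_const2)
    have "(\<lambda>n. hsq V (f n k)) \<longlonglongrightarrow> hsq V (g k)" for k
      using tendsto_power[OF tendsto_hnorm[of "\<lambda>n. f n k", OF _ g lim], where n = 2] f g
      by (simp add: hnorm_sq)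
    then show "(\<lambda>n. \<Sum>k<K. hsq V (f n k)) \<longlonglongrightarrow> (\<Sum>k<K. hsq V (g k))" by (rule tendsto_sum)
    have "(\<Sum>k<K. hsq V (f n k)) \<le> hsq (ell2 V) (f n)" for n
      using f by (simp add: hsq_ell2 sum_le_suminf ell2_summable)
    then show "\<exists>N. \<forall>n\<ge>N. (\<Sum>k<K. hsq V (f n k)) \<le> B" using bound order_trans by blast
  qed
  then have "summable (\<lambda>k. hsq V (g k))" using g by (intro partial_sums_bounded_imp_summable) auto
  then show gE: "g \<in> hcar (ell2 V)" using g by (simp add: mem_ell2)
  show "hsq (ell2 V) g \<le> B"
    unfolding hsq_ell2[OF gE] using ell2_summable[OF gE] partial by (rule suminf_le_const)
qed

lemma ell2_dist_coordinatewise_limit: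
  assumes f: "\<And>n. f n \<in> hcar (ell2 V)" and x: "x \<in> hcar (ell2 V)" and g: "\<And>k. g k \<in> hcar V"
    and lim: "\<And>k. tends_to V (\<lambda>n. f n k) (g k)"
    and bound: "\<And>n. N \<le> n \<Longrightarrow> hnorm (ell2 V) (hsub (ell2 V) x (f n)) \<le> e"
  shows "hsub (ell2 V) x g \<in> hcar (ell2 V)" and "hnorm (ell2 V) (hsub (ell2 V) x g) \<le> e"
proof -
  interpret E: inner_space "ell2 V" by (rule inner_space_ell2)
  let ?d = "\<lambda>n. hsub (ell2 V) x (f n)"
  have d: "?d n \<in> hcar (ell2 V)" for n using x f by (rule E.sub_closed)
  have sub: "hsub (ell2 V) x g k \<in> hcar V" for k using x g by simp
  have sub_lim: "tends_to V (\<lambda>n. ?d n k) (hsub (ell2 V) x g k)" for k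
    using tends_to_sub_left[of "\<lambda>n. f n k" "g k" "x k"] f g x lim by simp
  have "hsq (ell2 V) (?d n) \<le> e\<^sup>2" if "N \<le> n" for n
    using power_mono[OF bound[OF that] E.hnorm_nonneg[OF d], of 2] unfolding E.hnorm_sq[OF d] .
  note semicontinuous = ell2_lower_semicontinuous[OF d sub sub_lim this]
  show mem: "hsub (ell2 V) x g \<in> hcar (ell2 V)" by (rule semicontinuous)
  have "0 \<le> e" using order_trans[OF E.hnorm_nonneg[OF d] bound] by blast
  with semicontinuous(2) show "hnorm (ell2 V) (hsub (ell2 V) x g) \<le> e"
    unfolding E.hnorm_sq[OF mem, symmetric] by (rule power2_le_imp_le)
qed

end

lemma complete_space_ell2:
  assumes "complete_space V"
  shows "complete_space (ell2 V)"
proof -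
  interpret complete_space V by fact
  interpret E: inner_space "ell2 V" by (rule inner_space_ell2)
  show ?thesis
  proof
    fix f :: "nat \<Rightarrow> nat \<Rightarrow> 'a"
    assume f: "\<And>m. f m \<in> hcar (ell2 V)" and cauchy: "cauchy_seq (ell2 V) f"
    have dist: "hnorm V (hsub V (f m k) (f n k)) \<le> hnorm (ell2 V) (hsub (ell2 V) (f m) (f n))"
      for k m n
      using hsq_component_le_ell2[OF E.sub_closed[OF f f], of m n k]
      by (simp add: hnorm_def hsq_def)
    have "\<exists>l\<in>hcar V. tends_to V (\<lambda>n. f n k) l" for k
      using f by (intro complete cauchy_seq_mono[OF cauchy dist]) simp
    then obtain g where g: "\<And>k. g k \<in> hcar V" "\<And>k. tends_to V (\<lambda>n. f n k) (g k)" by metis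
    have close: "\<exists>N. \<forall>m\<ge>N. hsub (ell2 V) (f m) g \<in> hcar (ell2 V) \<and>
        hnorm (ell2 V) (hsub (ell2 V) (f m) g) \<le> e"
      if e: "0 < e" for e
    proof -
      obtain N where "\<And>m n. N \<le> m \<Longrightarrow> N \<le> n \<Longrightarrow> hnorm (ell2 V) (hsub (ell2 V) (f m) (f n)) \<le> e"
        using cauchy e unfolding cauchy_seq_def by (meson less_imp_le)
      then show ?thesis using ell2_dist_coordinatewise_limit[OF f f g] by blast
    qed
    obtain N where mem: "hsub (ell2 V) (f N) g \<in> hcar (ell2 V)" using close[of 1] by auto
    have "hsub (ell2 V) (f N) (hsub (ell2 V) (f N) g) = g" using f g(1) by simp
    then have gE: "g \<in> hcar (ell2 V)" using E.sub_closed[OF f[of N] mem] by (simp only:)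
    have "tends_to (ell2 V) f g"
      unfolding tends_to_def
    proof (rule LIMSEQ_I)
      fix e :: real assume e: "0 < e"
      then obtain N where N: "\<And>m. N \<le> m \<Longrightarrow> hnorm (ell2 V) (hsub (ell2 V) (f m) g) \<le> e / 2"
        using close[of "e / 2"] by auto
      have "norm (hnorm (ell2 V) (hsub (ell2 V) (f m) g) - 0) < e" if "N \<le> m" for m
        using N[OF that] e E.hnorm_nonneg[OF E.sub_closed[OF f gE], of m] unfolding real_norm_def
        by linarith
      then show "\<exists>N. \<forall>m\<ge>N. norm (hnorm (ell2 V) (hsub (ell2 V) (f m) g) - 0) < e" by blast
    qed
    then show "\<exists>l\<in>hcar (ell2 V). tends_to (ell2 V) f l" using gE by blast
  qed
qed

lemma isometry_ell2_map:
  assumes J: "isometry V W J" and V: "inner_space V" and W: "inner_space W"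
  shows "isometry (ell2 V) (ell2 W) (\<lambda>f n. J (f n))"
proof (rule isometryI)
  interpret V: inner_space V by fact
  interpret W: inner_space W by fact
  fix f assume f: "f \<in> hcar (ell2 V)"
  have hsq: "hsq W (J (f n)) = hsq V (f n)" for n using f by (intro isometry_hsq[OF J V W]) simp
  show Jf: "(\<lambda>n. J (f n)) \<in> hcar (ell2 W)"
    using f isometry_closed[OF J] by (simp add: mem_ell2 hsq)
  show "hsq (ell2 W) (\<lambda>n. J (f n)) = hsq (ell2 V) f"
    using f Jf by (simp add: V.hsq_ell2 W.hsq_ell2 hsq)
qed (simp_all add: bopD[OF isometry_bop[OF J]])

lemma isometry_inl:
  assumes "inner_space B"
  shows "isometry A (dsum A B) (\<lambda>a. (a, hzero B))"
proof -
  interpret B: inner_space B by fact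
  show ?thesis by (rule isometryI) simp_all
qed

section \<open>Orbits and unilateral shifts\<close>

definition orbit_span :: "'v cips \<Rightarrow> ('v \<Rightarrow> 'v) \<Rightarrow> 'v set \<Rightarrow> 'v set" where
  "orbit_span V S M = closed_span V (\<Union>n. (S ^^ n) ` M)"

lemma orbit_span_superset: "M \<subseteq> orbit_span V S M"
proof -
  have "M \<subseteq> (\<Union>n. (S ^^ n) ` M)" using UN_upper[of 0 UNIV "\<lambda>n. (S ^^ n) ` M"] by simp
  then show ?thesis unfolding orbit_span_def using closed_span_superset by (rule subset_trans)
qed

lemma orbit_span_least:
  assumes "closed_subspace V K" "M \<subseteq> K" "\<And>x. x \<in> K \<Longrightarrow> S x \<in> K"
  shows "orbit_span V S M \<subseteq> K"
proof -
  have "(S ^^ n) x \<in> K" if "x \<in> M" for n x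
    by (induction n) (use that assms(2,3) in auto)
  then show ?thesis unfolding orbit_span_def by (intro closed_span_minimal assms(1)) auto
qed

lemma bop_funpow_closed: "bop V V S \<Longrightarrow> x \<in> hcar V \<Longrightarrow> (S ^^ n) x \<in> hcar V"
  by (induction n) (auto simp: bop_closed)

lemma orbit_subset_carrier: "bop V V S \<Longrightarrow> M \<subseteq> hcar V \<Longrightarrow> (\<Union>n. (S ^^ n) ` M) \<subseteq> hcar V"
  by (intro UN_least image_subsetI bop_funpow_closed) auto

context inner_space
begin

lemma closed_subspace_orbit_span:
  assumes "bop V V S" "M \<subseteq> hcar V"
  shows "closed_subspace V (orbit_span V S M)"
  unfolding orbit_span_def
  by (intro closed_subspace_closed_span orbit_subset_carrier assms)

lemma orbit_span_invariant:
  assumes S: "bop V V S" and M: "M \<subseteq> hcar V" and x: "x \<in> orbit_span V S M"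
  shows "S x \<in> orbit_span V S M"
proof -
  let ?O = "\<Union>n. (S ^^ n) ` M"
  have "S y \<in> closed_span V ?O" if y: "y \<in> ?O" for y
  proof -
    obtain n z where "z \<in> M" "y = (S ^^ n) z" using y by blast
    then have "S y \<in> (S ^^ Suc n) ` M" by simp
    then have "S y \<in> ?O" by (rule UN_I[OF UNIV_I])
    then show ?thesis by (rule subsetD[OF closed_span_superset])
  qed
  then have "?O \<subseteq> {y \<in> hcar V. S y \<in> closed_span V ?O}"
    using orbit_subset_carrier[OF S M] by auto
  moreover have "closed_subspace V {y \<in> hcar V. S y \<in> closed_span V ?O}"
    using closed_subspace_orbit_span[OF S M] unfolding orbit_span_def
    by (rule closed_subspace_vimage[OF inner_space_axioms inner_space_axioms S])
  ultimately have "closed_span V ?O \<subseteq> {y \<in> hcar V. S y \<in> closed_span V ?O}"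
    by (intro closed_span_minimal)
  then show ?thesis using x unfolding orbit_span_def by blast
qed

lemma unilateral_shiftI:
  assumes S: "isometry V V S"
    and span: "orbit_span V S {x \<in> hcar V. \<forall>y\<in>S ` hcar V. hinner V y x = 0} = hcar V"
      (is "orbit_span V S ?L = _")
  shows "unilateral_shift V S"
proof -
  note bS = isometry_bop[OF S]
    and inner = isometry_inner[OF S inner_space_axioms inner_space_axioms]
  have inner_funpow: "hinner V ((S ^^ n) x) ((S ^^ n) y) = hinner V x y"
    if "x \<in> hcar V" "y \<in> hcar V" for n x y
    by (induction n) (use that inner bop_funpow_closed[OF bS] in auto)
  have orth_less: "hinner V ((S ^^ n) y) ((S ^^ m) x) = 0"
    if "m < n" and x: "x \<in> ?L" and y: "y \<in> ?L" for m n x y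
  proof -
    obtain k where n: "n = m + Suc k" using \<open>m < n\<close> less_imp_Suc_add by auto
    have "hinner V ((S ^^ n) y) ((S ^^ m) x) = hinner V ((S ^^ Suc k) y) x"
      unfolding n funpow_add comp_apply using x y bop_funpow_closed[OF bS, of y "Suc k"]
      by (intro inner_funpow) auto
    also have "\<dots> = 0" using x y bop_funpow_closed[OF bS, of y k] by simp
    finally show ?thesis .
  qed
  have "hinner V ((S ^^ m) x) ((S ^^ n) y) = 0" if "m \<noteq> n" "x \<in> ?L" "y \<in> ?L" for m n x y
  proof (cases "m < n")
    case True
    have "hinner V ((S ^^ n) y) ((S ^^ m) x) = 0" using True that by (intro orth_less)
    then show ?thesis
      using that inner_cnj[of "(S ^^ n) y" "(S ^^ m) x"] bop_funpow_closed[OF bS] by simp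
  next
    case False
    then show ?thesis using that by (intro orth_less) auto
  qed
  moreover have "closed_subspace V ?L"
    using bop_closed[OF bS] by (intro closed_subspace_orthogonal) auto
  ultimately show ?thesis
    unfolding unilateral_shift_def orbit_span_def[symmetric] using S span by blast
qed

end

lemma bop_restrict_orbit_span:
  assumes "inner_space E" "bop E E W" "M \<subseteq> hcar E"
  shows "bop (restrict_space E (orbit_span E W M)) (restrict_space E (orbit_span E W M)) W"
  using closed_subspaceD(1)[OF inner_space.closed_subspace_orbit_span[OF assms]]
    inner_space.orbit_span_invariant[OF assms] assms(2) by (intro bop_restrict) auto

lemma orbit_span_restrict:
  assumes V: "inner_space V" and S: "bop V V S" and M: "M \<subseteq> hcar V"
  shows "orbit_span (restrict_space V (orbit_span V S M)) S M = orbit_span V S M"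
    (is "orbit_span ?G S M = ?L")
proof
  note L = inner_space.closed_subspace_orbit_span[OF V S M]
  interpret G: inner_space ?G using V closed_subspace_linear[OF L] by (rule inner_space_restrict)
  have SG: "bop ?G ?G S" using V S M by (rule bop_restrict_orbit_span)
  have MG: "M \<subseteq> hcar ?G" using orbit_span_superset by simp
  note N = G.closed_subspace_orbit_span[OF SG MG]
  show "orbit_span ?G S M \<subseteq> ?L" using closed_subspaceD(1)[OF N] by auto
  show "?L \<subseteq> orbit_span ?G S M"
    using closed_subspace_of_restrict[OF L N] orbit_span_superset G.orbit_span_invariant[OF SG MG]
    by (rule orbit_span_least)
qed

definition single :: "'v cips \<Rightarrow> nat \<Rightarrow> 'v \<Rightarrow> nat \<Rightarrow> 'v" where
  "single V n v k = (if k = n then v else hzero V)"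

definition spread :: "'v cips \<Rightarrow> (nat \<Rightarrow> nat) \<Rightarrow> (nat \<Rightarrow> 'v) \<Rightarrow> nat \<Rightarrow> 'v" where
  "spread V \<tau> f k = (if k \<in> range \<tau> then f (inv \<tau> k) else hzero V)"

lemma spread_apply [simp]: "strict_mono \<tau> \<Longrightarrow> spread V \<tau> f (\<tau> n) = f n"
  by (simp add: spread_def strict_mono_imp_inj_on)

lemma spread_outside: "k \<notin> range \<tau> \<Longrightarrow> spread V \<tau> f k = hzero V"
  by (simp add: spread_def)

lemma spread_single:
  assumes "strict_mono \<tau>"
  shows "spread V \<tau> (single V n v) = single V (\<tau> n) v"
proof
  fix k
  show "spread V \<tau> (single V n v) k = single V (\<tau> n) v k"
    using assms by (cases "k \<in> range \<tau>") (auto simp: single_def spread_outside strict_mono_eq)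
qed

context inner_space
begin

lemma single_closed: "v \<in> hcar V \<Longrightarrow> single V n v \<in> hcar (ell2 V)"
  using summable_finite[of "{n}" "\<lambda>k. hsq V (single V n v k)"] by (auto simp: mem_ell2 single_def)

lemma tends_to_truncation:
  assumes f: "f \<in> hcar (ell2 V)"
  shows "tends_to (ell2 V) (\<lambda>N k. if k < N then f k else hzero V) f"
proof -
  interpret E: inner_space "ell2 V" by (rule inner_space_ell2)
  define t where "t N k = (if k < N then f k else hzero V)" for N k
  have tE: "t N \<in> hcar (ell2 V)" for N
    using f summable_finite[of "{..<N}" "\<lambda>k. hsq V (t N k)"] by (auto simp: mem_ell2 t_def)
  have "hsq (ell2 V) (hsub (ell2 V) (t N) f) = (\<Sum>n. hsq V (f (n + N)))" for N
  proof -
    have d: "hsub (ell2 V) (t N) f \<in> hcar (ell2 V)" using tE f by (rule E.sub_closed)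
    have sub: "hsq V (hsub V (t N k) (f k)) = (if k < N then 0 else hsq V (f k))" for k
      using f by (simp add: t_def) (simp add: hsq_def)
    show ?thesis
      using suminf_split_initial_segment[OF ell2_summable[OF d], of N]
      unfolding hsq_ell2[OF d] by (simp add: sub)
  qed
  moreover have "(\<lambda>N. \<Sum>n. hsq V (f (n + N))) \<longlonglongrightarrow> 0"
    using tendsto_diff[OF tendsto_const summable_LIMSEQ[OF ell2_summable[OF f]],
        of "\<Sum>n. hsq V (f n)"]
    by (simp add: suminf_minus_initial_segment[OF ell2_summable[OF f]])
  ultimately have "tends_to (ell2 V) t f" using tE f by (simp only: E.tends_to_iff_hsq)
  then show ?thesis by (simp add: t_def[abs_def])
qed

lemma closed_subspace_ell2_eq_carrier:
  assumes K: "closed_subspace (ell2 V) K" and single: "\<And>n v. v \<in> hcar V \<Longrightarrow> single V n v \<in> K"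
  shows "K = hcar (ell2 V)"
proof
  show "K \<subseteq> hcar (ell2 V)" using closed_subspaceD(1)[OF K] by blast
  show "hcar (ell2 V) \<subseteq> K"
  proof
    fix f assume f: "f \<in> hcar (ell2 V)"
    have "(\<lambda>k. if k < N then f k else hzero V) \<in> K" for N
    proof (induction N)
      case 0
      show ?case using closed_subspaceD(2)[OF K] by simp
    next
      case (Suc N)
      have "(\<lambda>k. if k < Suc N then f k else hzero V)
          = hadd (ell2 V) (\<lambda>k. if k < N then f k else hzero V) (single V N (f N))"
        using f by (auto simp: fun_eq_iff single_def)
      then show ?case using closed_subspaceD(3)[OF K Suc single] f by simp
    qed
    then show "f \<in> K" using f tends_to_truncation[OF f] by (rule closed_subspace_limit[OF K])
  qed
qed

lemma isometry_spread:
  assumes \<tau>: "strict_mono \<tau>"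
  shows "isometry (ell2 V) (ell2 V) (spread V \<tau>)"
proof (rule isometryI)
  fix f assume f: "f \<in> hcar (ell2 V)"
  have outside: "hsq V (spread V \<tau> f k) = 0" if "k \<notin> range \<tau>" for k
    using that by (simp add: spread_outside)
  have "summable (\<lambda>k. hsq V (spread V \<tau> f k))"
    using summable_mono_reindex[OF \<tau>, of "\<lambda>k. hsq V (spread V \<tau> f k)"] outside \<tau> ell2_summable[OF f]
    by simp
  moreover have "spread V \<tau> f k \<in> hcar V" for k using f by (simp add: spread_def)
  ultimately show mem: "spread V \<tau> f \<in> hcar (ell2 V)" by (simp add: mem_ell2)
  show "hsq (ell2 V) (spread V \<tau> f) = hsq (ell2 V) f"
    using suminf_mono_reindex[OF \<tau>, of "\<lambda>k. hsq V (spread V \<tau> f k)"] outside \<tau> f mem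
    by (simp add: hsq_ell2)
qed (auto simp: fun_eq_iff spread_def)

lemma orthogonal_ranges_spread:
  assumes "range \<tau> \<inter> range \<sigma> = {}"
  shows "orthogonal_ranges (ell2 V) (ell2 V) (ell2 V) (spread V \<tau>) (spread V \<sigma>)"
proof -
  have "hinner V (spread V \<tau> f k) (spread V \<sigma> g k) = 0"
    if "f \<in> hcar (ell2 V)" "g \<in> hcar (ell2 V)" for f g k
    using assms that by (auto simp: spread_def)
  then show ?thesis by (simp add: orthogonal_ranges_def hinner_ell2)
qed

lemma unilateral_shift_spread:
  assumes \<tau>: "strict_mono \<tau>" and "0 < \<tau> 0"
  shows "unilateral_shift (ell2 V) (spread V \<tau>)"
proof -
  interpret E: inner_space "ell2 V" by (rule inner_space_ell2)
  let ?S = "spread V \<tau>"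
  let ?L = "{f \<in> hcar (ell2 V). \<forall>g\<in>?S ` hcar (ell2 V). hinner (ell2 V) g f = 0}"
  note S = isometry_spread[OF \<tau>]
  have L: "?L \<subseteq> hcar (ell2 V)" by blast
  have increasing: "n < \<tau> n" for n
  proof (induction n)
    case (Suc n)
    then show ?case using strict_monoD[OF \<tau>, of n "Suc n"] by simp
  qed (rule \<open>0 < \<tau> 0\<close>)
  have "single V n v \<in> orbit_span (ell2 V) ?S ?L" if v: "v \<in> hcar V" for n v
  proof (induction n rule: less_induct)
    case (less n)
    show ?case
    proof (cases "n \<in> range \<tau>")
      case True
      then obtain k where k: "n = \<tau> k" by blast
      have "single V k v \<in> orbit_span (ell2 V) ?S ?L" by (rule less) (simp add: k increasing)
      then have "?S (single V k v) \<in> orbit_span (ell2 V) ?S ?L"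
        by (rule E.orbit_span_invariant[OF isometry_bop[OF S] L])
      then show ?thesis by (simp only: k spread_single[OF \<tau>])
    next
      case False
      have "hinner V (?S g k) (single V n v k) = 0" if "g \<in> hcar (ell2 V)" for g k
        using that v False by (auto simp: single_def spread_def)
      then have "single V n v \<in> ?L" using v by (auto simp: single_closed hinner_ell2)
      then show ?thesis by (rule subsetD[OF orbit_span_superset])
    qed
  qed
  then show ?thesis
    using E.closed_subspace_orbit_span[OF isometry_bop[OF S] L]
    by (intro E.unilateral_shiftI S closed_subspace_ell2_eq_carrier)
qed

end

section \<open>Factorization of positive forms\<close>

definition positive_contraction :: "'v cips \<Rightarrow> ('v \<Rightarrow> 'v) \<Rightarrow> bool" where
  "positive_contraction V A \<longleftrightarrow> bop V V A \<and>
     (\<forall>x\<in>hcar V. \<forall>y\<in>hcar V. hinner V (A x) y = hinner V x (A y)) \<and>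
     (\<forall>x\<in>hcar V. 0 \<le> Re (hinner V (A x) x) \<and> Re (hinner V (A x) x) \<le> hsq V x)"

lemma positive_contractionD:
  assumes "positive_contraction V A"
  shows "bop V V A"
    and "x \<in> hcar V \<Longrightarrow> y \<in> hcar V \<Longrightarrow> hinner V (A x) y = hinner V x (A y)"
    and "x \<in> hcar V \<Longrightarrow> 0 \<le> Re (hinner V (A x) x)"
    and "x \<in> hcar V \<Longrightarrow> Re (hinner V (A x) x) \<le> hsq V x"
  using assms unfolding positive_contraction_def by blast+

primrec square_remainder :: "'v cips \<Rightarrow> ('v \<Rightarrow> 'v) \<Rightarrow> nat \<Rightarrow> 'v \<Rightarrow> 'v" where
  "square_remainder V A 0 = A"
| "square_remainder V A (Suc n) =
     (\<lambda>x. hsub V (square_remainder V A n x) (square_remainder V A n (square_remainder V A n x)))"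

context inner_space
begin

lemma positive_contraction_form:
  assumes A: "positive_contraction V A"
  shows "positive_form V (\<lambda>x y. hinner V (A x) y)"
proof -
  note bA = bopD[OF positive_contractionD(1)[OF A]]
  have "hermitian_form V (\<lambda>x y. hinner V (A x) y)"
  proof (rule hermitian_formI)
    fix x y assume xy: "x \<in> hcar V" "y \<in> hcar V"
    show "hinner V (A y) x = cnj (hinner V (A x) y)"
      using xy bA(1) inner_cnj[of "A x" y] positive_contractionD(2)[OF A, of y x] by simp
  qed (simp_all add: bA inner_space_axioms)
  then show ?thesis by (simp add: positive_form_def positive_contractionD(3)[OF A])
qed

lemma positive_contraction_hsq_le:
  assumes A: "positive_contraction V A" and x: "x \<in> hcar V"
  shows "hsq V (A x) \<le> Re (hinner V (A x) x)"
proof (rule le_of_square_le_mult)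
  note Ax = bop_closed[OF positive_contractionD(1)[OF A] x]
  have "hsq V (A x) * hsq V (A x) = (cmod (hinner V (A x) (A x)))\<^sup>2"
    using Ax by (simp add: inner_self power2_eq_square)
  also have "\<dots> \<le> Re (hinner V (A x) x) * Re (hinner V (A (A x)) (A x))"
    using form_cauchy_schwarz[OF positive_contraction_form[OF A] x Ax] .
  also have "\<dots> \<le> Re (hinner V (A x) x) * hsq V (A x)"
    using positive_contractionD(4)[OF A Ax] positive_contractionD(3)[OF A x]
    by (rule mult_left_mono)
  finally show "hsq V (A x) * hsq V (A x) \<le> Re (hinner V (A x) x) * hsq V (A x)" .
qed (use x positive_contractionD(3)[OF A] bop_closed[OF positive_contractionD(1)[OF A]] in auto)

lemma positive_contraction_square_remainder:
  assumes "positive_contraction V A"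
  shows "positive_contraction V (square_remainder V A n)"
proof (induction n)
  case (Suc n)
  define B where "B = square_remainder V A n"
  have B: "positive_contraction V B" unfolding B_def by (rule Suc)
  note bB = positive_contractionD(1)[OF B] and sym = positive_contractionD(2)[OF B]
  have step: "square_remainder V A (Suc n) = (\<lambda>x. hsub V (B x) (B (B x)))" by (simp add: B_def)
  have form: "hinner V (hsub V (B x) (B (B x))) y = hinner V (B x) y - hinner V (B x) (B y)"
    if "x \<in> hcar V" "y \<in> hcar V" for x y
    using that bop_closed[OF bB] sym[of "B x" y] by simp
  show ?case
    unfolding step positive_contraction_def
  proof (intro conjI ballI)
    show "bop V V (\<lambda>x. hsub V (B x) (B (B x)))"
      by (intro bop_diff bop_compose[OF bB bB] bB inner_space_axioms)
    fix x assume x: "x \<in> hcar V"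
    show "hinner V (hsub V (B x) (B (B x))) y = hinner V x (hsub V (B y) (B (B y)))"
      if "y \<in> hcar V" for y
      using x that bop_closed[OF bB] by (simp add: form sym del: inner_sub_left)
    have "Re (hinner V (hsub V (B x) (B (B x))) x) = Re (hinner V (B x) x) - hsq V (B x)"
      using form[OF x x] by (simp add: hsq_def)
    then show "0 \<le> Re (hinner V (hsub V (B x) (B (B x))) x)"
      "Re (hinner V (hsub V (B x) (B (B x))) x) \<le> hsq V x"
      using positive_contraction_hsq_le[OF B x] positive_contractionD(4)[OF B x]
        hsq_nonneg[OF bop_closed[OF bB x]] by linarith+
  qed
qed (use assms in simp)

text \<open>With \<open>A\<^sub>0 = A\<close> and \<open>A\<^sub>n\<^sub>+\<^sub>1 = A\<^sub>n - A\<^sub>n\<^sup>2\<close> the sum of the \<open>A\<^sub>n\<^sup>2\<close> telescopes to \<open>A\<close>, so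
  \<open>x \<mapsto> (A\<^sub>n x)\<^sub>n\<close> does the work of a square root of \<open>A\<close>.\<close>

lemma square_remainder_sums:
  assumes A: "positive_contraction V A" and x: "x \<in> hcar V" and y: "y \<in> hcar V"
  shows "(\<lambda>n. hinner V (square_remainder V A n x) (square_remainder V A n y)) sums hinner V (A x) y"
proof -
  define R where "R = square_remainder V A"
  have R: "positive_contraction V (R n)" for n
    unfolding R_def using A by (rule positive_contraction_square_remainder)
  have Rc: "R n z \<in> hcar V" if "z \<in> hcar V" for n z
    using positive_contractionD(1)[OF R] that by (rule bopD)
  have telescope: "(\<Sum>j<n. hinner V (R j z) (R j w)) = hinner V (A z) w - hinner V (R n z) w"
    if z: "z \<in> hcar V" and w: "w \<in> hcar V" for z w n
  proof (induction n)
    case 0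
    show ?case by (simp add: R_def)
  next
    case (Suc n)
    have "R (Suc n) z = hsub V (R n z) (R n (R n z))" by (simp add: R_def)
    then have "hinner V (R (Suc n) z) w = hinner V (R n z) w - hinner V (R n z) (R n w)"
      using z w Rc positive_contractionD(2)[OF R Rc[OF z] w] by simp
    then show ?case using Suc by simp
  qed
  have "(\<Sum>j<n. hsq V (R j x)) \<le> Re (hinner V (A x) x)" for n
    using arg_cong[OF telescope[OF x x, of n], of Re] positive_contractionD(3)[OF R x, of n]
    by (simp add: hsq_def)
  then have "(\<lambda>n. hsq V (R n x)) \<longlonglongrightarrow> 0"
    using Rc[OF x] by (intro summable_LIMSEQ_zero partial_sums_bounded_imp_summable) simp
  from tendsto_real_sqrt[OF this] have "(\<lambda>n. hnorm V (R n x)) \<longlonglongrightarrow> 0"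
    by (simp add: hnorm_def hsq_def)
  from cauchy_schwarz[OF Rc[OF x] y] tendsto_mult_left_zero[OF this, of "hnorm V y"]
  have "(\<lambda>n. hinner V (R n x) y) \<longlonglongrightarrow> 0" by (rule tendsto_zero_comparison)
  from tendsto_diff[OF tendsto_const[of "hinner V (A x) y"] this]
  show ?thesis by (simp add: sums_def telescope[OF x y] flip: R_def)
qed

end

context complete_space
begin

lemma positive_contraction_of_form:
  assumes a: "positive_form V a" and bound: "\<And>x. x \<in> hcar V \<Longrightarrow> quad a x \<le> hsq V x"
  obtains A where "positive_contraction V A"
    and "\<And>x y. x \<in> hcar V \<Longrightarrow> y \<in> hcar V \<Longrightarrow> hinner V (A x) y = a x y"
proof -
  note h = positive_form_hermitian[OF a]
  have "cmod (a x y) \<le> 1 * hnorm V y * hnorm V x" if x: "x \<in> hcar V" and y: "y \<in> hcar V" for x y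
  proof (rule power2_le_imp_le)
    have "(cmod (a x y))\<^sup>2 \<le> quad a x * quad a y" using a x y by (rule form_cauchy_schwarz)
    also have "\<dots> \<le> hsq V x * hsq V y"
      using bound x y positive_form_nonneg[OF a] by (intro mult_mono) auto
    finally show "(cmod (a x y))\<^sup>2 \<le> (1 * hnorm V y * hnorm V x)\<^sup>2"
      using x y by (simp add: power_mult_distrib hnorm_sq mult.commute)
  qed (use x y in simp)
  from sesquilinear_form_representation[OF inner_space_axioms bop_id inner_space_axioms
      hermitian_form_sesquilinear[OF h] zero_le_one this]
  obtain A where A: "bop V V A" "\<And>x y. x \<in> hcar V \<Longrightarrow> y \<in> hcar V \<Longrightarrow> a x y = hinner V x (A y)"
    by blast
  have left: "hinner V (A x) y = a x y" if "x \<in> hcar V" "y \<in> hcar V" for x y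
    using that inner_cnj[of y "A x"] bop_closed[OF A(1)] A(2)[of y x] hermitian_form_cnj[OF h, of y x]
    by simp
  show thesis
  proof (rule that[OF _ left])
    show "positive_contraction V A"
      unfolding positive_contraction_def
      using A left bound positive_form_nonneg[OF a] by simp
  qed
qed

lemma contractive_form_factorization:
  assumes a: "positive_form V a" and bound: "\<And>x. x \<in> hcar V \<Longrightarrow> quad a x \<le> hsq V x"
  obtains R where "bop V (ell2 V) R"
    and "\<And>x y. x \<in> hcar V \<Longrightarrow> y \<in> hcar V \<Longrightarrow> hinner (ell2 V) (R x) (R y) = a x y"
proof -
  obtain A where A: "positive_contraction V A"
    and Aa: "\<And>x y. x \<in> hcar V \<Longrightarrow> y \<in> hcar V \<Longrightarrow> hinner V (A x) y = a x y"
    using positive_contraction_of_form[OF a bound] by blast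
  define R where "R x n = square_remainder V A n x" for x n
  have sums: "(\<lambda>n. hinner V (R x n) (R y n)) sums a x y" if "x \<in> hcar V" "y \<in> hcar V" for x y
    using square_remainder_sums[OF A that] Aa[OF that] by (simp add: R_def)
  have bR: "bop V V (\<lambda>x. R x n)" for n
    unfolding R_def
    by (rule positive_contractionD(1)[OF positive_contraction_square_remainder[OF A]])
  have inner: "hinner (ell2 V) (R x) (R y) = a x y" if "x \<in> hcar V" "y \<in> hcar V" for x y
    using sums[OF that] by (simp add: hinner_ell2 sums_iff)
  have "bop V (ell2 V) R"
  proof (rule bopI_hsq[where c = 1])
    fix x assume x: "x \<in> hcar V"
    show "R x \<in> hcar (ell2 V)"
      using sums_summable[OF sums_Re[OF sums[OF x x]]] bop_closed[OF bR x]
      by (simp add: mem_ell2 hsq_def)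
    show "hsq (ell2 V) (R x) \<le> 1 * hsq V x"
      using inner[OF x x] bound[OF x] by (simp add: hsq_def)
  qed (use bopD[OF bR] in \<open>auto simp: fun_eq_iff\<close>)
  then show thesis using inner that by blast
qed

lemma positive_form_factorization:
  assumes a: "positive_form V a" and bound: "\<And>x. x \<in> hcar V \<Longrightarrow> quad a x \<le> c * hsq V x"
  obtains R where "bop V (ell2 V) R"
    and "\<And>x y. x \<in> hcar V \<Longrightarrow> y \<in> hcar V \<Longrightarrow> hinner (ell2 V) (R x) (R y) = a x y"
proof -
  interpret E: inner_space "ell2 V" by (rule inner_space_ell2)
  define k where "k = max c 1"
  have k: "0 < k" by (simp add: k_def)
  have "quad a x / k \<le> hsq V x" if "x \<in> hcar V" for x
    using order_trans[OF bound[OF that] mult_right_mono[of c k, OF _ hsq_nonneg[OF that]]] k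
    by (simp add: k_def pos_divide_le_eq mult.commute)
  then obtain R where R: "bop V (ell2 V) R"
    and inner:
      "\<And>x y. x \<in> hcar V \<Longrightarrow> y \<in> hcar V \<Longrightarrow> hinner (ell2 V) (R x) (R y) = of_real (1 / k) * a x y"
    using contractive_form_factorization[OF positive_form_scale[OF a, of "1 / k"]] k by auto
  have sqrt: "complex_of_real (sqrt k) * of_real (sqrt k) = of_real k"
    using k by (simp flip: of_real_mult)
  let ?R = "\<lambda>x. hscale (ell2 V) (of_real (sqrt k)) (R x)"
  have "hinner (ell2 V) (?R x) (?R y) = a x y" if xy: "x \<in> hcar V" "y \<in> hcar V" for x y
  proof -
    have "hinner (ell2 V) (?R x) (?R y)
        = of_real (sqrt k) * of_real (sqrt k) * hinner (ell2 V) (R x) (R y)"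
      using bop_closed[OF R] xy by (simp only: E.inner_scale_left E.inner_scale_right E.scale_closed
          complex_cnj_complex_of_real mult.assoc)
    then show ?thesis using k by (simp only: sqrt inner[OF xy]) simp
  qed
  then show thesis using that bop_scale[OF R inner_space_ell2] by blast
qed

end

section \<open>Invariant forms\<close>

context complete_space
begin

lemma quad_pullback_bounded:
  assumes U: "inner_space U" and T: "bop U V T" and fc: "\<And>x. x \<in> hcar V \<Longrightarrow> quad f x \<le> c * hsq V x"
  obtains k where "\<And>x. x \<in> hcar U \<Longrightarrow> quad f (T x) \<le> k * hsq U x"
proof -
  interpret U: inner_space U by fact
  obtain d where d: "0 \<le> d" "\<And>x. x \<in> hcar U \<Longrightarrow> hnorm V (T x) \<le> d * hnorm U x"
    using bop_bound[OF T U] by blast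
  have "quad f (T x) \<le> (max c 0 * d\<^sup>2) * hsq U x" if x: "x \<in> hcar U" for x
  proof -
    note Tx = bop_closed[OF T x]
    have "quad f (T x) \<le> max c 0 * hsq V (T x)"
      using fc[OF Tx] mult_right_mono[of c "max c 0", OF _ hsq_nonneg[OF Tx]] by simp
    also have "\<dots> \<le> max c 0 * (d\<^sup>2 * hsq U x)"
      using power_mono[OF d(2)[OF x] hnorm_nonneg[OF Tx], of 2] x Tx
      by (intro mult_left_mono) (simp_all add: power_mult_distrib hnorm_sq U.hnorm_sq)
    finally show ?thesis by (simp add: mult.assoc)
  qed
  then show thesis by (rule that)
qed

text \<open>With \<open>f = R\<^sup>*R\<close> and \<open>g = G\<^sup>*G\<close> one has \<open>\<parallel>G x\<parallel> \<le> \<parallel>R (T x)\<parallel>\<close>, so \<open>G = C R T\<close> for a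
  contraction \<open>C\<close>, and \<open>p = (C R)\<^sup>*(C R)\<close>.\<close>

lemma positive_form_push_forward:
  assumes U: "complete_space U" and T: "bop U V T"
    and f: "positive_form V f" and fc: "\<And>x. x \<in> hcar V \<Longrightarrow> quad f x \<le> c * hsq V x"
    and g: "positive_form U g" and gf: "\<And>x. x \<in> hcar U \<Longrightarrow> quad g x \<le> quad f (T x)"
  obtains p where "positive_form V p" "\<And>x. x \<in> hcar V \<Longrightarrow> quad p x \<le> quad f x"
    and "\<And>x y. x \<in> hcar U \<Longrightarrow> y \<in> hcar U \<Longrightarrow> p (T x) (T y) = g x y"
proof -
  interpret U: complete_space U by fact
  interpret E: complete_space "ell2 V" by (rule complete_space_ell2) (rule complete_space_axioms)
  interpret F: complete_space "ell2 U" by (rule complete_space_ell2) (rule U)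
  obtain R where R: "bop V (ell2 V) R"
    "\<And>x y. x \<in> hcar V \<Longrightarrow> y \<in> hcar V \<Longrightarrow> hinner (ell2 V) (R x) (R y) = f x y"
    using positive_form_factorization[OF f fc] by blast
  have bRT: "bop U (ell2 V) (\<lambda>x. R (T x))" using T R(1) inner_space_axioms by (rule bop_compose)
  obtain k where "\<And>x. x \<in> hcar U \<Longrightarrow> quad f (T x) \<le> k * hsq U x"
    using quad_pullback_bounded[of U T f c, OF U.inner_space_axioms T fc] by blast
  then have "quad g x \<le> k * hsq U x" if "x \<in> hcar U" for x
    using gf[OF that] that order_trans by blast
  then obtain G where G: "bop U (ell2 U) G"
    "\<And>x y. x \<in> hcar U \<Longrightarrow> y \<in> hcar U \<Longrightarrow> hinner (ell2 U) (G x) (G y) = g x y"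
    using U.positive_form_factorization[OF g] by blast
  have "hnorm (ell2 U) (G x) \<le> hnorm (ell2 V) (R (T x))" if "x \<in> hcar U" for x
    using gf[OF that] G(2)[OF that that] R(2) bop_closed[OF T that] by (simp add: hnorm_def)
  then obtain C where C: "bop (ell2 V) (ell2 U) C"
    "\<And>y. y \<in> hcar (ell2 V) \<Longrightarrow> hnorm (ell2 U) (C y) \<le> hnorm (ell2 V) y"
    "\<And>x. x \<in> hcar U \<Longrightarrow> C (R (T x)) = G x"
    using douglas_factorization[OF E.complete_space_axioms F.complete_space_axioms
        U.inner_space_axioms bRT G(1)] by blast
  show thesis
  proof (rule that)
    have "bop V (ell2 U) (\<lambda>x. C (R x))" using R(1) C(1) E.inner_space_axioms by (rule bop_compose)
    with F.positive_form_inner show "positive_form V (\<lambda>x y. hinner (ell2 U) (C (R x)) (C (R y)))"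
      using inner_space_axioms by (rule positive_form_compose)
    show "quad (hinner (ell2 U)) (C (R x)) \<le> quad f x" if x: "x \<in> hcar V" for x
      using C(2)[OF bop_closed[OF R(1) x]] R(2)[OF x x] by (simp add: hnorm_def)
    show "hinner (ell2 U) (C (R (T x))) (C (R (T y))) = g x y" if "x \<in> hcar U" "y \<in> hcar U" for x y
      using that by (simp add: C(3) G(2))
  qed
qed

lemma form_shift_step:
  assumes T: "bop V V T" and expansive: "\<And>x. x \<in> hcar V \<Longrightarrow> hsq V x \<le> hsq V (T x)"
    and q: "positive_form V q" and c: "0 \<le> c"
    and qc: "\<And>x. x \<in> hcar V \<Longrightarrow> quad q x \<le> c * hsq V x"
    and dec: "\<And>x. x \<in> hcar V \<Longrightarrow> quad q (T x) \<le> quad q x"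
  obtains q' where "positive_form V q'" "\<And>x. x \<in> hcar V \<Longrightarrow> quad q x \<le> quad q' x"
    and "\<And>x. x \<in> hcar V \<Longrightarrow> quad q' x \<le> c * hsq V x"
    and "\<And>x y. x \<in> hcar V \<Longrightarrow> y \<in> hcar V \<Longrightarrow> q' (T x) (T y) = q x y"
proof -
  define I where "I x y = of_real c * hinner V x y" for x y
  have I: "positive_form V I" unfolding I_def using positive_form_inner c
    by (rule positive_form_scale)
  have quad_I: "quad I x = c * hsq V x" for x by (simp add: I_def hsq_def)
  note hI = positive_form_hermitian[OF I] and hq = positive_form_hermitian[OF q]
  have f: "positive_form V (\<lambda>x y. I x y - q x y)"
    using hI hq qc by (intro positive_form_diff) (simp_all add: quad_I)
  have g: "positive_form V (\<lambda>x y. I (T x) (T y) - q x y)"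
  proof (rule positive_form_diff[OF _ hq])
    show "hermitian_form V (\<lambda>x y. I (T x) (T y))"
      using positive_form_compose[OF I T inner_space_axioms] by (rule positive_form_hermitian)
    show "quad q x \<le> quad I (T x)" if "x \<in> hcar V" for x
      using qc[OF that] mult_left_mono[OF expansive[OF that] c] unfolding quad_I by linarith
  qed
  obtain p where p: "positive_form V p" "\<And>x. x \<in> hcar V \<Longrightarrow> quad p x \<le> quad I x - quad q x"
    "\<And>x y. x \<in> hcar V \<Longrightarrow> y \<in> hcar V \<Longrightarrow> p (T x) (T y) = I (T x) (T y) - q x y"
    using positive_form_push_forward[OF complete_space_axioms T f _ g, of c] dec
      positive_form_nonneg[OF q] by (auto simp: quad_I)
  show thesis
  proof (rule that)
    show "positive_form V (\<lambda>x y. I x y - p x y)"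
      using hI positive_form_hermitian[OF p(1)]
    proof (rule positive_form_diff)
      show "quad p x \<le> quad I x" if "x \<in> hcar V" for x
        using p(2)[OF that] positive_form_nonneg[OF q that] by linarith
    qed
    show "quad q x \<le> quad (\<lambda>x y. I x y - p x y) x" if "x \<in> hcar V" for x using p(2)[OF that] by simp
    show "quad (\<lambda>x y. I x y - p x y) x \<le> c * hsq V x" if "x \<in> hcar V" for x
      using positive_form_nonneg[OF p(1) that] quad_I[of x] by simp
    show "I (T x) (T y) - p (T x) (T y) = q x y" if "x \<in> hcar V" "y \<in> hcar V" for x y
      by (simp add: p(3)[OF that])
  qed
qed

end

context inner_space
begin

lemma positive_form_limit:
  assumes Q: "\<And>n. positive_form V (Q n)"
    and lim: "\<And>x y. x \<in> hcar V \<Longrightarrow> y \<in> hcar V \<Longrightarrow> (\<lambda>n. Q n x y) \<longlonglongrightarrow> q x y"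
  shows "positive_form V q"
proof -
  note h = positive_form_hermitian[OF Q]
  have "hermitian_form V q"
  proof (rule hermitian_formI[OF _ _ _ inner_space_axioms])
    fix x y z assume xyz: "x \<in> hcar V" "y \<in> hcar V" "z \<in> hcar V"
    have "(\<lambda>n. Q n (hadd V x y) z) \<longlonglongrightarrow> q x z + q y z"
      using tendsto_add[OF lim[OF xyz(1,3)] lim[OF xyz(2,3)]] xyz
      by (simp add: hermitian_form_expand[OF h])
    then show "q (hadd V x y) z = q x z + q y z"
      by (rule LIMSEQ_unique[OF lim[OF add_closed[OF xyz(1,2)] xyz(3)]])
  next
    fix s x y assume xy: "x \<in> hcar V" "y \<in> hcar V"
    have "(\<lambda>n. Q n (hscale V s x) y) \<longlonglongrightarrow> s * q x y"
      using tendsto_mult[OF tendsto_const lim[OF xy], of s] xy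
      by (simp add: hermitian_form_expand[OF h])
    then show "q (hscale V s x) y = s * q x y"
      by (rule LIMSEQ_unique[OF lim[OF scale_closed[OF xy(1)] xy(2)]])
  next
    fix x y assume xy: "x \<in> hcar V" "y \<in> hcar V"
    have "(\<lambda>n. Q n y x) \<longlonglongrightarrow> cnj (q x y)"
      using tendsto_cnj[OF lim[OF xy]] unfolding hermitian_form_cnj[OF h xy, symmetric] .
    then show "q y x = cnj (q x y)" by (rule LIMSEQ_unique[OF lim[OF xy(2,1)]])
  qed
  moreover have "0 \<le> quad q x" if "x \<in> hcar V" for x
    using positive_form_nonneg[OF Q that]
    by (intro LIMSEQ_le_const[OF tendsto_Re[OF lim[OF that that]]]) auto
  ultimately show ?thesis by (simp add: positive_form_def)
qed

lemma monotone_form_limit: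
  assumes Q: "\<And>n. positive_form V (Q n)"
    and mono: "\<And>n x. x \<in> hcar V \<Longrightarrow> quad (Q n) x \<le> quad (Q (Suc n)) x"
    and bound: "\<And>n x. x \<in> hcar V \<Longrightarrow> quad (Q n) x \<le> c * hsq V x"
  obtains q where "positive_form V q"
    and "\<And>x y. x \<in> hcar V \<Longrightarrow> y \<in> hcar V \<Longrightarrow> (\<lambda>n. Q n x y) \<longlonglongrightarrow> q x y"
proof -
  have diag: "(\<lambda>n. quad (Q n) x) \<longlonglongrightarrow> lim (\<lambda>n. quad (Q n) x)" if x: "x \<in> hcar V" for x
  proof -
    have "incseq (\<lambda>n. quad (Q n) x)" using mono[OF x] by (rule incseq_SucI)
    then obtain L where "(\<lambda>n. quad (Q n) x) \<longlonglongrightarrow> L"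
      using bound[OF x] incseq_convergent by blast
    then show ?thesis by (simp add: limI)
  qed
  have "convergent (\<lambda>n. Q n x y)" if x: "x \<in> hcar V" and y: "y \<in> hcar V" for x y
  proof -
    have "hscale V \<i> y \<in> hcar V" using y by simp
    note diag = diag[OF add_closed[OF x y]] diag[OF sub_closed[OF x y]]
      diag[OF add_closed[OF x this]] diag[OF sub_closed[OF x this]]
    show ?thesis
      unfolding form_polarization[OF positive_form_hermitian[OF Q] x y]
      by (rule convergentI[OF tendsto_Complex[
              OF tendsto_divide[OF tendsto_diff[OF diag(1,2)] tendsto_const]
              tendsto_divide[OF tendsto_diff[OF diag(3,4)] tendsto_const]]]) simp_all
  qed
  then have lim: "(\<lambda>n. Q n x y) \<longlonglongrightarrow> lim (\<lambda>n. Q n x y)" if "x \<in> hcar V" "y \<in> hcar V" for x y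
    using that by (simp add: convergent_LIMSEQ_iff)
  show thesis by (rule that[OF positive_form_limit[OF Q lim] lim])
qed

end

context complete_space
begin

lemma invariant_form_sequence:
  assumes T: "bop V V T" and expansive: "\<And>x. x \<in> hcar V \<Longrightarrow> hsq V x \<le> hsq V (T x)"
    and d: "positive_form V d" and c: "0 \<le> c"
    and dc: "\<And>x. x \<in> hcar V \<Longrightarrow> quad d x \<le> c * hsq V x"
    and dec: "\<And>x. x \<in> hcar V \<Longrightarrow> quad d (T x) \<le> quad d x"
  obtains Q where "Q 0 = d" "\<And>n. positive_form V (Q n)"
    and "\<And>n x. x \<in> hcar V \<Longrightarrow> quad (Q n) x \<le> c * hsq V x"
    and "\<And>n x. x \<in> hcar V \<Longrightarrow> quad (Q n) x \<le> quad (Q (Suc n)) x"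
    and "\<And>n x y. x \<in> hcar V \<Longrightarrow> y \<in> hcar V \<Longrightarrow> Q (Suc n) (T x) (T y) = Q n x y"
proof -
  define admissible where "admissible q \<longleftrightarrow> positive_form V q \<and>
    (\<forall>x\<in>hcar V. quad q x \<le> c * hsq V x \<and> quad q (T x) \<le> quad q x)" for q
  define successor where "successor q q' \<longleftrightarrow> (\<forall>x\<in>hcar V. quad q x \<le> quad q' x) \<and>
    (\<forall>x\<in>hcar V. \<forall>y\<in>hcar V. q' (T x) (T y) = q x y)" for q q'
  have "\<exists>q'. admissible q' \<and> successor q q'" if "admissible q" for q
  proof -
    have q: "positive_form V q" "\<And>x. x \<in> hcar V \<Longrightarrow> quad q x \<le> c * hsq V x"
      "\<And>x. x \<in> hcar V \<Longrightarrow> quad q (T x) \<le> quad q x"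
      using that by (auto simp: admissible_def)
    obtain q' where "positive_form V q'" "\<And>x. x \<in> hcar V \<Longrightarrow> quad q x \<le> quad q' x"
      "\<And>x. x \<in> hcar V \<Longrightarrow> quad q' x \<le> c * hsq V x"
      "\<And>x y. x \<in> hcar V \<Longrightarrow> y \<in> hcar V \<Longrightarrow> q' (T x) (T y) = q x y"
      using form_shift_step[OF T expansive q(1) c q(2,3)] by blast
    then show ?thesis by (intro exI[of _ q']) (simp add: admissible_def successor_def)
  qed
  moreover have "admissible d" using d dc dec by (simp add: admissible_def)
  ultimately have "\<exists>Q. \<forall>n. (admissible (Q n) \<and> (n = 0 \<longrightarrow> Q n = d)) \<and> successor (Q n) (Q (Suc n))"
    by (intro dependent_nat_choice) auto
  then obtain Q where "Q 0 = d" "\<And>n. admissible (Q n)" "\<And>n. successor (Q n) (Q (Suc n))" by blast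
  then show thesis by (intro that[of Q]) (simp_all add: admissible_def successor_def)
qed

theorem invariant_form_between:
  assumes "bop V V T" and "\<And>x. x \<in> hcar V \<Longrightarrow> hsq V x \<le> hsq V (T x)"
    and "positive_form V d" and "0 \<le> c"
    and "\<And>x. x \<in> hcar V \<Longrightarrow> quad d x \<le> c * hsq V x"
    and "\<And>x. x \<in> hcar V \<Longrightarrow> quad d (T x) \<le> quad d x"
  obtains q where "positive_form V q" "\<And>x. x \<in> hcar V \<Longrightarrow> quad d x \<le> quad q x"
    and "\<And>x. x \<in> hcar V \<Longrightarrow> quad q x \<le> c * hsq V x"
    and "\<And>x y. x \<in> hcar V \<Longrightarrow> y \<in> hcar V \<Longrightarrow> q (T x) (T y) = q x y"
proof -
  obtain Q where Q: "Q 0 = d" "\<And>n. positive_form V (Q n)"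
    and le: "\<And>n x. x \<in> hcar V \<Longrightarrow> quad (Q n) x \<le> c * hsq V x"
    and mono: "\<And>n x. x \<in> hcar V \<Longrightarrow> quad (Q n) x \<le> quad (Q (Suc n)) x"
    and step: "\<And>n x y. x \<in> hcar V \<Longrightarrow> y \<in> hcar V \<Longrightarrow> Q (Suc n) (T x) (T y) = Q n x y"
    using invariant_form_sequence[OF assms] by blast
  obtain q where q: "positive_form V q"
    and lim: "\<And>x y. x \<in> hcar V \<Longrightarrow> y \<in> hcar V \<Longrightarrow> (\<lambda>n. Q n x y) \<longlonglongrightarrow> q x y"
    using monotone_form_limit[of Q c, OF Q(2) mono le] by blast
  show thesis
  proof (rule that[OF q])
    fix x assume x: "x \<in> hcar V"
    have "quad d x \<le> quad (Q n) x" for n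
      using incseqD[OF incseq_SucI, of "\<lambda>n. quad (Q n) x" 0 n] mono[OF x] by (simp add: Q(1))
    then show "quad d x \<le> quad q x" by (intro LIMSEQ_le_const[OF tendsto_Re[OF lim[OF x x]]]) auto
    show "quad q x \<le> c * hsq V x"
      using le[OF x] by (intro LIMSEQ_le_const2[OF tendsto_Re[OF lim[OF x x]]]) auto
    fix y assume y: "y \<in> hcar V"
    have "(\<lambda>n. Q (Suc n) (T x) (T y)) \<longlonglongrightarrow> q (T x) (T y)"
      using bop_closed[OF assms(1) x] bop_closed[OF assms(1) y] by (intro LIMSEQ_Suc lim)
    then show "q (T x) (T y) = q x y" using LIMSEQ_unique[OF lim[OF x y]] by (simp add: step x y)
  qed
qed

end

section \<open>Defect forms, 2-isometries and covariance\<close>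

context inner_space
begin

lemma
  assumes A: "bop V W A" and W: "inner_space W"
  shows opnorm_nonneg: "0 \<le> opnorm V W A"
    and hnorm_le_opnorm: "x \<in> hcar V \<Longrightarrow> hnorm W (A x) \<le> opnorm V W A * hnorm V x"
proof -
  interpret W: inner_space W by fact
  let ?X = "(\<lambda>x. hnorm W (A x)) ` {x \<in> hcar V. hnorm V x \<le> 1}"
  obtain c where c: "0 \<le> c" "\<And>x. x \<in> hcar V \<Longrightarrow> hnorm W (A x) \<le> c * hnorm V x"
    using bop_bound[OF A inner_space_axioms] by blast
  have "hnorm W (A x) \<le> c" if "x \<in> hcar V" "hnorm V x \<le> 1" for x
    using c(2)[OF that(1)] mult_left_le[OF that(2) c(1)] by linarith
  then have bdd: "bdd_above ?X" by (intro bdd_aboveI2) auto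
  have "hnorm W (A (hzero V)) = 0" using bop_zero[OF A inner_space_axioms W] by simp
  then show "0 \<le> opnorm V W A"
    unfolding opnorm_def using bdd by (intro cSup_upper image_eqI[of _ _ "hzero V"]) auto
  show "hnorm W (A x) \<le> opnorm V W A * hnorm V x" if x: "x \<in> hcar V"
  proof (cases "hnorm V x = 0")
    case True
    then show ?thesis using c(2)[OF x] by simp
  next
    case False
    then have pos: "0 < hnorm V x" using hnorm_nonneg[OF x] by linarith
    let ?y = "hscale V (of_real (1 / hnorm V x)) x"
    have "hnorm V ?y = 1" using pos x by (simp add: hnorm_scale norm_divide)
    then have "hnorm W (A ?y) \<le> opnorm V W A"
      unfolding opnorm_def using bdd x by (intro cSup_upper) auto
    moreover have "hnorm W (A ?y) = hnorm W (A x) / hnorm V x"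
      using pos bop_closed[OF A x] by (simp add: bop_hscale[OF A x] W.hnorm_scale norm_divide)
    ultimately show ?thesis using pos by (simp add: pos_divide_le_eq)
  qed
qed

lemma opnorm_le:
  assumes "\<And>x. x \<in> hcar V \<Longrightarrow> hnorm W (A x) \<le> M * hnorm V x" "0 \<le> M"
  shows "opnorm V W A \<le> M"
  unfolding opnorm_def
proof (rule cSup_least)
  show "(\<lambda>x. hnorm W (A x)) ` {x \<in> hcar V. hnorm V x \<le> 1} \<noteq> {}"
    using hnorm_zero zero_closed by force
  fix r assume "r \<in> (\<lambda>x. hnorm W (A x)) ` {x \<in> hcar V. hnorm V x \<le> 1}"
  then obtain x where x: "x \<in> hcar V" "hnorm V x \<le> 1" "r = hnorm W (A x)" by blast
  show "r \<le> M" using assms(1)[OF x(1)] mult_left_le[OF x(2) assms(2)] x(3) by linarith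
qed

lemma opnorm_le_iff_form_le:
  assumes B: "bop V V B" and a: "positive_form V a"
    and Ba: "\<And>x y. x \<in> hcar V \<Longrightarrow> y \<in> hcar V \<Longrightarrow> hinner V (B x) y = a x y" and M: "0 \<le> M"
  shows "opnorm V V B \<le> M \<longleftrightarrow> (\<forall>x\<in>hcar V. quad a x \<le> M * hsq V x)"
proof (intro iffI ballI)
  fix x assume x: "x \<in> hcar V" and le: "opnorm V V B \<le> M"
  note Bx = bop_closed[OF B x]
  have "quad a x \<le> hnorm V (B x) * hnorm V x"
    using Ba[OF x x] cauchy_schwarz[OF Bx x] complex_Re_le_cmod[of "a x x"] by simp
  also have "\<dots> \<le> (M * hnorm V x) * hnorm V x"
  proof (rule mult_right_mono)
    show "hnorm V (B x) \<le> M * hnorm V x"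
      using hnorm_le_opnorm[OF B inner_space_axioms x] mult_right_mono[OF le hnorm_nonneg[OF x]]
      by linarith
  qed (use x in simp)
  finally show "quad a x \<le> M * hsq V x" using hnorm_sq[OF x]
    by (simp add: power2_eq_square mult.assoc)
next
  assume le: "\<forall>x\<in>hcar V. quad a x \<le> M * hsq V x"
  show "opnorm V V B \<le> M"
  proof (rule opnorm_le[OF _ M])
    fix x assume x: "x \<in> hcar V"
    note Bx = bop_closed[OF B x]
    have "hsq V (B x) * hsq V (B x) = (cmod (a x (B x)))\<^sup>2"
      unfolding Ba[OF x Bx, symmetric] inner_self[OF Bx] by (simp add: power2_eq_square)
    also have "\<dots> \<le> quad a x * quad a (B x)" using a x Bx by (rule form_cauchy_schwarz)
    also have "\<dots> \<le> (M * hsq V x) * (M * hsq V (B x))"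
      using le x Bx M positive_form_nonneg[OF a] by (intro mult_mono) auto
    finally have "hsq V (B x) * hsq V (B x) \<le> (M\<^sup>2 * hsq V x) * hsq V (B x)"
      by (simp add: power2_eq_square mult_ac)
    then have "hsq V (B x) \<le> M\<^sup>2 * hsq V x" by (rule le_of_square_le_mult) (use x Bx in simp_all)
    then have "(hnorm V (B x))\<^sup>2 \<le> (M * hnorm V x)\<^sup>2"
      using x Bx by (simp add: power_mult_distrib hnorm_sq)
    then show "hnorm V (B x) \<le> M * hnorm V x" by (rule power2_le_imp_le) (use x M in simp)
  qed
qed

end

definition defect_form :: "'v cips \<Rightarrow> ('v \<Rightarrow> 'v) \<Rightarrow> 'v \<Rightarrow> 'v \<Rightarrow> complex" where
  "defect_form V T x y = hinner V (T x) (T y) - hinner V x y"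

definition defect :: "'v cips \<Rightarrow> ('v \<Rightarrow> 'v) \<Rightarrow> 'v \<Rightarrow> real" where
  "defect V T x = hsq V (T x) - hsq V x"

lemma quad_defect_form [simp]: "quad (defect_form V T) x = defect V T x"
  by (simp add: defect_form_def defect_def hsq_def)

lemma isometry_defect:
  assumes "isometry V V A" "inner_space V" "x \<in> hcar V"
  shows "defect V A x = 0"
  using isometry_hsq[OF assms(1,2,2,3)] by (simp add: defect_def)

lemma (in inner_space) hermitian_defect_form:
  assumes "bop V V T"
  shows "hermitian_form V (defect_form V T)"
  unfolding defect_form_def
  by (intro hermitian_form_diff positive_form_hermitian positive_form_compose[OF _ assms]
      positive_form_inner inner_space_axioms)

lemma (in inner_space) positive_defect_form:
  assumes "bop V V T" "\<And>x. x \<in> hcar V \<Longrightarrow> 0 \<le> defect V T x"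
  shows "positive_form V (defect_form V T)"
  using assms by (simp add: positive_form_def hermitian_defect_form)

context complete_space
begin

lemmas inner_hadj_self = inner_hadj_left[OF complete_space_axioms inner_space_axioms]
lemmas bop_hadj_self = bop_hadj[OF complete_space_axioms inner_space_axioms]

lemma bop_Delta:
  assumes T: "bop V V T"
  shows "bop V V (Delta V T)"
  unfolding Delta_def[abs_def]
  by (intro bop_diff bop_compose[OF T bop_hadj_self[OF T]] bop_id inner_space_axioms)

lemma inner_Delta:
  "bop V V T \<Longrightarrow> x \<in> hcar V \<Longrightarrow> y \<in> hcar V \<Longrightarrow> hinner V (Delta V T x) y = defect_form V T x y"
  by (simp add: Delta_def defect_form_def bop_closed[OF bop_hadj_self] bopD inner_hadj_self)

lemma inner_twoiso_op:
  assumes T: "bop V V T" and x: "x \<in> hcar V" and y: "y \<in> hcar V"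
  shows "hinner V (twoiso_op V T x) y = defect_form V T (T x) (T y) - defect_form V T x y"
  using x y bop_closed[OF T] bop_closed[OF bop_hadj_self[OF T]]
  by (simp add: twoiso_op_def defect_form_def inner_hadj_self[OF T])

lemma two_isometryI:
  assumes T: "bop V V T" and invariant: "\<And>x. x \<in> hcar V \<Longrightarrow> defect V T (T x) = defect V T x"
  shows "two_isometry V T"
  unfolding two_isometry_def
proof (intro conjI ballI T)
  fix x assume x: "x \<in> hcar V"
  note hermitian = hermitian_defect_form[OF T]
  have "hermitian_form V (\<lambda>x y. defect_form V T (T x) (T y))"
    by (rule hermitian_formI[OF _ _ hermitian_form_cnj[OF hermitian] inner_space_axioms])
      (simp_all add: hermitian_form_expand[OF hermitian] bopD[OF T])
  then have eq: "defect_form V T (T x) (T y) = defect_form V T x y" if "y \<in> hcar V" for y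
    using invariant x that by (intro hermitian_form_eqI[OF _ hermitian]) simp_all
  have "twoiso_op V T x \<in> hcar V"
    using x bop_closed[OF T] bop_closed[OF bop_hadj_self[OF T]] by (simp add: twoiso_op_def)
  then show "twoiso_op V T x = hzero V"
    by (rule vector_eqI) (simp_all add: inner_twoiso_op[OF T x] eq)
qed

lemma opnorm_Delta_le_iff:
  assumes "bop V V T" "\<And>x. x \<in> hcar V \<Longrightarrow> 0 \<le> defect V T x" "0 \<le> M"
  shows "opnorm V V (Delta V T) \<le> M \<longleftrightarrow> (\<forall>x\<in>hcar V. defect V T x \<le> M * hsq V x)"
  using opnorm_le_iff_form_le[OF bop_Delta positive_defect_form inner_Delta] assms by simp

lemma opnorm_Delta_nonneg: "bop V V T \<Longrightarrow> 0 \<le> opnorm V V (Delta V T)"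
  by (intro opnorm_nonneg bop_Delta inner_space_axioms)

lemma cov_eqI:
  assumes T: "bop V V T" and pos: "\<And>x. x \<in> hcar V \<Longrightarrow> 0 \<le> defect V T x" and M: "0 \<le> M"
    and least: "\<And>N. 0 \<le> N \<Longrightarrow> (\<forall>x\<in>hcar V. defect V T x \<le> N * hsq V x) \<longleftrightarrow> M \<le> N"
  shows "cov V T = sqrt M"
proof -
  have "opnorm V V (Delta V T) \<le> N \<longleftrightarrow> M \<le> N" if "0 \<le> N" for N
    using opnorm_Delta_le_iff[OF T pos that] least[OF that] by blast
  from this[of M] this[of "opnorm V V (Delta V T)"] have "opnorm V V (Delta V T) = M"
    using M opnorm_Delta_nonneg[OF T] by auto
  then show ?thesis by (simp add: cov_def)
qed

end

lemma concave_nonneg_seq_increasing: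
  fixes u :: "nat \<Rightarrow> real"
  assumes nonneg: "\<And>n. 0 \<le> u n" and concave: "\<And>n. u (Suc (Suc n)) - u (Suc n) \<le> u (Suc n) - u n"
  shows "u 0 \<le> u 1"
proof (rule ccontr)
  assume "\<not> u 0 \<le> u 1"
  then obtain n where n: "u 0 < real n * (u 0 - u 1)" using reals_Archimedean3[of "u 0 - u 1"]
    by auto
  have step: "u (Suc n) - u n \<le> u 1 - u 0" for n
  proof (induction n)
    case (Suc n)
    then show ?case using concave[of n] by linarith
  qed simp
  have "u n \<le> u 0 - real n * (u 0 - u 1)"
  proof (induction n)
    case (Suc n)
    then show ?case using step[of n] by (simp add: algebra_simps)
  qed simp
  then show False using n nonneg[of n] by linarith
qed

context complete_space
begin

lemma concave_op_bop: "concave_op V T \<Longrightarrow> bop V V T"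
  by (simp add: concave_op_def)

lemma concave_op_defect_decreasing:
  assumes T: "concave_op V T" and x: "x \<in> hcar V"
  shows "defect V T (T x) \<le> defect V T x"
proof -
  have "quad (\<lambda>x y. hinner V (twoiso_op V T x) y) x \<le> 0"
    using T x by (simp add: concave_op_def op_nonpos_def)
  then show ?thesis
    unfolding inner_twoiso_op[OF concave_op_bop[OF T] x x] by simp
qed

lemma concave_op_defect_nonneg:
  assumes T: "concave_op V T" and x: "x \<in> hcar V"
  shows "0 \<le> defect V T x"
proof -
  have iterate: "(T ^^ n) x \<in> hcar V" for n using concave_op_bop[OF T] x by (rule bop_funpow_closed)
  have "hsq V ((T ^^ 0) x) \<le> hsq V ((T ^^ 1) x)"
  proof (rule concave_nonneg_seq_increasing[of "\<lambda>n. hsq V ((T ^^ n) x)"])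
    show "hsq V ((T ^^ Suc (Suc n)) x) - hsq V ((T ^^ Suc n) x)
        \<le> hsq V ((T ^^ Suc n) x) - hsq V ((T ^^ n) x)" for n
      using concave_op_defect_decreasing[OF T iterate[of n]] by (simp add: defect_def)
  qed (use iterate in simp)
  then show ?thesis by (simp add: defect_def)
qed

end

section \<open>Block operators\<close>

lemma bop_fst: "inner_space A \<Longrightarrow> inner_space B \<Longrightarrow> bop (dsum A B) A fst"
  by (rule bopI[where c = 1]) (auto simp: hnorm_le_hnorm_dsum)

lemma bop_snd: "inner_space A \<Longrightarrow> inner_space B \<Longrightarrow> bop (dsum A B) B snd"
  by (rule bopI[where c = 1]) (auto simp: hnorm_le_hnorm_dsum)

lemma bop_inl:
  assumes "inner_space A" "inner_space B"
  shows "bop A (dsum A B) (\<lambda>a. (a, hzero B))"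
  using assms(2) by (intro isometry_bop isometry_inl)

lemma bop_Pair:
  assumes A: "bop U V A" and B: "bop U W B" and U: "inner_space U" and V: "inner_space V"
    and W: "inner_space W"
  shows "bop U (dsum V W) (\<lambda>x. (A x, B x))"
proof -
  interpret U: inner_space U by fact
  interpret V: inner_space V by fact
  interpret W: inner_space W by fact
  obtain c where c: "0 \<le> c" "\<And>x. x \<in> hcar U \<Longrightarrow> hnorm V (A x) \<le> c * hnorm U x"
    using bop_bound[OF A U] by blast
  obtain d where d: "0 \<le> d" "\<And>x. x \<in> hcar U \<Longrightarrow> hnorm W (B x) \<le> d * hnorm U x"
    using bop_bound[OF B U] by blast
  show ?thesis
  proof (rule bopI_hsq)
    fix x assume x: "x \<in> hcar U"
    have "hsq V (A x) \<le> c\<^sup>2 * hsq U x" "hsq W (B x) \<le> d\<^sup>2 * hsq U x"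
      using power_mono[OF c(2)[OF x], of 2] power_mono[OF d(2)[OF x], of 2] x bop_closed[OF A x]
        bop_closed[OF B x]
      by (simp_all add: power_mult_distrib U.hnorm_sq V.hnorm_sq W.hnorm_sq)
    then show "hsq (dsum V W) (A x, B x) \<le> (c\<^sup>2 + d\<^sup>2) * hsq U x" by (simp add: distrib_right)
  qed (use bopD[OF A] bopD[OF B] in auto)
qed

lemma bop_upper_blk:
  assumes P: "bop G G P" and Q: "bop H G Q" and R: "bop H H R" and G: "inner_space G"
    and H: "inner_space H"
  shows "bop (dsum G H) (dsum G H) (upper_blk G P Q R)"
proof -
  note K = inner_space_dsum[OF G H]
  have "bop (dsum G H) (dsum G H) (\<lambda>x. (hadd G (P (fst x)) (Q (snd x)), R (snd x)))"
    by (intro bop_Pair bop_add bop_compose[OF bop_fst P] bop_compose[OF bop_snd Q]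
        bop_compose[OF bop_snd R] G H K)
  then show ?thesis by (simp add: upper_blk_def case_prod_beta')
qed

lemma hsq_upper_blk:
  assumes G: "inner_space G" and W: "bop G G W" and X: "bop H G X"
    and orth: "orthogonal_ranges G H G W X" and g: "g \<in> hcar G" and h: "h \<in> hcar H"
  shows "hsq G (hadd G (W g) (X h)) = hsq G (W g) + hsq G (X h)"
  using inner_space.hsq_add[OF G bop_closed[OF W g] bop_closed[OF X h]]
    orthogonal_rangesD[OF orth g h] by simp

lemma defect_upper_blk:
  assumes "inner_space G" "bop G G W" "bop H G X" "orthogonal_ranges G H G W X"
    and "g \<in> hcar G" "h \<in> hcar H"
  shows "defect (dsum G H) (upper_blk G W X T) (g, h) = defect G W g + hsq G (X h) + defect H T h"
  using hsq_upper_blk[OF assms] by (simp add: defect_def upper_blk_def)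

lemma upper_blk_inl:
  assumes "bop G G W" "bop H G X" "bop H H T" "inner_space G" "inner_space H" "g \<in> hcar G"
  shows "upper_blk G W X T (g, hzero H) = (W g, hzero H)"
  using assms by (simp add: upper_blk_def bop_zero bop_closed inner_space.add_zero)

lemma upper_blk_inr:
  assumes "bop G G W" "bop H G X" "inner_space G" "h \<in> hcar H"
  shows "upper_blk G W X T (hzero G, h) = (X h, T h)"
  using assms by (simp add: upper_blk_def bop_zero bop_closed inner_space.zero_add)

section \<open>Liftings\<close>

lemma is_lifting_upper_blk: "is_lifting G H (upper_blk G W X T) T"
  by (simp add: is_lifting_def upper_blk_def)

lemma bop_into_restrict_orbit_span:
  assumes "bop H E X"
  shows "bop H (restrict_space E (orbit_span E W (X ` hcar H))) X"
  using bop_restrict[OF assms subset_refl, of "orbit_span E W (X ` hcar H)"]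
    orbit_span_superset[of "X ` hcar H" E W] by auto

text \<open>\<open>X h \<oplus> 0 = S (0, h) - (0, T h)\<close>, and \<open>S\<close> acts on \<open>G \<oplus> 0\<close> as \<open>W\<close>.\<close>

lemma closed_invariant_subspace_eq_dsum:
  assumes G: "inner_space G" and H: "inner_space H" and W: "bop G G W" and X: "bop H G X"
    and T: "bop H H T"
    and generating: "orbit_span G W (X ` hcar H) = hcar G"
    and N: "closed_subspace (dsum G H) N" and HN: "\<And>h. h \<in> hcar H \<Longrightarrow> (hzero G, h) \<in> N"
    and invariant: "\<And>x. x \<in> N \<Longrightarrow> upper_blk G W X T x \<in> N"
  shows "N = hcar (dsum G H)"
proof -
  interpret G: inner_space G by fact
  interpret H: inner_space H by fact
  let ?GN = "{g \<in> hcar G. (g, hzero H) \<in> N}"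
  have "closed_subspace G ?GN"
    using G inner_space_dsum[OF G H] bop_inl[OF G H] N by (rule closed_subspace_vimage)
  moreover have "X ` hcar H \<subseteq> ?GN"
  proof (rule image_subsetI)
    fix h assume h: "h \<in> hcar H"
    note Xh = bop_closed[OF X h] and Th = bop_closed[OF T h]
    have "hsub (dsum G H) (upper_blk G W X T (hzero G, h)) (hzero G, T h) \<in> N"
      by (intro closed_subspaceD(5)[OF N] invariant HN h Th)
    then show "X h \<in> ?GN" using Xh Th by (simp add: upper_blk_inr[OF W X G h])
  qed
  moreover have "W g \<in> ?GN" if "g \<in> ?GN" for g
    using that invariant[of "(g, hzero H)"] bop_closed[OF W, of g] upper_blk_inl[OF W X T G H, of g]
    by simp
  ultimately have "hcar G \<subseteq> ?GN" unfolding generating[symmetric] by (rule orbit_span_least)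
  then have "(g, h) \<in> N" if "g \<in> hcar G" "h \<in> hcar H" for g h
    using closed_subspaceD(3)[OF N _ HN[OF that(2)], of "(g, hzero H)"] that by auto
  then show ?thesis using closed_subspaceD(1)[OF N] by auto
qed

lemma minimal_lifting_upper_blk:
  assumes G: "inner_space G" and H: "inner_space H" and W: "bop G G W" and X: "bop H G X"
    and T: "bop H H T"
    and generating: "orbit_span G W (X ` hcar H) = hcar G"
  shows "minimal_lifting G H (upper_blk G W X T) T"
proof -
  interpret G: inner_space G by fact
  interpret K: inner_space "dsum G H" using G H by (rule inner_space_dsum)
  let ?S = "upper_blk G W X T" and ?M = "{hzero G} \<times> hcar H"
  have S: "bop (dsum G H) (dsum G H) ?S" using W X T G H by (rule bop_upper_blk)
  have M: "?M \<subseteq> hcar (dsum G H)" by auto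
  have "orbit_span (dsum G H) ?S ?M = hcar (dsum G H)"
    using K.closed_subspace_orbit_span[OF S M] _ K.orbit_span_invariant[OF S M]
  proof (rule closed_invariant_subspace_eq_dsum[OF G H W X T generating])
    show "(hzero G, h) \<in> orbit_span (dsum G H) ?S ?M" if "h \<in> hcar H" for h
      by (rule subsetD[OF orbit_span_superset]) (use that in simp)
  qed
  then show ?thesis by (simp add: minimal_lifting_def is_lifting_upper_blk orbit_span_def)
qed

lemma bounded_by_dsum_iff_opnorm_le:
  assumes G: "inner_space G" and H: "complete_space H" and T: "concave_op H T"
    and ge: "\<And>h. h \<in> hcar H \<Longrightarrow> defect H T h \<le> q h"
    and le: "\<And>h. h \<in> hcar H \<Longrightarrow> q h \<le> opnorm H H (Delta H T) * hsq H h" and N: "0 \<le> N"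
  shows "(\<forall>g\<in>hcar G. \<forall>h\<in>hcar H. q h \<le> N * hsq (dsum G H) (g, h)) \<longleftrightarrow> opnorm H H (Delta H T) \<le> N"
proof -
  interpret G: inner_space G by fact
  interpret H: complete_space H by fact
  show ?thesis
  proof (intro iffI ballI)
    assume bound: "\<forall>g\<in>hcar G. \<forall>h\<in>hcar H. q h \<le> N * hsq (dsum G H) (g, h)"
    have "defect H T h \<le> N * hsq H h" if "h \<in> hcar H" for h
      using bspec[OF bspec[OF bound G.zero_closed] that] ge[OF that] by simp
    then show "opnorm H H (Delta H T) \<le> N"
      using H.opnorm_Delta_le_iff[OF H.concave_op_bop[OF T] H.concave_op_defect_nonneg[OF T] N]
      by blast
  next
    fix g h assume g: "g \<in> hcar G" and h: "h \<in> hcar H" and opnorm: "opnorm H H (Delta H T) \<le> N"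
    show "q h \<le> N * hsq (dsum G H) (g, h)"
      using le[OF h] mult_right_mono[OF opnorm H.hsq_nonneg[OF h]]
        mult_nonneg_nonneg[OF N G.hsq_nonneg[OF g]]
      by (simp add: distrib_left)
  qed
qed

lemma isometric_upper_blk_lifting:
  assumes G: "complete_space G" and H: "complete_space H" and T: "concave_op H T"
    and W: "isometry G G W" and X: "bop H G X" and orth: "orthogonal_ranges G H G W X"
    and hsq_X: "\<And>h. h \<in> hcar H \<Longrightarrow> hsq G (X h) = q h - defect H T h"
    and invariant: "\<And>h. h \<in> hcar H \<Longrightarrow> q (T h) = q h"
    and le: "\<And>h. h \<in> hcar H \<Longrightarrow> q h \<le> opnorm H H (Delta H T) * hsq H h"
  shows "two_isometry (dsum G H) (upper_blk G W X T)"
    and "cov (dsum G H) (upper_blk G W X T) = sqrt (opnorm H H (Delta H T))"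
proof -
  interpret G: complete_space G by fact
  interpret H: complete_space H by fact
  interpret K: complete_space "dsum G H" using G H by (rule complete_space_dsum)
  let ?K = "dsum G H" and ?S = "upper_blk G W X T"
  note Gi = G.inner_space_axioms and bT = H.concave_op_bop[OF T] and bW = isometry_bop[OF W]
  have S: "bop ?K ?K ?S" using bW X bT Gi H.inner_space_axioms by (rule bop_upper_blk)
  have defect: "defect ?K ?S (g, h) = q h" if "g \<in> hcar G" "h \<in> hcar H" for g h
    using defect_upper_blk[OF Gi bW X orth that] isometry_defect[OF W Gi that(1)] hsq_X[OF that(2)]
    by simp
  have ge: "defect H T h \<le> q h" if "h \<in> hcar H" for h
    using G.hsq_nonneg[OF bop_closed[OF X that]] hsq_X[OF that] by simp
  have "defect ?K ?S (?S (g, h)) = defect ?K ?S (g, h)" if "g \<in> hcar G" "h \<in> hcar H" for g h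
    using that bop_closed[OF bW] bop_closed[OF X] bop_closed[OF bT]
    by (simp add: upper_blk_def[of G W X T] defect[unfolded upper_blk_def] invariant)
  then show "two_isometry ?K ?S" by (intro K.two_isometryI[OF S]) auto
  have "0 \<le> defect ?K ?S x" if "x \<in> hcar ?K" for x
    using that ge H.concave_op_defect_nonneg[OF T] by (fastforce simp: defect)
  moreover have "(\<forall>x\<in>hcar ?K. defect ?K ?S x \<le> N * hsq ?K x) \<longleftrightarrow> opnorm H H (Delta H T) \<le> N"
    if "0 \<le> N" for N
    using bounded_by_dsum_iff_opnorm_le[of G H T q, OF Gi H T ge le that] by (auto simp: defect)
  ultimately show "cov ?K ?S = sqrt (opnorm H H (Delta H T))"
    using H.opnorm_Delta_nonneg[OF bT] by (intro K.cov_eqI[OF S])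
qed

locale ambient_space = H: complete_space H + E: complete_space E
  for H :: "'a cips" and E :: "'b cips" +
  fixes shift embed :: "'b \<Rightarrow> 'b"
  assumes nontrivial: "hcar E \<noteq> {hzero E}"
    and unilateral_shift: "unilateral_shift E shift" and isometry_embed: "isometry E E embed"
    and shift_embed: "orthogonal_ranges E E E shift embed"
    and factorization: "positive_form H q \<Longrightarrow> (\<And>x. x \<in> hcar H \<Longrightarrow> quad q x \<le> c * hsq H x) \<Longrightarrow>
      \<exists>X. bop H E X \<and> (\<forall>h\<in>hcar H. hsq E (X h) = quad q h) \<and>
        orthogonal_ranges E H E shift X \<and> orthogonal_ranges E H E embed X"
begin

lemma isometry_shift: "isometry E E shift"
  using unilateral_shift by (simp add: unilateral_shift_def)

lemma exists_hsq_pos: "\<exists>e\<in>hcar E. 0 < hsq E e"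
  using nontrivial E.zero_closed E.hsq_eq_0_iff E.hsq_nonneg by (force simp: order_less_le)

definition brownian :: "'b \<times> 'b \<Rightarrow> 'b \<times> 'b" where
  "brownian = upper_blk E shift (\<lambda>y. hscale E (complex_of_real (sqrt 2)) (embed y)) shift"

lemma brownian_apply:
  "brownian (f, g) = (hadd E (shift f) (hscale E (complex_of_real (sqrt 2)) (embed g)), shift g)"
  by (simp add: brownian_def upper_blk_def)

lemma bop_brownian: "bop (dsum E E) (dsum E E) brownian"
  unfolding brownian_def
  by (intro bop_upper_blk bop_scale isometry_bop isometry_shift isometry_embed E.inner_space_axioms)

lemma defect_brownian:
  assumes f: "f \<in> hcar E" and g: "g \<in> hcar E"
  shows "defect (dsum E E) brownian (f, g) = 2 * hsq E g"
proof -
  note Ei = E.inner_space_axioms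
  have "orthogonal_ranges E E E shift (\<lambda>y. hscale E (complex_of_real (sqrt 2)) (embed y))"
    using orthogonal_rangesD[OF shift_embed] isometry_closed[OF isometry_embed]
      isometry_closed[OF isometry_shift]
    by (simp add: orthogonal_ranges_def)
  then have "defect (dsum E E) brownian (f, g)
      = defect E shift f + hsq E (hscale E (complex_of_real (sqrt 2)) (embed g)) + defect E shift g"
    unfolding brownian_def using f g
    by (intro defect_upper_blk bop_scale isometry_bop isometry_shift isometry_embed Ei)
  then show ?thesis
    using f g isometry_closed[OF isometry_embed]
    by (simp add: isometry_defect[OF isometry_shift Ei] E.hsq_scale
        isometry_hsq[OF isometry_embed Ei Ei])
qed

lemma two_isometry_brownian: "two_isometry (dsum E E) brownian"
proof -
  note Ei = E.inner_space_axioms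
  interpret EE: complete_space "dsum E E" by (intro complete_space_dsum E.complete_space_axioms)
  show ?thesis
  proof (rule EE.two_isometryI[OF bop_brownian])
    fix x assume "x \<in> hcar (dsum E E)"
    then obtain f g where x: "x = (f, g)" "f \<in> hcar E" "g \<in> hcar E" by auto
    have "hadd E (shift f) (hscale E (complex_of_real (sqrt 2)) (embed g)) \<in> hcar E"
      "shift g \<in> hcar E"
      using x isometry_closed[OF isometry_embed] isometry_closed[OF isometry_shift] by auto
    then show "defect (dsum E E) brownian (brownian x) = defect (dsum E E) brownian x"
      unfolding x(1) brownian_apply[of f g]
      using x isometry_hsq[OF isometry_shift Ei Ei] by (simp add: defect_brownian)
  qed
qed

abbreviation lifting_space :: "(('b \<times> 'b) \<times> 'a) cips" where
  "lifting_space \<equiv> dsum (dsum E E) H"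

abbreviation brownian_lifting ::
    "('a \<Rightarrow> 'a) \<Rightarrow> ('a \<Rightarrow> 'b \<times> 'b) \<Rightarrow> ('b \<times> 'b) \<times> 'a \<Rightarrow> ('b \<times> 'b) \<times> 'a" where
  "brownian_lifting T X \<equiv> upper_blk (dsum E E) brownian X T"

text \<open>\<open>W\<^sup>*X = 0\<close>, \<open>\<parallel>X h\<parallel>\<^sup>2 = \<Delta>(h)\<close>, and the second component of \<open>X\<close> compensates the loss of
  \<open>\<Delta>\<close> under \<open>T\<close>, which makes the defect \<open>2 \<parallel>g\<parallel>\<^sup>2 + 2 \<Delta>(h)\<close> of the lifting invariant.\<close>

definition brownian_coupling :: "('a \<Rightarrow> 'a) \<Rightarrow> ('a \<Rightarrow> 'b \<times> 'b) \<Rightarrow> bool" where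
  "brownian_coupling T X \<longleftrightarrow> bop H (dsum E E) X \<and>
     orthogonal_ranges (dsum E E) H (dsum E E) brownian X \<and>
     (\<forall>h\<in>hcar H. hsq (dsum E E) (X h) = defect H T h) \<and>
     (\<forall>h\<in>hcar H. hsq E (snd (X h)) = defect H T h - defect H T (T h)) \<and>
     orthogonal_ranges E H E shift (\<lambda>h. snd (X h))"

lemma brownian_couplingD:
  assumes "brownian_coupling T X"
  shows "bop H (dsum E E) X" and "orthogonal_ranges (dsum E E) H (dsum E E) brownian X"
    and "h \<in> hcar H \<Longrightarrow> hsq (dsum E E) (X h) = defect H T h"
    and "h \<in> hcar H \<Longrightarrow> hsq E (snd (X h)) = defect H T h - defect H T (T h)"
    and "orthogonal_ranges E H E shift (\<lambda>h. snd (X h))"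
  using assms by (simp_all add: brownian_coupling_def)

context
  fixes T :: "'a \<Rightarrow> 'a"
  assumes concave: "concave_op H T"
begin

lemmas bop_T = H.concave_op_bop[OF concave]
lemmas defect_nonneg = H.concave_op_defect_nonneg[OF concave]
lemmas defect_decreasing = H.concave_op_defect_decreasing[OF concave]
lemmas opnorm_le_iff = H.opnorm_Delta_le_iff[OF bop_T defect_nonneg]
lemmas opnorm_nonneg = H.opnorm_Delta_nonneg[OF bop_T]

lemma defect_le_opnorm: "h \<in> hcar H \<Longrightarrow> defect H T h \<le> opnorm H H (Delta H T) * hsq H h"
  using opnorm_le_iff[OF _ opnorm_nonneg] by blast

lemma brownian_coupling_exists: "\<exists>X. brownian_coupling T X"
proof -
  have d: "positive_form H (defect_form H T)"
    using bop_T defect_nonneg by (rule H.positive_defect_form)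
  have d1: "positive_form H (\<lambda>x y. defect_form H T (T x) (T y))"
    using d bop_T H.inner_space_axioms by (rule positive_form_compose)
  have d0: "positive_form H (\<lambda>x y. defect_form H T x y - defect_form H T (T x) (T y))"
    using positive_form_hermitian[OF d] positive_form_hermitian[OF d1]
    by (rule H.positive_form_diff) (simp add: defect_decreasing)
  have "defect H T (T h) \<le> opnorm H H (Delta H T) * hsq H h" if "h \<in> hcar H" for h
    using defect_decreasing[OF that] defect_le_opnorm[OF that] by linarith
  then obtain X1 where X1: "bop H E X1" "\<And>h. h \<in> hcar H \<Longrightarrow> hsq E (X1 h) = defect H T (T h)"
    "orthogonal_ranges E H E shift X1" "orthogonal_ranges E H E embed X1"
    using factorization[OF d1, of "opnorm H H (Delta H T)"] by auto
  have "defect H T h - defect H T (T h) \<le> opnorm H H (Delta H T) * hsq H h" if "h \<in> hcar H" for h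
    using defect_nonneg[OF bop_closed[OF bop_T that]] defect_le_opnorm[OF that] by linarith
  then obtain X0 where X0: "bop H E X0"
    "\<And>h. h \<in> hcar H \<Longrightarrow> hsq E (X0 h) = defect H T h - defect H T (T h)"
    "orthogonal_ranges E H E shift X0"
    using factorization[OF d0, of "opnorm H H (Delta H T)"] by auto
  have "hinner (dsum E E) (brownian (f, g)) (X1 h, X0 h) = 0"
    if "f \<in> hcar E" "g \<in> hcar E" "h \<in> hcar H" for f g h
    using that isometry_closed[OF isometry_embed] isometry_closed[OF isometry_shift]
      bop_closed[OF X1(1)] orthogonal_rangesD[OF X1(3)] orthogonal_rangesD[OF X1(4)]
      orthogonal_rangesD[OF X0(3)]
    by (simp add: brownian_apply)
  then have "orthogonal_ranges (dsum E E) H (dsum E E) brownian (\<lambda>h. (X1 h, X0 h))"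
    by (auto simp: orthogonal_ranges_def)
  moreover have "bop H (dsum E E) (\<lambda>h. (X1 h, X0 h))"
    using X1(1) X0(1) H.inner_space_axioms E.inner_space_axioms E.inner_space_axioms
    by (rule bop_Pair)
  ultimately have "brownian_coupling T (\<lambda>h. (X1 h, X0 h))"
    using X1(2) X0(2,3) by (simp add: brownian_coupling_def)
  then show ?thesis by blast
qed

context
  fixes X :: "'a \<Rightarrow> 'b \<times> 'b"
  assumes coupling: "brownian_coupling T X"
begin

lemmas bop_X = brownian_couplingD(1)[OF coupling]

interpretation EE: complete_space "dsum E E"
  by (intro complete_space_dsum E.complete_space_axioms)

interpretation K: complete_space lifting_space
  by (intro complete_space_dsum EE.complete_space_axioms H.complete_space_axioms)

lemma bop_brownian_lifting: "bop lifting_space lifting_space (brownian_lifting T X)"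
  by (intro bop_upper_blk bop_brownian bop_X bop_T EE.inner_space_axioms H.inner_space_axioms)

lemma defect_brownian_lifting:
  assumes "f \<in> hcar E" "g \<in> hcar E" "h \<in> hcar H"
  shows "defect lifting_space (brownian_lifting T X) ((f, g), h) = 2 * hsq E g + 2 * defect H T h"
  using assms brownian_couplingD(3)[OF coupling]
    defect_upper_blk[OF EE.inner_space_axioms bop_brownian brownian_couplingD(1,2)[OF coupling],
      of "(f, g)" h T]
  by (simp add: defect_brownian)

lemma two_isometry_brownian_lifting: "two_isometry lifting_space (brownian_lifting T X)"
proof (rule K.two_isometryI[OF bop_brownian_lifting])
  let ?S = "brownian_lifting T X"
  note Ei = E.inner_space_axioms
  fix x assume x: "x \<in> hcar lifting_space"
  then obtain f g h where fgh: "x = ((f, g), h)" "f \<in> hcar E" "g \<in> hcar E" "h \<in> hcar H" by auto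
  obtain f' where f': "?S x = ((f', hadd E (shift g) (snd (X h))), T h)"
    by (cases "X h") (simp add: fgh(1) upper_blk_def brownian_apply)
  have "bop H E (\<lambda>h. snd (X h))"
    by (intro bop_compose[OF bop_X bop_snd] Ei EE.inner_space_axioms)
  from hsq_upper_blk[OF Ei isometry_bop[OF isometry_shift] this brownian_couplingD(5)[OF coupling]
      fgh(3,4)]
  have "hsq E (hadd E (shift g) (snd (X h))) = hsq E g + (defect H T h - defect H T (T h))"
    using isometry_hsq[OF isometry_shift Ei Ei fgh(3)] brownian_couplingD(4)[OF coupling fgh(4)]
    by simp
  moreover have "?S x \<in> hcar lifting_space" using bop_brownian_lifting x by (rule bop_closed)
  ultimately have "defect lifting_space ?S (?S x)
      = 2 * (hsq E g + (defect H T h - defect H T (T h))) + 2 * defect H T (T h)"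
    unfolding f' by (subst defect_brownian_lifting) auto
  then show "defect lifting_space ?S (?S x) = defect lifting_space ?S x"
    using fgh by (simp add: defect_brownian_lifting)
qed

lemma brownian_lifting_defect_le_iff:
  assumes N: "0 \<le> N"
  shows "(\<forall>x\<in>hcar lifting_space.
      defect lifting_space (brownian_lifting T X) x \<le> N * hsq lifting_space x)
    \<longleftrightarrow> 2 * max 1 (opnorm H H (Delta H T)) \<le> N"
    (is "?bound \<longleftrightarrow> _")
proof
  assume bound: ?bound
  obtain e where e: "e \<in> hcar E" "0 < hsq E e" using exists_hsq_pos by blast
  have "2 * hsq E e + 2 * defect H T (hzero H) \<le> N * hsq E e"
    using bspec[OF bound, of "((hzero E, e), hzero H)"] e by (simp add: defect_brownian_lifting)
  then have "2 * hsq E e \<le> N * hsq E e" using defect_nonneg[OF H.zero_closed] by linarith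
  then have "2 \<le> N" using e(2) by (rule mult_right_le_imp_le)
  moreover have "defect H T h \<le> N / 2 * hsq H h" if "h \<in> hcar H" for h
    using bspec[OF bound, of "((hzero E, hzero E), h)"] that by (simp add: defect_brownian_lifting)
  then have "opnorm H H (Delta H T) \<le> N / 2" using opnorm_le_iff[of "N / 2"] N by simp
  ultimately show "2 * max 1 (opnorm H H (Delta H T)) \<le> N" by simp
next
  assume "2 * max 1 (opnorm H H (Delta H T)) \<le> N"
  then have le: "2 \<le> N" "opnorm H H (Delta H T) \<le> N / 2" by linarith+
  show ?bound
  proof
    fix x assume "x \<in> hcar lifting_space"
    then obtain f g h where x: "x = ((f, g), h)" "f \<in> hcar E" "g \<in> hcar E" "h \<in> hcar H" by auto
    have "0 \<le> N * hsq E f" "2 * hsq E g \<le> N * hsq E g"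
      using N le(1) x by (auto intro: mult_right_mono)
    moreover have "defect H T h \<le> N / 2 * hsq H h"
      using le(2) opnorm_le_iff[of "N / 2"] N x(4) by auto
    ultimately show "defect lifting_space (brownian_lifting T X) x \<le> N * hsq lifting_space x"
      using x by (simp add: defect_brownian_lifting distrib_left)
  qed
qed

lemma cov_brownian_lifting:
  "cov lifting_space (brownian_lifting T X) = sqrt 2 * max 1 (sqrt (opnorm H H (Delta H T)))"
proof -
  have "0 \<le> defect lifting_space (brownian_lifting T X) x" if "x \<in> hcar lifting_space" for x
    using that defect_nonneg by (auto simp: defect_brownian_lifting)
  moreover have "0 \<le> 2 * max 1 (opnorm H H (Delta H T))" using opnorm_nonneg by (simp add: max_def)
  ultimately have
    "cov lifting_space (brownian_lifting T X) = sqrt (2 * max 1 (opnorm H H (Delta H T)))"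
    by (rule K.cov_eqI[OF bop_brownian_lifting _ _ brownian_lifting_defect_le_iff])
  also have "\<dots> = sqrt 2 * max 1 (sqrt (opnorm H H (Delta H T)))"
    by (simp add: real_sqrt_mult max_def)
  finally show ?thesis .
qed

end

theorem concave_brownian_lifting:
  obtains X where "bop H (dsum E E) X"
    and "\<forall>h\<in>hcar H. hadj (dsum E E) (dsum E E) brownian (X h) = hzero (dsum E E)"
    and "two_isometry lifting_space (brownian_lifting T X)"
    and "cov lifting_space (brownian_lifting T X) = sqrt 2 * max 1 (sqrt (opnorm H H (Delta H T)))"
proof -
  interpret EE: complete_space "dsum E E" by (intro complete_space_dsum E.complete_space_axioms)
  obtain X where X: "brownian_coupling T X" using brownian_coupling_exists by blast
  note adj = hadj_orthogonal_eq_zero[OF EE.complete_space_axioms EE.inner_space_axioms bop_brownian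
      brownian_couplingD(1,2)[OF X]]
  show thesis
    using brownian_couplingD(1)[OF X] ballI[OF adj] two_isometry_brownian_lifting[OF X]
      cov_brownian_lifting[OF X]
    by (rule that)
qed

lemma isometric_coupling_exists:
  obtains X and q :: "'a \<Rightarrow> real" where "bop H E X" "orthogonal_ranges E H E shift X"
    and "\<And>h. h \<in> hcar H \<Longrightarrow> hsq E (X h) = q h - defect H T h"
    and "\<And>h. h \<in> hcar H \<Longrightarrow> q (T h) = q h"
    and "\<And>h. h \<in> hcar H \<Longrightarrow> q h \<le> opnorm H H (Delta H T) * hsq H h"
proof -
  let ?c = "opnorm H H (Delta H T)"
  have d: "positive_form H (defect_form H T)"
    using bop_T defect_nonneg by (rule H.positive_defect_form)
  have "hsq H h \<le> hsq H (T h)" if "h \<in> hcar H" for h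
    using defect_nonneg[OF that] by (simp add: defect_def)
  then obtain q where q: "positive_form H q" "\<And>h. h \<in> hcar H \<Longrightarrow> defect H T h \<le> quad q h"
    "\<And>h. h \<in> hcar H \<Longrightarrow> quad q h \<le> ?c * hsq H h"
    "\<And>h k. h \<in> hcar H \<Longrightarrow> k \<in> hcar H \<Longrightarrow> q (T h) (T k) = q h k"
    using H.invariant_form_between[OF bop_T _ d opnorm_nonneg, unfolded quad_defect_form,
        OF _ defect_le_opnorm defect_decreasing] by blast
  have "positive_form H (\<lambda>x y. q x y - defect_form H T x y)"
    using positive_form_hermitian[OF q(1)] positive_form_hermitian[OF d]
    by (rule H.positive_form_diff) (simp add: q(2))
  moreover have "quad q h - defect H T h \<le> ?c * hsq H h" if "h \<in> hcar H" for h
    using q(3)[OF that] defect_nonneg[OF that] by linarith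
  ultimately obtain X where "bop H E X" "\<And>h. h \<in> hcar H \<Longrightarrow> hsq E (X h) = quad q h - defect H T h"
    "orthogonal_ranges E H E shift X"
    using factorization[of "\<lambda>x y. q x y - defect_form H T x y" ?c] by auto
  then show thesis using q(3,4) by (intro that[of X "quad q"]) simp_all
qed

theorem concave_minimal_lifting:
  obtains G :: "'b cips" and W X
  where "complete_space G" "isometry G G W" "bop H G X"
    and "\<forall>g\<in>hcar G. upper_blk G W X T (g, hzero H) = (W g, hzero H)"
    and "\<forall>h\<in>hcar H. hadj G G W (X h) = hzero G"
    and "minimal_lifting G H (upper_blk G W X T) T" "two_isometry (dsum G H) (upper_blk G W X T)"
    and "cov (dsum G H) (upper_blk G W X T) = sqrt (opnorm H H (Delta H T))"
proof -
  obtain X and q :: "'a \<Rightarrow> real" where X: "bop H E X" "orthogonal_ranges E H E shift X"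
    "\<And>h. h \<in> hcar H \<Longrightarrow> hsq E (X h) = q h - defect H T h"
    and q: "\<And>h. h \<in> hcar H \<Longrightarrow> q (T h) = q h"
      "\<And>h. h \<in> hcar H \<Longrightarrow> q h \<le> opnorm H H (Delta H T) * hsq H h"
    using isometric_coupling_exists by blast
  note Ei = E.inner_space_axioms and Hi = H.inner_space_axioms
    and bop_shift = isometry_bop[OF isometry_shift]
  define G where "G = restrict_space E (orbit_span E shift (X ` hcar H))"
  have XE: "X ` hcar H \<subseteq> hcar E" using bop_closed[OF X(1)] by blast
  note L = E.closed_subspace_orbit_span[OF bop_shift XE]
  interpret G: complete_space G
    unfolding G_def using E.complete_space_axioms L by (rule complete_space_restrict)
  note Gi = G.inner_space_axioms
  have W: "bop G G shift" unfolding G_def using Ei bop_shift XE by (rule bop_restrict_orbit_span)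
  then have isometry: "isometry G G shift"
    using isometry_shift closed_subspaceD(1)[OF L] by (simp add: isometry_def G_def)
  have GX: "bop H G X" unfolding G_def using X(1) by (rule bop_into_restrict_orbit_span)
  have orth: "orthogonal_ranges G H G shift X"
    using X(2) closed_subspaceD(1)[OF L] by (simp add: orthogonal_ranges_def G_def)
  have "hsq G (X h) = q h - defect H T h" if "h \<in> hcar H" for h
    using X(3)[OF that] by (simp add: G_def)
  note lifting = isometric_upper_blk_lifting[OF G.complete_space_axioms H.complete_space_axioms
      concave isometry GX orth this q]
  have "orbit_span G shift (X ` hcar H) = hcar G"
    using orbit_span_restrict[OF Ei bop_shift XE] by (simp add: G_def)
  then have minimal: "minimal_lifting G H (upper_blk G shift X T) T"
    by (rule minimal_lifting_upper_blk[OF Gi Hi W GX bop_T])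
  show thesis
    using G.complete_space_axioms isometry GX ballI[OF upper_blk_inl[OF W GX bop_T Gi Hi]]
      ballI[OF hadj_orthogonal_eq_zero[OF G.complete_space_axioms Gi W GX orth]] minimal lifting
    by (rule that)
qed

end

end

section \<open>The ambient space\<close>

definition residue_spread :: "'v cips \<Rightarrow> nat \<Rightarrow> (nat \<Rightarrow> 'v) \<Rightarrow> nat \<Rightarrow> 'v" where
  "residue_spread V r = spread V (\<lambda>n. 3 * n + r)"

context inner_space
begin

lemma isometry_residue_spread: "isometry (ell2 V) (ell2 V) (residue_spread V r)"
  unfolding residue_spread_def by (intro isometry_spread strict_monoI) simp

lemma unilateral_shift_residue_spread: "0 < r \<Longrightarrow> unilateral_shift (ell2 V) (residue_spread V r)"
  unfolding residue_spread_def by (intro unilateral_shift_spread strict_monoI) simp_all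

lemma orthogonal_ranges_residue_spread:
  assumes "r \<noteq> s" "r < 3" "s < 3"
  shows "orthogonal_ranges (ell2 V) (ell2 V) (ell2 V) (residue_spread V r) (residue_spread V s)"
proof -
  have "3 * m + r \<noteq> 3 * n + s" for m n using assms by presburger
  then show ?thesis unfolding residue_spread_def by (intro orthogonal_ranges_spread) blast
qed

end

lemma positive_form_factorization_residue:
  assumes H: "complete_space H" and D: "complete_space D" and J: "isometry H D J"
    and q: "positive_form H q" and bound: "\<And>x. x \<in> hcar H \<Longrightarrow> quad q x \<le> c * hsq H x"
  obtains X where "bop H (ell2 D) X" "\<And>h. h \<in> hcar H \<Longrightarrow> hsq (ell2 D) (X h) = quad q h"
    and "\<And>r. 0 < r \<Longrightarrow> r < 3 \<Longrightarrow> orthogonal_ranges (ell2 D) H (ell2 D) (residue_spread D r) X"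
proof -
  interpret H: complete_space H by fact
  interpret D: complete_space D by fact
  note Hi = H.inner_space_ell2 and Di = D.inner_space_ell2
  obtain R where R: "bop H (ell2 H) R"
    "\<And>x y. x \<in> hcar H \<Longrightarrow> y \<in> hcar H \<Longrightarrow> hinner (ell2 H) (R x) (R y) = q x y"
    using H.positive_form_factorization[OF q bound] by blast
  define Y where "Y h n = J (R h n)" for h n
  note map = isometry_ell2_map[OF J H.inner_space_axioms D.inner_space_axioms]
  note spread = D.isometry_residue_spread[of 0]
  have Y: "bop H (ell2 D) Y"
    using bop_compose[OF R(1) isometry_bop[OF map] Hi] by (simp add: Y_def[abs_def])
  show thesis
  proof (rule that)
    show "bop H (ell2 D) (\<lambda>h. residue_spread D 0 (Y h))"
      using Y isometry_bop[OF spread] Di by (rule bop_compose)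
    show "hsq (ell2 D) (residue_spread D 0 (Y h)) = quad q h" if "h \<in> hcar H" for h
      using isometry_hsq[OF spread Di Di bop_closed[OF Y that]] R(2)[OF that that]
        isometry_hsq[OF map Hi Di bop_closed[OF R(1) that]]
      by (simp add: Y_def[abs_def] hsq_def[of "ell2 H"])
    show "orthogonal_ranges (ell2 D) H (ell2 D) (residue_spread D r) (\<lambda>h. residue_spread D 0 (Y h))"
      if "0 < r" "r < 3" for r
      using orthogonal_rangesD[OF D.orthogonal_ranges_residue_spread[of r 0]] that bop_closed[OF Y]
      by (simp add: orthogonal_ranges_def)
  qed
qed

lemma ambient_space_ell2:
  assumes H: "complete_space H"
  shows "ambient_space H (ell2 (dsum H complex_line))
    (residue_spread (dsum H complex_line) 1) (residue_spread (dsum H complex_line) 2)"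
proof -
  let ?D = "dsum H complex_line"
  let ?E = "ell2 ?D"
  have D: "complete_space ?D" by (intro complete_space_dsum H complete_space_complex_line)
  interpret H: complete_space H by fact
  interpret C: complete_space complex_line by (rule complete_space_complex_line)
  interpret D: complete_space ?D by (rule D)
  interpret E: complete_space ?E using D by (rule complete_space_ell2)
  show ?thesis
  proof
    let ?v = "single ?D 0 (hzero H, 1)"
    have "?v 0 \<noteq> hzero ?E 0" by (simp add: single_def)
    then have "?v \<noteq> hzero ?E" by metis
    moreover have "?v \<in> hcar ?E" by (rule D.single_closed) simp
    ultimately show "hcar ?E \<noteq> {hzero ?E}" by blast
    show "unilateral_shift ?E (residue_spread ?D 1)"
      by (rule D.unilateral_shift_residue_spread) simp
    show "isometry ?E ?E (residue_spread ?D 2)" by (rule D.isometry_residue_spread)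
    show "orthogonal_ranges ?E ?E ?E (residue_spread ?D 1) (residue_spread ?D 2)"
      by (rule D.orthogonal_ranges_residue_spread) simp_all
    fix q c assume "positive_form H q" "\<And>x. x \<in> hcar H \<Longrightarrow> quad q x \<le> c * hsq H x"
    then obtain X where "bop H ?E X" "\<And>h. h \<in> hcar H \<Longrightarrow> hsq ?E (X h) = quad q h"
      "\<And>r. 0 < r \<Longrightarrow> r < 3 \<Longrightarrow> orthogonal_ranges ?E H ?E (residue_spread ?D r) X"
      using positive_form_factorization_residue[OF H D isometry_inl[OF C.inner_space_axioms]]
      by blast
    then show "\<exists>X. bop H ?E X \<and> (\<forall>h\<in>hcar H. hsq ?E (X h) = quad q h) \<and>
        orthogonal_ranges ?E H ?E (residue_spread ?D 1) X \<and>
        orthogonal_ranges ?E H ?E (residue_spread ?D 2) X"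
      by (intro exI[of _ X]) simp
  qed
qed

theorem theorem2p1:
  fixes H :: "'a cips" and T :: "'a \<Rightarrow> 'a"
  assumes "hilbert_space H" and "bop H H T" and "concave_op H T"
  shows "(\<exists>(G1 :: 'a bigT cips) (G0 :: 'a bigT cips) S1 S0 E0 X W S.
            hilbert_space G1 \<and> hilbert_space G0 \<and>
            hcar G1 \<noteq> {hzero G1} \<and> hcar G0 \<noteq> {hzero G0} \<and>
            unilateral_shift G1 S1 \<and> unilateral_shift G0 S0 \<and>
            isometry G0 G1 E0 \<and> bop H (dsum G1 G0) X \<and>
            W = upper_blk G1 S1 (\<lambda>y. hscale G1 (complex_of_real (sqrt 2)) (E0 y)) S0 \<and>
            two_isometry (dsum G1 G0) W \<and>
            (\<forall>h\<in>hcar H. hadj (dsum G1 G0) (dsum G1 G0) W (X h) = hzero (dsum G1 G0)) \<and>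
            S = upper_blk (dsum G1 G0) W X T \<and>
            is_lifting (dsum G1 G0) H S T \<and>
            two_isometry (dsum (dsum G1 G0) H) S \<and>
            cov (dsum (dsum G1 G0) H) S = sqrt 2 * max 1 (sqrt (opnorm H H (Delta H T))))
       \<and> (\<exists>(G :: 'a bigT cips) W X S.
            hilbert_space G \<and> isometry G G W \<and> bop H G X \<and>
            S = upper_blk G W X T \<and>
            (\<forall>g\<in>hcar G. S (g, hzero H) = (W g, hzero H)) \<and>
            (\<forall>h\<in>hcar H. hadj G G W (X h) = hzero G) \<and>
            minimal_lifting G H S T \<and>
            two_isometry (dsum G H) S \<and>
            cov (dsum G H) S = sqrt (opnorm H H (Delta H T)))"
proof -
  let ?E = "ell2 (dsum H complex_line)"
  let ?s = "residue_spread (dsum H complex_line) 1"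
    and ?e = "residue_spread (dsum H complex_line) 2"
  have "complete_space H" using assms(1) by (simp only: hilbert_space_iff)
  then interpret ambient_space H ?E ?s ?e by (rule ambient_space_ell2)
  show ?thesis
  proof (rule conjI, goal_cases)
    case 1
    show ?case
    proof (rule concave_brownian_lifting[OF assms(3)], goal_cases)
      case (1 X)
      show ?case
        by (rule exI[of _ ?E], rule exI[of _ ?E], rule exI[of _ ?s], rule exI[of _ ?s],
            rule exI[of _ ?e], rule exI[of _ X], rule exI[of _ brownian],
            rule exI[of _ "brownian_lifting T X"])
          (intro conjI refl E.complete_space_axioms[folded hilbert_space_iff] nontrivial
            unilateral_shift isometry_embed brownian_def two_isometry_brownian is_lifting_upper_blk 1)
    qed
  next
    case 2
    show ?case
      by (rule concave_minimal_lifting[OF assms(3)], unfold hilbert_space_iff) blast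
  qed
qed

end
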